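(* Let $\mathcal G=\mathcal T$ or $\mathcal G=\mathcal T_o$, and let $p\in(2,6)$. Then, defining $$\mu^*_{\mathcal G,r}:=\max\left\{\mu\ge0:\ \mathcal L_{\mathcal G,r}(\mu)=\tfrac12\lambda_1\mu\right\},$$ there holds $\mu^*_{\mathcal G,r}>0$, and the function $\mathcal L_{\mathcal G,r}:[0,\infty)\to\mathbb R$ is concave and such that $\mathcal L_{\mathcal G,r}(\mu)=\frac12\lambda_1\mu$ if $\mu\in[0,\mu^*_{\mathcal G,r}]$, $\mathcal L_{\mathcal G,r}(\mu)<\frac12\lambda_1\mu$ if $\mu>\mu^*_{\mathcal G,r}$, and $\mathcal L_{\mathcal G,r}(\mu)<0$ if $\mu$ is large enough. Finally, radial ground states of mass $\mu$ on $\mathcal G$ exist if $\mu\ge\mu^*_{\mathcal G,r}$, whereas they do not exist if $\mu\in(0,\mu^*_{\mathcal G,r})$.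
   Context: $\mathcal T$ (unrooted binary tree) is the infinite metric tree with all edges of length $1$ in which every vertex has degree $3$. $\mathcal T_o$ (rooted binary tree) is the infinite metric tree with all edges of length $1$ in which every vertex has degree $3$, except one vertex $o$ (the root), which has degree $1$. For $\mathcal G=\mathcal T$, an arbitrary vertex is fixed and denoted $o$. For $x\in\mathcal G$, $|x|$ is the geodesic distance from $x$ to $o$. For $\mathcal G\in\{\mathcal T,\mathcal T_o\}$, $H^1(\mathcal G)$ is the space of continuous real-valued functions on $\mathcal G$ whose restriction to each edge is $H^1$ and such that $\int_{\mathcal G}(|u'|^2+|u|^2)\,dx<\infty$; all integrals and $L^p$ norms are with respect to the length measure. A function $u\in H^1(\mathcal G)$ is radial if $u(x)$ depends only on $|x|$. For $\mu\ge0$, $H^1_\mu(\mathcal G):=\{u\in H^1(\mathcal G):\int_{\mathcal G}|u|^2dx=\mu\}$ and $H^1_{\mu,r}(\mathcal G):=\{u\in H^1_\mu(\mathcal G): u\text{ is radial}\}$. The NLS energy is $E(u,\mathcal G):=\frac12\int_{\mathcal G}|u'|^2dx-\frac1p\int_{\mathcal G}|u|^pdx$, and $\mathcal L_{\mathcal G,r}(\mu):=\inf_{u\in H^1_{\mu,r}(\mathcal G)}E(u,\mathcal G)$ for $\mu\ge0$. A radial ground state of mass $\mu$ is a function $u\in H^1_{\mu,r}(\mathcal G)$ with $E(u,\mathcal G)=\mathcal L_{\mathcal G,r}(\mu)$. The constant $\lambda_1$ (infimum over all, not only radial, functions) is $\lambda_1:=\inf_{0\not\equiv u\in H^1(\mathcal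 T)}\frac{\int_{\mathcal T}|u'|^2dx}{\int_{\mathcal T}|u|^2dx}=\inf_{0\not\equiv u\in H^1(\mathcal T_o)}\frac{\int_{\mathcal T_o}|u'|^2dx}{\int_{\mathcal T_o}|u|^2dx}>0$ (it is known that the two infima coincide and are positive). *)

theory Defs
  imports "HOL-Analysis.Analysis" "Graph_Theory.Digraph"
begin

section \<open>Metric graphs with edges of length one\<close>

text \<open>
  A metric graph is given by a multigraph whose edges carry an orientation, used only to
  parametrise them: the edge \<open>e\<close> is a copy of \<open>[0,1]\<close>, where \<open>0\<close> is \<open>tail G e\<close> and \<open>1\<close> is
  \<open>head G e\<close>. The pair \<open>(e, t)\<close> stands for the point of \<open>e\<close> with coordinate \<open>t\<close>.
  Hence a vertex has one name for each edge end incident with it, and a function on the metric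
  graph is a function of \<open>(e, t)\<close> which agrees on all names of a vertex.
  Values outside \<open>points G\<close> are irrelevant in all that follows.
\<close>

definition points :: "('v, 'e) pre_digraph \<Rightarrow> ('e \<times> real) set" where
  "points G = arcs G \<times> {0..1}"

definition length_measure :: "('v, 'e) pre_digraph \<Rightarrow> ('e \<times> real) measure" where
  "length_measure G = count_space (arcs G) \<Otimes>\<^sub>M restrict_space lborel {0..1}"

definition adjacency :: "('v, 'e) pre_digraph \<Rightarrow> ('v \<times> 'v) set" where
  "adjacency G = {(v, w). \<exists>e\<in>arcs G. {v, w} = {tail G e, head G e}}"

definition vertex_dist :: "('v, 'e) pre_digraph \<Rightarrow> 'v \<Rightarrow> 'v \<Rightarrow> nat" where
  "vertex_dist G v w = (LEAST n. (v, w) \<in> adjacency G ^^ n)"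

text \<open>A geodesic from the vertex \<open>v\<close> enters an edge through one of its two ends.\<close>

definition geodesic_dist :: "('v, 'e) pre_digraph \<Rightarrow> 'v \<Rightarrow> 'e \<times> real \<Rightarrow> real" where
  "geodesic_dist G v = (\<lambda>(e, t).
     min (real (vertex_dist G v (tail G e)) + t) (real (vertex_dist G v (head G e)) + (1 - t)))"

definition continuous_on_graph :: "('v, 'e) pre_digraph \<Rightarrow> ('e \<times> real \<Rightarrow> real) \<Rightarrow> bool" where
  "continuous_on_graph G u \<longleftrightarrow>
     (\<forall>e\<in>arcs G. continuous_on {0..1} (\<lambda>t. u (e, t))) \<and>
     (\<exists>f. \<forall>e\<in>arcs G. u (e, 0) = f (tail G e) \<and> u (e, 1) = f (head G e))"


section \<open>The Sobolev spaces\<close>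

definition L2_unit :: "(real \<Rightarrow> real) \<Rightarrow> bool" where
  "L2_unit f \<longleftrightarrow> set_borel_measurable lborel {0<..<1} f \<and>
     set_integrable lborel {0<..<1} (\<lambda>t. (f t)\<^sup>2)"

text \<open>
  Weak derivatives on \<open>(0,1)\<close>, with continuously differentiable compactly supported test functions
  (as in Brezis, \<^emph>\<open>Functional Analysis, Sobolev Spaces and PDE\<close>, Section 8.2).
\<close>

definition test_function :: "(real \<Rightarrow> real) \<Rightarrow> bool" where
  "test_function \<phi> \<longleftrightarrow> (\<forall>t. \<phi> differentiable (at t)) \<and> continuous_on UNIV (deriv \<phi>) \<and>
     (\<exists>a b. 0 < a \<and> b < 1 \<and> (\<forall>t. t \<notin> {a..b} \<longrightarrow> \<phi> t = 0))"

definition has_L2_weak_deriv :: "(real \<Rightarrow> real) \<Rightarrow> (real \<Rightarrow> real) \<Rightarrow> bool" where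
  "has_L2_weak_deriv f g \<longleftrightarrow> L2_unit g \<and>
     (\<forall>\<phi>. test_function \<phi> \<longrightarrow>
        (LINT t:{0<..<1}|lborel. f t * deriv \<phi> t) = - (LINT t:{0<..<1}|lborel. g t * \<phi> t))"

definition H1_unit :: "(real \<Rightarrow> real) \<Rightarrow> bool" where
  "H1_unit f \<longleftrightarrow> L2_unit f \<and> (\<exists>g. has_L2_weak_deriv f g)"

text \<open>The weak derivative is determined almost everywhere only, which suffices for integrals.\<close>

definition weak_deriv :: "(real \<Rightarrow> real) \<Rightarrow> real \<Rightarrow> real" where
  "weak_deriv f = (SOME g. has_L2_weak_deriv f g)"

definition graph_deriv :: "('e \<times> real \<Rightarrow> real) \<Rightarrow> 'e \<times> real \<Rightarrow> real" where
  "graph_deriv u = (\<lambda>(e, t). weak_deriv (\<lambda>s. u (e, s)) t)"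

definition H1 :: "('v, 'e) pre_digraph \<Rightarrow> ('e \<times> real \<Rightarrow> real) set" where
  "H1 G = {u. continuous_on_graph G u \<and>
     (\<forall>e\<in>arcs G. H1_unit (\<lambda>t. u (e, t))) \<and>
     integrable (length_measure G) (\<lambda>x. (graph_deriv u x)\<^sup>2 + (u x)\<^sup>2)}"

definition H1_mass :: "('v, 'e) pre_digraph \<Rightarrow> real \<Rightarrow> ('e \<times> real \<Rightarrow> real) set" where
  "H1_mass G \<mu> = {u \<in> H1 G. (\<integral>x. (u x)\<^sup>2 \<partial>length_measure G) = \<mu>}"

definition radial :: "('v, 'e) pre_digraph \<Rightarrow> 'v \<Rightarrow> ('e \<times> real \<Rightarrow> real) \<Rightarrow> bool" where
  "radial G v u \<longleftrightarrow>
     (\<forall>x\<in>points G. \<forall>y\<in>points G. geodesic_dist G v x = geodesic_dist G v y \<longrightarrow> u x = u y)"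

definition H1_mass_radial ::
    "('v, 'e) pre_digraph \<Rightarrow> 'v \<Rightarrow> real \<Rightarrow> ('e \<times> real \<Rightarrow> real) set" where
  "H1_mass_radial G v \<mu> = {u \<in> H1_mass G \<mu>. radial G v u}"


section \<open>Energy and ground states\<close>

definition energy :: "real \<Rightarrow> ('v, 'e) pre_digraph \<Rightarrow> ('e \<times> real \<Rightarrow> real) \<Rightarrow> real" where
  "energy p G u = 1/2 * (\<integral>x. (graph_deriv u x)\<^sup>2 \<partial>length_measure G)
     - 1/p * (\<integral>x. \<bar>u x\<bar> powr p \<partial>length_measure G)"

definition radial_level :: "real \<Rightarrow> ('v, 'e) pre_digraph \<Rightarrow> 'v \<Rightarrow> real \<Rightarrow> real" where
  "radial_level p G v \<mu> = (INF u \<in> H1_mass_radial G v \<mu>. energy p G u)"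

definition radial_ground_state ::
    "real \<Rightarrow> ('v, 'e) pre_digraph \<Rightarrow> 'v \<Rightarrow> real \<Rightarrow> ('e \<times> real \<Rightarrow> real) \<Rightarrow> bool" where
  "radial_ground_state p G v \<mu> u \<longleftrightarrow>
     u \<in> H1_mass_radial G v \<mu> \<and> energy p G u = radial_level p G v \<mu>"

definition rayleigh_inf :: "('v, 'e) pre_digraph \<Rightarrow> real" where
  "rayleigh_inf G = (INF u \<in> {u \<in> H1 G. \<exists>x\<in>points G. u x \<noteq> 0}.
     (\<integral>x. (graph_deriv u x)\<^sup>2 \<partial>length_measure G) / (\<integral>x. (u x)\<^sup>2 \<partial>length_measure G))"


section \<open>The binary trees\<close>

text \<open>
  A vertex is the word recording, from right to left, the successive choices made on the path that
  leads to it from the vertex \<open>o\<close>, which is the empty word. There are \<open>k\<close> choices at \<open>o\<close> and two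
  choices at every other vertex. Every other vertex \<open>w\<close> names the edge that joins it to its
  predecessor \<open>tl w\<close>.
\<close>

inductive_set tree_verts :: "nat \<Rightarrow> nat list set" for k :: nat where
  root: "[] \<in> tree_verts k"
| first: "i < k \<Longrightarrow> [i] \<in> tree_verts k"
| step: "w \<in> tree_verts k \<Longrightarrow> w \<noteq> [] \<Longrightarrow> i < 2 \<Longrightarrow> i # w \<in> tree_verts k"

definition binary_tree :: "nat \<Rightarrow> (nat list, nat list) pre_digraph" where
  "binary_tree k = \<lparr>verts = tree_verts k, arcs = tree_verts k - {[]}, tail = tl, head = (\<lambda>w. w)\<rparr>"

text \<open>
  The unrooted tree is vertex-transitive, so that addressing its vertices from the chosen
  vertex \<open>o\<close> is no restriction.
\<close>

definition unrooted_binary_tree :: "(nat list, nat list) pre_digraph" where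
  "unrooted_binary_tree = binary_tree 3"

definition rooted_binary_tree :: "(nat list, nat list) pre_digraph" where
  "rooted_binary_tree = binary_tree 1"

definition lambda1 :: real where
  "lambda1 = rayleigh_inf unrooted_binary_tree"

definition mu_star :: "real \<Rightarrow> (nat list, nat list) pre_digraph \<Rightarrow> real" where
  "mu_star p G = (GREATEST \<mu>. 0 \<le> \<mu> \<and> radial_level p G [] \<mu> = 1/2 * lambda1 * \<mu>)"


subsection \<open>The trees have the required shape\<close>

lemma binary_tree_simps [simp]:
  "verts (binary_tree k) = tree_verts k" "arcs (binary_tree k) = tree_verts k - {[]}"
  "tail (binary_tree k) = tl" "head (binary_tree k) = (\<lambda>w. w)"
  by (simp_all add: binary_tree_def)

lemma Cons_in_tree_verts:
  "i # w \<in> tree_verts k \<longleftrightarrow> w \<in> tree_verts k \<and> i < (if w = [] then k else 2)"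
  by (auto elim: tree_verts.cases intro: tree_verts.intros)

lemma tl_in_tree_verts: "w \<in> tree_verts k \<Longrightarrow> tl w \<in> tree_verts k"
  by (cases w) (auto simp: Cons_in_tree_verts)

lemma wf_digraph_binary_tree: "wf_digraph (binary_tree k)"
  by unfold_locales (auto intro: tl_in_tree_verts)

lemma binary_tree_degree:
  assumes "w \<in> tree_verts k"
  shows "in_degree (binary_tree k) w + out_degree (binary_tree k) w = (if w = [] then k else 3)"
proof -
  have "out_arcs (binary_tree k) w = (\<lambda>i. i # w) ` {..<(if w = [] then k else 2)}"
  proof -
    have "(v \<in> tree_verts k \<and> v \<noteq> [] \<and> tl v = w) \<longleftrightarrow>
        v \<in> (\<lambda>i. i # w) ` {..<(if w = [] then k else 2)}" for v
      using assms by (cases v) (auto simp: Cons_in_tree_verts)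
    then show ?thesis by (auto simp: out_arcs_def)
  qed
  then have "out_degree (binary_tree k) w = (if w = [] then k else 2)"
    by (simp add: out_degree_def card_image inj_on_def)
  moreover have "in_arcs (binary_tree k) w = (if w = [] then {} else {w})"
    using assms by (auto simp: in_arcs_def)
  then have "in_degree (binary_tree k) w = (if w = [] then 0 else 1)"
    by (simp add: in_degree_def)
  ultimately show ?thesis by simp
qed

lemma unrooted_binary_tree_degree:
  "v \<in> verts unrooted_binary_tree \<Longrightarrow>
     in_degree unrooted_binary_tree v + out_degree unrooted_binary_tree v = 3"
  using binary_tree_degree[of v 3] by (simp add: unrooted_binary_tree_def)

lemma rooted_binary_tree_degree:
  "v \<in> verts rooted_binary_tree \<Longrightarrow>
     in_degree rooted_binary_tree v + out_degree rooted_binary_tree v = (if v = [] then 1 else 3)"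
  using binary_tree_degree[of v 1] by (simp add: rooted_binary_tree_def)

lemma root_connected:
  assumes "w \<in> tree_verts k"
  shows "([], w) \<in> adjacency (binary_tree k) ^^ length w"
  using assms
proof induction
  case (first i)
  then have "[i] \<in> arcs (binary_tree k)" by (simp add: tree_verts.intros)
  then show ?case by (auto simp: adjacency_def intro!: bexI[of _ "[i]"])
next
  case (step w i)
  then have "(w, i # w) \<in> adjacency (binary_tree k)"
    by (auto simp: adjacency_def Cons_in_tree_verts intro!: bexI[of _ "i # w"])
  with step show ?case by auto
qed simp

text \<open>Every edge is a bridge; together with connectedness this says that the graph is a tree.\<close>

lemma edge_is_bridge:
  assumes "e \<in> arcs (binary_tree k)"
  shows "(e, tl e) \<notin> (adjacency (binary_tree k\<lparr>arcs := arcs (binary_tree k) - {e}\<rparr>))\<^sup>*"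
proof
  let ?R = "adjacency (binary_tree k\<lparr>arcs := arcs (binary_tree k) - {e}\<rparr>)"
  assume "(e, tl e) \<in> ?R\<^sup>*"
  then have "\<exists>xs. tl e = xs @ e"
  proof (induction rule: rtrancl_induct)
    case (step y z)
    then obtain xs where y: "y = xs @ e" by auto
    from step(2) obtain d where d: "d \<noteq> []" "d \<noteq> e" "y = d \<and> z = tl d \<or> y = tl d \<and> z = d"
      by (auto simp: adjacency_def doubleton_eq_iff)
    show ?case
    proof (cases "y = d")
      case True
      with d y have "xs \<noteq> []" "z = tl (xs @ e)" by auto
      then show ?thesis by (metis tl_append2)
    next
      case False
      with d y have "z = hd d # xs @ e" by (cases d) auto
      then show ?thesis by (metis append_Cons)
    qed
  qed auto
  then obtain xs where "tl e = xs @ e" by blast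
  then have "length (tl e) \<ge> length e" by simp
  with assms show False by (cases e) auto
qed

lemma vertex_dist_root:
  assumes "w \<in> tree_verts k"
  shows "vertex_dist (binary_tree k) [] w = length w"
proof -
  have le: "length v \<le> n" if "([], v) \<in> adjacency (binary_tree k) ^^ n" for v n
    using that
  proof (induction n arbitrary: v)
    case (Suc n)
    then obtain y where y: "([], y) \<in> adjacency (binary_tree k) ^^ n"
        "(y, v) \<in> adjacency (binary_tree k)"
      by auto
    then have "length v \<le> Suc (length y)"
      by (auto simp: adjacency_def doubleton_eq_iff)
    with Suc.IH[OF y(1)] show ?case by simp
  qed auto
  show ?thesis
    unfolding vertex_dist_def by (rule Least_equality) (auto simp: root_connected assms le)
qed

lemma geodesic_dist_root:
  assumes "(w, t) \<in> points (binary_tree k)"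
  shows "geodesic_dist (binary_tree k) [] (w, t) = real (length w) - 1 + t"
proof -
  from assms have w: "w \<in> tree_verts k" "w \<noteq> []" and t: "0 \<le> t" "t \<le> 1"
    by (auto simp: points_def)
  then have "real (length (tl w)) = real (length w) - 1" by (cases w) auto
  with w t show ?thesis
    by (simp add: geodesic_dist_def vertex_dist_root tl_in_tree_verts)
qed

end

theory Submission
  imports Defs "HOL-Complex_Analysis.Great_Picard" "HOL-Real_Asymp.Real_Asymp"
begin

text \<open>
  The proof reduces the statement to functions on a half-line and then to a set of triples of real
  numbers.

  A radial function is given by its restrictions to the edges of a ray, its profile. Level \<open>n\<close> has
  \<open>k\<close> times two to the power \<open>n\<close> edges, where \<open>k\<close> is the number of edges at the root. Hence mass,
  kinetic and potential energy are series over the levels, and \<open>k\<close> enters only as a factor.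

  The bottom of the spectrum is found with the method of a positive generalised eigenfunction. On
  every edge of level \<open>n\<close> it is \<open>ground\<close>, a piece of a cosine, times the power \<open>- n / 2\<close> of two. By
  \<open>excess_eq\<close> the difference of the kinetic energy and \<open>spec\<close> times the mass on an edge is a
  nonnegative integral plus terms at the two ends, and the latter cancel at every vertex except the
  root, where the sign is right. For arbitrary functions this gives \<open>H1_spectral_gap\<close>. As the
  eigenfunction times a slowly decaying exponential is a trial function, the constant \<open>lambda1\<close> is
  \<open>spec\<close>, which is \<open>arctan (1 / (2 * sqrt 2))\<close> squared.

  For a radial function, the difference of the kinetic energy and \<open>lambda1\<close> times the mass, its
  deficit, is in this way a one-dimensional Dirichlet integral of the quotient by the eigenfunction.
  The quotient grows at most like the square root of the distance. In the potential energy the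
  \<open>p\<close>-th power of the eigenfunction decays faster than the number of edges grows, since \<open>p > 2\<close>.
  This has two consequences. The potential energy is at most a constant times the deficit to the
  power \<open>p / 2\<close> (\<open>potential_le_deficit\<close>). It is also continuous along sequences of bounded mass and
  deficit which converge pointwise, while mass and deficit are lower semicontinuous along them
  (\<open>profile_compactness\<close>). So there is compactness for radial functions, and the only
  defect is that mass can escape at cost \<open>lambda1 / 2\<close> per unit.

  The variational argument uses only these properties. The level is concave, as an infimum of
  the concave functions obtained by scaling a function of mass one. It is at most
  \<open>lambda1 * \<mu> / 2\<close>, and equality holds for small \<open>\<mu>\<close>: if the deficit is small, the potential
  energy, being of higher order, is dominated by it; otherwise \<open>p < 6\<close> makes the potential energy
  grow slower than the kinetic energy, with a factor that is small with the mass. By concavity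
  equality holds on an interval, whose right end is the threshold. A minimiser below the threshold
  would, multiplied by a constant, have too small an energy at the threshold. Above it, the level
  minus \<open>lambda1 * \<mu> / 2\<close> is negative and strictly decreasing, so that minimising sequences lose
  no mass. At the threshold, competitors for slightly larger masses have a deficit
  bounded from below, and hence their limit does not vanish; as it cannot be a minimiser of smaller
  mass, it has the full mass.
\<close>

section \<open>Square-integrable functions on the unit interval\<close>

abbreviation unit_leb :: "real measure" where
  "unit_leb \<equiv> restrict_space lborel {0..1}"

lemma space_unit_leb: "space unit_leb = {0..1}"
  by (simp add: space_restrict_space)

interpretation unit_leb: finite_measure unit_leb
  by (rule finite_measureI) (simp add: space_unit_leb emeasure_restrict_space)

lemma measure_unit_leb_Icc: "0 \<le> a \<Longrightarrow> a \<le> b \<Longrightarrow> b \<le> 1 \<Longrightarrow> measure unit_leb {a..b} = b - a"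
  by (subst measure_restrict_space) auto

lemma measure_unit_leb_space: "measure unit_leb {0..1} = 1"
  using measure_unit_leb_Icc[of 0 1] by simp

lemma measurable_unit_leb_borel: "f \<in> borel_measurable borel \<Longrightarrow> f \<in> borel_measurable unit_leb"
  by (simp add: measurable_restrict_space1)

lemma continuous_on_borel_measurable_unit:
  fixes f :: "real \<Rightarrow> real"
  shows "continuous_on {0..1} f \<Longrightarrow> f \<in> borel_measurable unit_leb"
proof -
  have "sets unit_leb = sets (restrict_space borel {0..1})"
    by (rule sets_restrict_space_cong) simp
  then show "continuous_on {0..1} f \<Longrightarrow> f \<in> borel_measurable unit_leb"
    using borel_measurable_continuous_on_restrict[of "{0..1}" f] measurable_cong_sets[OF _ refl] by blast
qed

lemma continuous_on_unit_bounded: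
  fixes f :: "real \<Rightarrow> real"
  assumes "continuous_on {0..1} f"
  obtains K where "K \<ge> 0" "\<And>t. t \<in> {0..1} \<Longrightarrow> \<bar>f t\<bar> \<le> K"
proof -
  have "bounded (f ` {0..1})"
    by (intro compact_imp_bounded compact_continuous_image assms) auto
  then obtain K where "\<forall>x\<in>f ` {0..1}. norm x \<le> K" unfolding bounded_iff by blast
  then have "\<And>t. t \<in> {0..1} \<Longrightarrow> \<bar>f t\<bar> \<le> K" by simp
  moreover from this[of 0] have "K \<ge> 0" by auto
  ultimately show ?thesis using that by blast
qed

lemma integrable_unit_bounded:
  fixes f :: "real \<Rightarrow> real"
  assumes "f \<in> borel_measurable unit_leb" "\<And>t. t \<in> {0..1} \<Longrightarrow> \<bar>f t\<bar> \<le> K"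
  shows "integrable unit_leb f"
proof (rule unit_leb.integrable_const_bound[where B = K])
  show "AE t in unit_leb. norm (f t) \<le> K"
    by (rule AE_I2) (simp add: space_unit_leb assms)
qed fact

lemma continuous_on_integrable_unit:
  fixes f :: "real \<Rightarrow> real"
  assumes "continuous_on {0..1} f"
  shows "integrable unit_leb f"
proof -
  obtain K where "\<And>t. t \<in> {0..1} \<Longrightarrow> \<bar>f t\<bar> \<le> K"
    using continuous_on_unit_bounded[OF assms] by blast
  then show ?thesis
    by (rule integrable_unit_bounded[OF continuous_on_borel_measurable_unit[OF assms]])
qed

lemma integral_unit_bound:
  fixes f :: "real \<Rightarrow> real"
  assumes "integrable unit_leb f" "\<And>t. t \<in> {0..1} \<Longrightarrow> f t \<le> K"
  shows "(\<integral>t. f t \<partial>unit_leb) \<le> K"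
proof -
  have "(\<integral>t. f t \<partial>unit_leb) \<le> (\<integral>t. K \<partial>unit_leb)"
    by (rule integral_mono) (simp_all add: assms space_unit_leb)
  then show ?thesis by (simp add: space_unit_leb measure_unit_leb_space)
qed

definition L2 :: "(real \<Rightarrow> real) \<Rightarrow> bool" where
  "L2 q \<longleftrightarrow> q \<in> borel_measurable unit_leb \<and> integrable unit_leb (\<lambda>t. (q t)\<^sup>2)"

lemma L2_measurable: "L2 q \<Longrightarrow> q \<in> borel_measurable unit_leb"
  by (simp add: L2_def)

lemma L2_sq_integrable: "L2 q \<Longrightarrow> integrable unit_leb (\<lambda>t. (q t)\<^sup>2)"
  by (simp add: L2_def)

lemma L2_mult_integrable:
  assumes "L2 q" "L2 r"
  shows "integrable unit_leb (\<lambda>t. q t * r t)"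
proof (rule Bochner_Integration.integrable_bound)
  show "integrable unit_leb (\<lambda>t. (q t)\<^sup>2 + (r t)\<^sup>2)"
    using assms by (simp add: L2_sq_integrable)
  show "(\<lambda>t. q t * r t) \<in> borel_measurable unit_leb"
    using assms by (intro borel_measurable_times L2_measurable)
  have "\<bar>a * b\<bar> \<le> a\<^sup>2 + b\<^sup>2" for a b :: real
  proof -
    have "0 \<le> \<bar>a\<bar> * \<bar>b\<bar>" "2 * \<bar>a\<bar> * \<bar>b\<bar> \<le> \<bar>a\<bar>\<^sup>2 + \<bar>b\<bar>\<^sup>2"
      using sum_squares_bound[of "\<bar>a\<bar>" "\<bar>b\<bar>"] by simp_all
    then show ?thesis unfolding abs_mult power2_abs by linarith
  qed
  then show "AE t in unit_leb. norm (q t * r t) \<le> norm ((q t)\<^sup>2 + (r t)\<^sup>2)"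
    by simp
qed

lemma L2_const: "L2 (\<lambda>_. c)"
  by (simp add: L2_def)

lemma L2_integrable: "L2 q \<Longrightarrow> integrable unit_leb q"
  using L2_mult_integrable[OF _ L2_const[of 1]] by simp

lemma L2_cmult: "L2 q \<Longrightarrow> L2 (\<lambda>t. c * q t)"
  by (simp add: L2_def power_mult_distrib borel_measurable_times)

lemma L2_add: 
  assumes "L2 q" "L2 r" shows "L2 (\<lambda>t. q t + r t)"
proof -
  have "integrable unit_leb (\<lambda>t. (q t)\<^sup>2 + (r t)\<^sup>2 + 2 * (q t * r t))"
    using assms by (intro Bochner_Integration.integrable_add integrable_mult_right L2_mult_integrable L2_sq_integrable)
  then show ?thesis using assms by (simp add: L2_def power2_sum mult.assoc borel_measurable_add)
qed

lemma L2_diff: 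
  assumes "L2 q" "L2 r" shows "L2 (\<lambda>t. q t - r t)"
  using L2_add[OF assms(1) L2_cmult[OF assms(2), of "-1"]] by simp

lemma L2_mult_bounded:
  assumes "L2 q" and [measurable]: "\<eta> \<in> borel_measurable unit_leb"
    and K: "\<And>t. t \<in> {0..1} \<Longrightarrow> \<bar>\<eta> t\<bar> \<le> K"
  shows "L2 (\<lambda>t. \<eta> t * q t)"
  unfolding L2_def
proof
  have [measurable]: "q \<in> borel_measurable unit_leb" using assms by (simp add: L2_def)
  show "(\<lambda>t. \<eta> t * q t) \<in> borel_measurable unit_leb" by measurable
  show "integrable unit_leb (\<lambda>t. (\<eta> t * q t)\<^sup>2)"
  proof (rule Bochner_Integration.integrable_bound)
    show "integrable unit_leb (\<lambda>t. K\<^sup>2 * (q t)\<^sup>2)"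
      using assms by (simp add: L2_sq_integrable)
    have "(\<eta> t)\<^sup>2 \<le> K\<^sup>2" if "t \<in> {0..1}" for t
      using K[OF that] by (metis abs_ge_zero power2_abs power_mono)
    then show "AE t in unit_leb. norm ((\<eta> t * q t)\<^sup>2) \<le> norm (K\<^sup>2 * (q t)\<^sup>2)"
      by (intro AE_I2) (simp add: space_unit_leb power_mult_distrib mult_right_mono)
  qed measurable
qed

lemma L2_mult_continuous:
  assumes "L2 q" "continuous_on {0..1} \<eta>"
  shows "L2 (\<lambda>t. \<eta> t * q t)"
proof -
  obtain K where "\<And>t. t \<in> {0..1} \<Longrightarrow> \<bar>\<eta> t\<bar> \<le> K"
    using continuous_on_unit_bounded[OF assms(2)] by blast
  then show ?thesis
    by (rule L2_mult_bounded[OF assms(1) continuous_on_borel_measurable_unit[OF assms(2)]])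
qed

lemma L2_continuous: "continuous_on {0..1} \<eta> \<Longrightarrow> L2 \<eta>"
  using L2_mult_continuous[OF L2_const[of 1]] by simp

lemma L2_indicator_mult: "L2 q \<Longrightarrow> A \<in> sets borel \<Longrightarrow> L2 (\<lambda>t. indicator A t * q t)"
  by (rule L2_mult_bounded[where K = 1])
    (auto intro!: measurable_unit_leb_borel simp: indicator_def)

lemma L2_cong:
  assumes "\<And>t. t \<in> {0..1} \<Longrightarrow> q t = r t" shows "L2 q \<longleftrightarrow> L2 r"
  unfolding L2_def
  by (intro arg_cong2[of _ _ _ _ "(\<and>)"] measurable_cong Bochner_Integration.integrable_cong)
    (auto simp: space_unit_leb assms)

lemma integral_unit_cong:
  fixes q r :: "real \<Rightarrow> real"
  assumes "\<And>t. t \<in> {0..1} \<Longrightarrow> q t = r t"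
  shows "(\<integral>t. q t \<partial>unit_leb) = (\<integral>t. r t \<partial>unit_leb)"
  by (rule Bochner_Integration.integral_cong) (auto simp: space_unit_leb assms)

lemma Cauchy_Schwarz_unit:
  assumes "L2 q" "L2 r"
  shows "(\<integral>t. q t * r t \<partial>unit_leb)\<^sup>2 \<le> (\<integral>t. (q t)\<^sup>2 \<partial>unit_leb) * (\<integral>t. (r t)\<^sup>2 \<partial>unit_leb)"
proof -
  define A B C where "A = (\<integral>t. (q t)\<^sup>2 \<partial>unit_leb)" and "B = (\<integral>t. q t * r t \<partial>unit_leb)"
    and "C = (\<integral>t. (r t)\<^sup>2 \<partial>unit_leb)"
  note I [simp] = L2_sq_integrable[OF assms(1)] L2_sq_integrable[OF assms(2)] L2_mult_integrable[OF assms]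
  have ge: "0 \<le> x\<^sup>2 * A + 2 * x * y * B + y\<^sup>2 * C" for x y
  proof -
    have "0 \<le> (\<integral>t. (x * q t + y * r t)\<^sup>2 \<partial>unit_leb)" by simp
    also have "\<dots> = (\<integral>t. x\<^sup>2 * (q t)\<^sup>2 + 2 * x * y * (q t * r t) + y\<^sup>2 * (r t)\<^sup>2 \<partial>unit_leb)"
      by (intro integral_unit_cong) (simp add: power2_eq_square algebra_simps)
    finally show ?thesis by (simp add: A_def B_def C_def)
  qed
  have "A \<ge> 0" "C \<ge> 0" by (simp_all add: A_def C_def)
  \<comment> \<open>The quadratic form is nonnegative, and so its discriminant is not positive.\<close>
  show ?thesis unfolding A_def[symmetric] B_def[symmetric] C_def[symmetric]
  proof (cases "A = 0")
    case True
    show "B\<^sup>2 \<le> A * C"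
    proof (rule ccontr)
      assume "\<not> ?thesis"
      with True have "B \<noteq> 0" by auto
      with ge[of "-(C+1)/(2*B)" 1] True show False by (simp add: field_simps)
    qed
  next
    case False
    with \<open>A \<ge> 0\<close> have "A > 0" by simp
    from ge[of "-B" A] have "0 \<le> A * (A * C - B\<^sup>2)" by (simp add: power2_eq_square algebra_simps)
    with \<open>A > 0\<close> show "B\<^sup>2 \<le> A * C" by (simp add: zero_le_mult_iff)
  qed
qed


section \<open>Primitives of square-integrable functions\<close>

definition antideriv :: "(real \<Rightarrow> real) \<Rightarrow> real \<Rightarrow> real" where
  "antideriv q t = (\<integral>s. indicator {0..t} s * q s \<partial>unit_leb)"

text \<open>
  The continuous representative of a Sobolev function on the unit interval, together with a
  derivative. Only the values on the unit interval matter.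
\<close>

definition primitive :: "(real \<Rightarrow> real) \<Rightarrow> (real \<Rightarrow> real) \<Rightarrow> bool" where
  "primitive f q \<longleftrightarrow> L2 q \<and> (\<forall>t\<in>{0..1}. f t = f 0 + antideriv q t)"

lemma primitive_L2: "primitive f q \<Longrightarrow> L2 q"
  by (simp add: primitive_def)

lemma antideriv_0: "antideriv q 0 = 0"
proof -
  have "antideriv q 0 = (\<integral>s. indicator {0} s * q 0 \<partial>unit_leb)"
    unfolding antideriv_def by (rule integral_unit_cong) (auto simp: indicator_def)
  also have "\<dots> = 0"
    by (simp add: integral_indicator space_unit_leb measure_restrict_space)
  finally show ?thesis .
qed

lemma primitive_eq: "primitive f q \<Longrightarrow> t \<in> {0..1} \<Longrightarrow> f t = f 0 + antideriv q t"
  unfolding primitive_def by blast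

lemma primitiveI: "L2 q \<Longrightarrow> (\<And>t. t \<in> {0..1} \<Longrightarrow> f t = c + antideriv q t) \<Longrightarrow> primitive f q"
  unfolding primitive_def using antideriv_0[of q] by simp

lemma primitive_cong:
  assumes P: "primitive f q" and eq: "\<And>t. t \<in> {0..1} \<Longrightarrow> f t = F t" "\<And>t. t \<in> {0..1} \<Longrightarrow> q t = r t"
  shows "primitive F r"
proof (rule primitiveI)
  show "L2 r" using primitive_L2[OF P] L2_cong[of q r] eq(2) by blast
  fix t :: real assume t: "t \<in> {0..1}"
  have "antideriv q t = antideriv r t"
    unfolding antideriv_def by (intro integral_unit_cong) (simp add: eq)
  with primitive_eq[OF P t] show "F t = f 0 + antideriv r t"
    by (simp add: eq(1)[OF t, symmetric])
qed

lemma antideriv_cmult: "antideriv (\<lambda>s. c * q s) t = c * antideriv q t"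
  unfolding antideriv_def by (simp add: mult.left_commute)

lemma integrable_indicator_unit:
  fixes q :: "real \<Rightarrow> real"
  assumes "integrable unit_leb q" "A \<in> sets borel"
  shows "integrable unit_leb (\<lambda>s. indicator A s * q s)"
proof -
  have "A \<inter> {0..1} \<in> sets unit_leb"
    using assms(2) by (auto simp: sets_restrict_space image_def)
  then have "integrable unit_leb (\<lambda>s. indicator (A \<inter> {0..1}) s *\<^sub>R q s)"
    by (intro integrable_mult_indicator assms)
  also have "?this \<longleftrightarrow> ?thesis"
    by (intro Bochner_Integration.integrable_cong) (auto simp: space_unit_leb indicator_def)
  finally show ?thesis .
qed

lemma antideriv_add:
  assumes "integrable unit_leb q" "integrable unit_leb r"
  shows "antideriv (\<lambda>s. q s + r s) t = antideriv q t + antideriv r t"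
  using assms by (simp add: antideriv_def distrib_left integrable_indicator_unit)

lemma primitive_cmult:
  assumes "primitive f q" shows "primitive (\<lambda>t. c * f t) (\<lambda>t. c * q t)"
proof (rule primitiveI)
  show "L2 (\<lambda>t. c * q t)" by (rule L2_cmult[OF primitive_L2[OF assms]])
  fix t :: real assume t: "t \<in> {0..1}"
  show "c * f t = c * f 0 + antideriv (\<lambda>t. c * q t) t"
    unfolding antideriv_cmult
    by (subst primitive_eq[OF assms t]) (simp add: distrib_left)
qed

lemma primitive_add: 
  assumes "primitive f q" "primitive F r"
  shows "primitive (\<lambda>t. f t + F t) (\<lambda>t. q t + r t)"
proof (rule primitiveI)
  note L = assms[THEN primitive_L2]
  show "L2 (\<lambda>t. q t + r t)" by (intro L2_add L)
  fix t :: real assume t: "t \<in> {0..1}"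
  show "f t + F t = (f 0 + F 0) + antideriv (\<lambda>t. q t + r t) t"
    unfolding antideriv_add[OF L[THEN L2_integrable]]
    by (subst primitive_eq[OF assms(1) t], subst primitive_eq[OF assms(2) t]) simp
qed

lemma antideriv_diff:
  assumes "L2 q" "0 \<le> s" "s \<le> t"
  shows "antideriv q t - antideriv q s = (\<integral>x. indicator {s<..t} x * q x \<partial>unit_leb)"
proof -
  have "antideriv q t - antideriv q s
      = (\<integral>x. indicator {0..t} x * q x - indicator {0..s} x * q x \<partial>unit_leb)"
    unfolding antideriv_def using assms
    by (subst Bochner_Integration.integral_diff) (simp_all add: integrable_indicator_unit L2_integrable)
  also have "\<dots> = (\<integral>x. indicator {s<..t} x * q x \<partial>unit_leb)"
    using assms by (intro integral_unit_cong) (auto simp: indicator_def)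
  finally show ?thesis .
qed

text \<open>
  The Cauchy-Schwarz inequality for the derivative and the indicator function of the interval.
\<close>

lemma primitive_holder:
  assumes f: "primitive f q" and s: "0 \<le> s" "s \<le> t" "t \<le> 1"
  shows "(f t - f s)\<^sup>2 \<le> (t - s) * (\<integral>x. (q x)\<^sup>2 \<partial>unit_leb)"
proof -
  note q = primitive_L2[OF f]
  have "f t - f s = antideriv q t - antideriv q s"
    using primitive_eq[OF f, of s] primitive_eq[OF f, of t] s by simp
  also have "\<dots> = (\<integral>x. indicator {s<..t} x * q x \<partial>unit_leb)"
    using antideriv_diff[OF q] s by simp
  finally have "(f t - f s)\<^sup>2 = (\<integral>x. indicator {s<..t} x * q x \<partial>unit_leb)\<^sup>2" by simp
  also have "\<dots> \<le> (\<integral>x. (indicator {s<..t} x)\<^sup>2 \<partial>unit_leb) * (\<integral>x. (q x)\<^sup>2 \<partial>unit_leb)"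
    using L2_indicator_mult[OF L2_const[of 1]] by (intro Cauchy_Schwarz_unit q) simp
  also have "(\<integral>x. (indicat_real {s<..t} x)\<^sup>2 \<partial>unit_leb) = (\<integral>x. indicat_real {s<..t} x \<partial>unit_leb)"
    by (intro integral_unit_cong) (simp add: indicator_def)
  also have "\<dots> = measure unit_leb ({s<..t} \<inter> {0..1})"
    by (simp add: integral_indicator space_unit_leb)
  also have "\<dots> = t - s"
    using s by (subst measure_restrict_space) (auto simp: Int_absorb2 subset_iff)
  finally show ?thesis .
qed

lemma primitive_holder_abs:
  assumes f: "primitive f q" and s: "s \<in> {0..1}" "t \<in> {0..1}"
  shows "(f t - f s)\<^sup>2 \<le> \<bar>t - s\<bar> * (\<integral>x. (q x)\<^sup>2 \<partial>unit_leb)"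
  using primitive_holder[OF f, of s t] primitive_holder[OF f, of t s] s
  by (cases "s \<le> t") (auto simp: power2_commute)

lemma primitive_continuous:
  assumes f: "primitive f q"
  shows "continuous_on {0..1} f"
proof (rule continuous_onI)
  fix x e :: real assume x: "x \<in> {0..1}" and e: "e > 0"
  define T where "T = (\<integral>x. (q x)\<^sup>2 \<partial>unit_leb)"
  have T: "T \<ge> 0" by (simp add: T_def)
  define d where "d = e\<^sup>2 / (T + 1)"
  have d: "d > 0" using e T by (simp add: d_def)
  show "\<exists>d>0. \<forall>x'\<in>{0..1}. dist x' x < d \<longrightarrow> dist (f x') (f x) \<le> e"
  proof (intro exI[of _ d] conjI ballI impI d)
    fix y assume y: "y \<in> {0..1::real}" "dist y x < d"
    have "(f y - f x)\<^sup>2 \<le> \<bar>y - x\<bar> * T"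
      using primitive_holder_abs[OF f x y(1)] by (simp add: T_def)
    also have "\<dots> \<le> d * (T + 1)"
      using y T d by (intro mult_mono) (auto simp: dist_real_def)
    also have "\<dots> = e\<^sup>2" using T by (simp add: d_def)
    finally have "\<bar>f y - f x\<bar>\<^sup>2 \<le> e\<^sup>2" by simp
    then show "dist (f y) (f x) \<le> e"
      unfolding dist_real_def by (rule power2_le_imp_le) (use e in simp)
  qed
qed

lemma antideriv_primitive: "L2 q \<Longrightarrow> primitive (antideriv q) q"
  by (rule primitiveI[where c = 0]) simp_all

lemma antideriv_lborel:
  assumes "t \<in> {0..1}"
  shows "antideriv q t = (\<integral>s. indicator {0..t} s *\<^sub>R q s \<partial>lborel)"
proof -
  have "antideriv q t = (\<integral>s. indicator {0..1} s *\<^sub>R (indicator {0..t} s * q s) \<partial>lborel)"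
    unfolding antideriv_def by (rule integral_restrict_space) simp
  also have "\<dots> = (\<integral>s. indicator {0..t} s *\<^sub>R q s \<partial>lborel)"
    using assms by (intro Bochner_Integration.integral_cong) (auto simp: indicator_def)
  finally show ?thesis .
qed

lemma primitive_C1:
  assumes deriv: "\<And>t. t \<in> {0..1} \<Longrightarrow> (f has_real_derivative q t) (at t within {0..1})"
    and cont: "continuous_on {0..1} q"
  shows "primitive f q"
proof -
  have "f t = f 0 + antideriv q t" if t: "t \<in> {0..1}" for t
  proof -
    have "antideriv q t = f t - f 0"
      unfolding antideriv_lborel[OF t]
    proof (rule integral_FTC_atLeastAtMost)
      show "0 \<le> t" using t by simp
      show "continuous_on {0..t} q"
        by (rule continuous_on_subset[OF cont]) (use t in auto)
      fix x assume "0 \<le> x" "x \<le> t"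
      then have "(f has_real_derivative q x) (at x within {0..t})"
        using t by (intro DERIV_subset[OF deriv]) auto
      then show "(f has_vector_derivative q x) (at x within {0..t})"
        by (simp add: has_real_derivative_iff_has_vector_derivative)
    qed
    then show ?thesis by simp
  qed
  then show ?thesis by (rule primitiveI[OF L2_continuous[OF cont]])
qed

lemma integrable_unit_product:
  fixes q r :: "real \<Rightarrow> real"
  assumes "integrable unit_leb q" "integrable unit_leb r"
  shows "integrable (unit_leb \<Otimes>\<^sub>M unit_leb) (\<lambda>(x, y). q x * r y)"
proof -
  interpret P: pair_sigma_finite unit_leb unit_leb ..
  have [measurable]: "q \<in> borel_measurable unit_leb" "r \<in> borel_measurable unit_leb"
    using assms by auto
  show ?thesis
  proof (rule P.Fubini_integrable)
    show "(\<lambda>(x, y). q x * r y) \<in> borel_measurable (unit_leb \<Otimes>\<^sub>M unit_leb)" by measurable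
    show "integrable unit_leb (\<lambda>x. LINT y|unit_leb. norm (case (x, y) of (x, y) \<Rightarrow> q x * r y))"
      using assms by (simp add: abs_mult)
    show "AE x in unit_leb. integrable unit_leb (\<lambda>y. case (x, y) of (x, y) \<Rightarrow> q x * r y)"
      using assms by simp
  qed
qed

lemma antideriv_1: "antideriv q 1 = (\<integral>t. q t \<partial>unit_leb)"
  unfolding antideriv_def by (rule integral_unit_cong) simp

text \<open>
  Integration by parts for integrands that are merely square integrable. By Fubini's theorem both
  terms integrate the product \<open>q x * r s\<close> over a triangle of the square, and the two triangles
  fill the square up to its diagonal.
\<close>

lemma antideriv_mult:
  assumes q: "L2 q" and r: "L2 r" and t: "t \<in> {0..1}"
  shows "antideriv (\<lambda>x. q x * antideriv r x + antideriv q x * r x) t = antideriv q t * antideriv r t"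
proof -
  interpret P: pair_sigma_finite unit_leb unit_leb ..
  define Q where "Q x = indicator {0..t} x * q x" for x
  define R where "R x = indicator {0..t} x * r x" for x
  have Q: "L2 Q" and R: "L2 R"
    unfolding Q_def R_def by (rule L2_indicator_mult[OF q], simp) (rule L2_indicator_mult[OF r], simp)
  note iQ = L2_integrable[OF Q] and iR = L2_integrable[OF R]
  have [measurable]: "Q \<in> borel_measurable unit_leb" "R \<in> borel_measurable unit_leb"
    using iQ iR by auto
  have aQ: "antideriv Q x = antideriv q x" and aR: "antideriv R x = antideriv r x" if "x \<le> t" for x
    unfolding antideriv_def Q_def R_def using that by (auto intro!: integral_unit_cong simp: indicator_def)
  have cQ: "continuous_on {0..1} (antideriv Q)" and cR: "continuous_on {0..1} (antideriv R)"
    using antideriv_primitive[OF Q] antideriv_primitive[OF R] primitive_continuous by blast+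
  note cQ' = L2_continuous[OF cQ] and cR' = L2_continuous[OF cR]
  let ?A = "\<integral>x. Q x * antideriv R x \<partial>unit_leb" and ?B = "\<integral>x. antideriv Q x * R x \<partial>unit_leb"
  have "antideriv (\<lambda>x. q x * antideriv r x + antideriv q x * r x) t
      = (\<integral>x. Q x * antideriv R x + antideriv Q x * R x \<partial>unit_leb)"
    unfolding antideriv_def[of _ t]
  proof (rule integral_unit_cong)
    fix s :: real
    show "indicator {0..t} s * (q s * antideriv r s + antideriv q s * r s)
        = Q s * antideriv R s + antideriv Q s * R s"
      using aQ[of s] aR[of s] by (cases "s \<in> {0..t}") (simp_all add: Q_def R_def)
  qed
  also have "\<dots> = ?A + ?B"
    by (intro Bochner_Integration.integral_add L2_mult_integrable Q R cQ' cR')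
  also have "?A = (\<integral>x. \<integral>s. Q x * (indicator {s..1} x * R s) \<partial>unit_leb \<partial>unit_leb)"
  proof (rule integral_unit_cong)
    fix x :: real assume x: "x \<in> {0..1}"
    have "antideriv R x = (\<integral>s. indicator {s..1} x * R s \<partial>unit_leb)"
      unfolding antideriv_def using x by (intro integral_unit_cong) (auto simp: indicator_def)
    then show "Q x * antideriv R x = (\<integral>s. Q x * (indicator {s..1} x * R s) \<partial>unit_leb)" by simp
  qed
  also have "\<dots> = (\<integral>s. \<integral>x. Q x * (indicator {s..1} x * R s) \<partial>unit_leb \<partial>unit_leb)"
  proof (rule P.Fubini_integral[symmetric])
    show "integrable (unit_leb \<Otimes>\<^sub>M unit_leb) (\<lambda>(x, s). Q x * (indicator {s..1} x * R s))"
    proof (rule Bochner_Integration.integrable_bound[OF integrable_unit_product[OF iQ iR]])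
      have [measurable]: "(\<lambda>x. x) \<in> borel_measurable unit_leb"
        by (rule measurable_unit_leb_borel) simp
      have "(\<lambda>(x, s). Q x * (of_bool (s \<le> x \<and> x \<le> 1) * R s)) \<in> borel_measurable (unit_leb \<Otimes>\<^sub>M unit_leb)"
        by measurable
      also have "(\<lambda>(x, s). Q x * (of_bool (s \<le> x \<and> x \<le> 1) * R s)) = (\<lambda>(x, s). Q x * (indicator {s..1} x * R s))"
        by (auto simp: indicator_def fun_eq_iff)
      finally show "(\<lambda>(x, s). Q x * (indicator {s..1} x * R s)) \<in> borel_measurable (unit_leb \<Otimes>\<^sub>M unit_leb)" .
    qed (auto simp: indicator_def)
  qed
  also have "\<dots> = (\<integral>s. (antideriv Q 1 - antideriv Q s) * R s \<partial>unit_leb)"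
  proof (rule integral_unit_cong)
    fix s :: real assume s: "s \<in> {0..1}"
    \<comment> \<open>The diagonal is negligible.\<close>
    have "AE x in lborel. x \<noteq> s" by (rule AE_lborel_singleton)
    then have "AE x in unit_leb. x \<noteq> s"
      by (subst AE_restrict_space_iff) auto
    then have ae: "AE x in unit_leb. indicator {s..1} x * Q x = indicator {s<..1} x * Q x"
      by eventually_elim (auto simp: indicator_def)
    have "(\<integral>x. indicator {s..1} x * Q x \<partial>unit_leb) = (\<integral>x. indicator {s<..1} x * Q x \<partial>unit_leb)"
      using ae by (rule integral_cong_AE[rotated 2]) (rule L2_measurable[OF L2_indicator_mult[OF Q]], simp)+
    also have "\<dots> = antideriv Q 1 - antideriv Q s"
      using antideriv_diff[OF Q, of s 1] s by simp
    finally have *: "(\<integral>x. indicator {s..1} x * Q x \<partial>unit_leb) = antideriv Q 1 - antideriv Q s" .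
    have "(\<integral>x. Q x * (indicator {s..1} x * R s) \<partial>unit_leb) = (\<integral>x. (indicator {s..1} x * Q x) * R s \<partial>unit_leb)"
      by (rule integral_unit_cong) simp
    then show "(\<integral>x. Q x * (indicator {s..1} x * R s) \<partial>unit_leb) = (antideriv Q 1 - antideriv Q s) * R s"
      by (simp add: *)
  qed
  also have "\<dots> = (\<integral>s. antideriv Q 1 * R s \<partial>unit_leb) - ?B"
    using L2_mult_integrable[OF cQ' R] iR
    by (subst Bochner_Integration.integral_diff[symmetric]) (simp_all add: left_diff_distrib)
  also have "(\<integral>s. antideriv Q 1 * R s \<partial>unit_leb) = antideriv Q 1 * antideriv R 1"
    by (simp add: antideriv_1)
  also have "antideriv Q 1 = antideriv q t"
    unfolding antideriv_def Q_def using t by (intro integral_unit_cong) (auto simp: indicator_def)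
  also have "antideriv R 1 = antideriv r t"
    unfolding antideriv_def R_def using t by (intro integral_unit_cong) (auto simp: indicator_def)
  finally show ?thesis by simp
qed

lemma primitive_mult:
  assumes f: "primitive f q" and F: "primitive F r"
  shows "primitive (\<lambda>t. f t * F t) (\<lambda>t. q t * F t + f t * r t)"
proof (rule primitiveI)
  note q = primitive_L2[OF f] and r = primitive_L2[OF F]
  note cf = primitive_continuous[OF f] and cF = primitive_continuous[OF F]
  have L: "L2 (\<lambda>t. q t * F t)" "L2 (\<lambda>t. f t * r t)"
    using L2_mult_continuous[OF q cF] L2_mult_continuous[OF r cf] by (simp_all add: mult.commute)
  then show "L2 (\<lambda>t. q t * F t + f t * r t)" by (rule L2_add)
  fix t :: real assume t: "t \<in> {0..1}"
  let ?a = "antideriv q" and ?b = "antideriv r"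
  have L': "L2 (\<lambda>t. q t * ?b t + ?a t * r t)"
    using L2_add[OF L2_mult_continuous[OF q primitive_continuous[OF antideriv_primitive[OF r]]]
      L2_mult_continuous[OF r primitive_continuous[OF antideriv_primitive[OF q]]]]
    by (simp add: mult.commute)
  have "antideriv (\<lambda>t. q t * F t + f t * r t) t
     = antideriv (\<lambda>t. (F 0 * q t + f 0 * r t) + (q t * ?b t + ?a t * r t)) t"
    unfolding antideriv_def
    by (rule integral_unit_cong)
      (subst primitive_eq[OF f], assumption, subst primitive_eq[OF F], assumption,
        simp add: antideriv_def algebra_simps)
  also have "\<dots> = F 0 * ?a t + f 0 * ?b t + ?a t * ?b t"
    using L2_integrable[OF q] L2_integrable[OF r]
    by (subst antideriv_add) (simp_all add: L2_integrable[OF L'] antideriv_add antideriv_cmult antideriv_mult[OF q r t])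
  finally show "f t * F t = f 0 * F 0 + antideriv (\<lambda>t. q t * F t + f t * r t) t"
    by (subst primitive_eq[OF f t], subst primitive_eq[OF F t]) (simp add: algebra_simps)
qed

lemma primitive_by_parts:
  assumes f: "primitive f q" and F: "primitive F r"
  shows "(\<integral>t. q t * F t \<partial>unit_leb) + (\<integral>t. f t * r t \<partial>unit_leb) = f 1 * F 1 - f 0 * F 0"
proof -
  have "f 1 * F 1 = f 0 * F 0 + antideriv (\<lambda>t. q t * F t + f t * r t) 1"
    using primitive_eq[OF primitive_mult[OF f F], of 1] by simp
  moreover have "integrable unit_leb (\<lambda>t. q t * F t)" "integrable unit_leb (\<lambda>t. f t * r t)"
    by (intro L2_mult_integrable primitive_L2[OF f] primitive_L2[OF F]
        L2_continuous primitive_continuous[OF f] primitive_continuous[OF F])+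
  ultimately show ?thesis by (simp add: antideriv_1)
qed

text \<open>The intervals generate the Borel sets and are closed under intersection.\<close>

lemma antideriv_0_imp_AE:
  assumes r: "L2 r" and 0: "\<And>t. t \<in> {0..1} \<Longrightarrow> antideriv r t = 0"
  shows "AE t in unit_leb. r t = 0"
proof -
  note ir = L2_integrable[OF r]
  have S: "set_integrable unit_leb (B \<inter> {0..1}) r" if "B \<in> sets borel" for B
    unfolding set_integrable_def
    by (intro integrable_mult_indicator ir) (use that in \<open>auto simp: sets_restrict_space\<close>)
  have all0: "(\<integral>t. r t \<partial>unit_leb) = 0"
    using 0[of 1] by (simp add: antideriv_1)
  have "(LINT t:B \<inter> {0..1}|unit_leb. r t) = 0" if "B \<in> sets borel" for B
  proof -
    have "B \<in> sigma_sets UNIV (range (\<lambda>a::real. {..a}))"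
      using that by (simp add: borel_eq_atMost)
    moreover have "Int_stable (range (\<lambda>a::real. {..a}))"
      by (auto simp: Int_stable_def)
    moreover have "range (\<lambda>a::real. {..a}) \<subseteq> Pow UNIV" by simp
    ultimately have "Int_stable (range (\<lambda>a::real. {..a}))" "range (\<lambda>a::real. {..a}) \<subseteq> Pow UNIV"
      "B \<in> sigma_sets UNIV (range (\<lambda>a::real. {..a}))" by blast+
    then show ?thesis
    proof (induction rule: sigma_sets_induct_disjoint)
      case (basic A)
      then obtain a where A: "A = {..a}" by auto
      have "(LINT t:A \<inter> {0..1}|unit_leb. r t) = (if a < 0 then 0 else antideriv r (min a 1))"
      proof (cases "a < 0")
        case True
        then have "{..a} \<inter> {0..1} = {}" by auto
        with True show ?thesis by (simp add: A set_lebesgue_integral_def)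
      next
        case False
        then show ?thesis
          unfolding antideriv_def set_lebesgue_integral_def A
          by (auto intro!: integral_unit_cong simp: indicator_def)
      qed
      then show ?case using 0[of "min a 1"] by auto
    next
      case empty
      then show ?case by (simp add: set_lebesgue_integral_def)
    next
      case (compl A)
      then have A: "A \<in> sets borel" by (simp add: borel_eq_atMost)
      have "(LINT t:(UNIV - A) \<inter> {0..1}|unit_leb. r t)
          = (\<integral>t. r t - indicator (A \<inter> {0..1}) t *\<^sub>R r t \<partial>unit_leb)"
        unfolding set_lebesgue_integral_def by (rule integral_unit_cong) (auto simp: indicator_def)
      also have "\<dots> = (\<integral>t. r t \<partial>unit_leb) - (LINT t:A \<inter> {0..1}|unit_leb. r t)"
        unfolding set_lebesgue_integral_def using S[OF A] ir
        by (simp add: set_integrable_def)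
      finally show ?case using compl all0 by simp
    next
      case (union A)
      then have A: "A i \<in> sets borel" for i by (auto simp: borel_eq_atMost)
      have UN: "(\<Union>i. A i \<inter> {0..1}) = (\<Union>i. A i) \<inter> {0..1}" by blast
      have "(LINT t:(\<Union>i. A i \<inter> {0..1})|unit_leb. r t) = (\<Sum>i. LINT t:A i \<inter> {0..1}|unit_leb. r t)"
      proof (rule lebesgue_integral_countable_add)
        show "A i \<inter> {0..1} \<in> sets unit_leb" for i using A by (auto simp: sets_restrict_space)
        show "A i \<inter> {0..1} \<inter> (A j \<inter> {0..1}) = {}" if "i \<noteq> j" for i j
          using union that by (auto simp: disjoint_family_on_def)
        have "(\<Union>i. A i) \<in> sets borel" using A by blast
        from S[OF this] show "set_integrable unit_leb (\<Union>i. A i \<inter> {0..1}) r"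
          unfolding UN .
      qed
      then show ?case using union by (simp add: UN)
    qed
  qed
  note zero = this
  have "(LINT t:A|unit_leb. r t) = (LINT t:A|unit_leb. 0)" if "A \<in> sets unit_leb" for A
  proof -
    from that obtain B where "B \<in> sets borel" "A = {0..1} \<inter> B"
      unfolding sets_restrict_space by auto
    with zero[of B] show ?thesis by (simp add: Int_commute)
  qed
  then show ?thesis
    using density_unique_real[of unit_leb r "\<lambda>_. 0"] ir by simp
qed

lemma primitive_unique:
  assumes f: "primitive f q" and F: "primitive F r" and eq: "\<And>t. t \<in> {0..1} \<Longrightarrow> f t = F t"
  shows "AE t in unit_leb. q t = r t"
proof -
  have "AE t in unit_leb. q t - r t = 0"
  proof (rule antideriv_0_imp_AE)
    show "L2 (\<lambda>t. q t - r t)" using f F by (intro L2_diff primitive_L2)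
    fix t :: real assume t: "t \<in> {0..1}"
    have "antideriv q t = antideriv r t"
      using primitive_eq[OF f t] primitive_eq[OF F t] eq[OF t] eq[of 0] by simp
    moreover have "antideriv (\<lambda>t. q t - r t) t = antideriv q t - antideriv r t"
      using antideriv_add[OF L2_integrable[OF primitive_L2[OF f]]
          L2_integrable[OF L2_cmult[OF primitive_L2[OF F], of "-1"]], of t]
      unfolding antideriv_cmult by (simp only: mult_minus1 add_uminus_conv_diff)
    ultimately show "antideriv (\<lambda>t. q t - r t) t = 0" by simp
  qed
  then show ?thesis by simp
qed

text \<open>
  The Dirichlet integral is a function of \<open>f\<close>, although \<open>weak_deriv\<close> is an arbitrary choice
  among the weak derivatives.
\<close>

lemma primitive_unique_energy:
  assumes f: "primitive f q" and F: "primitive F r" and eq: "\<And>t. t \<in> {0..1} \<Longrightarrow> f t = F t"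
  shows "(\<integral>t. (q t)\<^sup>2 \<partial>unit_leb) = (\<integral>t. (r t)\<^sup>2 \<partial>unit_leb)"
proof (rule integral_cong_AE)
  show "AE t in unit_leb. (q t)\<^sup>2 = (r t)\<^sup>2"
    using primitive_unique[OF f F] eq by (auto elim: eventually_mono)
qed (intro borel_measurable_integrable L2_sq_integrable primitive_L2[OF f] primitive_L2[OF F])+

section \<open>Weak derivatives on the unit interval\<close>

text \<open>
  The interval of integration may be open or closed, and an integrand defined on the open
  interval may be given any values at the two ends.
\<close>

lemma indicator_Icc_split:
  fixes f :: "real \<Rightarrow> real"
  shows "indicator {0..1} t * f t
    = indicator {0<..<1} t * f t + (indicator {0} t * f 0 + indicator {1} t * f 1)"
  by (auto simp: indicator_def)

lemma borel_measurable_unit_iff: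
  fixes f :: "real \<Rightarrow> real"
  shows "f \<in> borel_measurable unit_leb \<longleftrightarrow> set_borel_measurable lborel {0<..<1} f"
proof -
  let ?k = "\<lambda>t::real. indicator {0} t * f 0 + indicator {1} t * f 1"
  have k: "?k \<in> borel_measurable borel" by simp
  have "f \<in> borel_measurable unit_leb \<longleftrightarrow> (\<lambda>t. indicator {0..1} t * f t) \<in> borel_measurable borel"
    by (subst borel_measurable_restrict_space_iff) simp_all
  also have "\<dots> \<longleftrightarrow> (\<lambda>t. indicator {0<..<1} t * f t) \<in> borel_measurable borel"
  proof
    assume "(\<lambda>t. indicator {0..1} t * f t) \<in> borel_measurable borel"
    then have "(\<lambda>t. indicator {0..1} t * f t - ?k t) \<in> borel_measurable borel"
      using k by (rule borel_measurable_diff)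
    then show "(\<lambda>t. indicator {0<..<1} t * f t) \<in> borel_measurable borel"
      unfolding indicator_Icc_split by simp
  next
    assume "(\<lambda>t. indicator {0<..<1} t * f t) \<in> borel_measurable borel"
    then show "(\<lambda>t. indicator {0..1} t * f t) \<in> borel_measurable borel"
      unfolding indicator_Icc_split using k by (rule borel_measurable_add)
  qed
  finally show ?thesis by (simp add: set_borel_measurable_def)
qed

lemma has_bochner_integral_endpoints:
  "has_bochner_integral lborel (\<lambda>t::real. indicator {0} t * a + indicator {1} t * (b::real)) 0"
proof -
  have "has_bochner_integral lborel (\<lambda>t::real. indicator {c} t * a) 0" for c a :: real
    using has_bochner_integral_mult_left[OF has_bochner_integral_real_indicator[of "{c}" lborel]] by simp
  from has_bochner_integral_add[OF this[of 0 a] this[of 1 b]] show ?thesis by simp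
qed

lemma has_bochner_integral_unit_iff:
  fixes f :: "real \<Rightarrow> real"
  shows "has_bochner_integral unit_leb f I
    \<longleftrightarrow> has_bochner_integral lborel (\<lambda>t. indicator {0<..<1} t *\<^sub>R f t) I"
proof -
  let ?k = "\<lambda>t::real. indicator {0} t * f 0 + indicator {1} t * f 1"
  have "has_bochner_integral unit_leb f I
      \<longleftrightarrow> has_bochner_integral lborel (\<lambda>t. indicator {0..1} t * f t) I"
    by (simp add: has_bochner_integral_iff integral_restrict_space integrable_restrict_space)
  also have "\<dots> \<longleftrightarrow> has_bochner_integral lborel (\<lambda>t. indicator {0<..<1} t * f t) I"
  proof
    assume "has_bochner_integral lborel (\<lambda>t. indicator {0..1} t * f t) I"
    from has_bochner_integral_diff[OF this has_bochner_integral_endpoints[of "f 0" "f 1"]]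
    show "has_bochner_integral lborel (\<lambda>t. indicator {0<..<1} t * f t) I"
      unfolding indicator_Icc_split by simp
  next
    assume "has_bochner_integral lborel (\<lambda>t. indicator {0<..<1} t * f t) I"
    from has_bochner_integral_add[OF this has_bochner_integral_endpoints[of "f 0" "f 1"]]
    show "has_bochner_integral lborel (\<lambda>t. indicator {0..1} t * f t) I"
      unfolding indicator_Icc_split by simp
  qed
  finally show ?thesis by simp
qed

lemma integrable_unit_iff:
  fixes f :: "real \<Rightarrow> real"
  shows "integrable unit_leb f \<longleftrightarrow> set_integrable lborel {0<..<1} f"
  using has_bochner_integral_unit_iff[of f]
  unfolding set_integrable_def integrable.simps by blast

lemma integral_unit_eq:
  fixes f :: "real \<Rightarrow> real"
  assumes "integrable unit_leb f"
  shows "(LINT t:{0<..<1}|lborel. f t) = (\<integral>t. f t \<partial>unit_leb)"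
  unfolding set_lebesgue_integral_def
  by (rule has_bochner_integral_integral_eq)
    (use has_bochner_integral_unit_iff[of f] has_bochner_integral_integrable[OF assms] in blast)

lemma L2_unit_iff: "L2_unit q \<longleftrightarrow> L2 q"
  by (simp add: L2_unit_def L2_def borel_measurable_unit_iff integrable_unit_iff)

lemma test_function_primitive:
  assumes "test_function \<phi>"
  shows "primitive \<phi> (deriv \<phi>)" "\<phi> 0 = 0" "\<phi> 1 = 0"
proof -
  show "primitive \<phi> (deriv \<phi>)"
  proof (rule primitive_C1)
    show "continuous_on {0..1} (deriv \<phi>)"
      using assms continuous_on_subset unfolding test_function_def by blast
    show "(\<phi> has_real_derivative deriv \<phi> t) (at t within {0..1})" for t
      using assms unfolding test_function_def
      by (metis DERIV_deriv_iff_real_differentiable has_field_derivative_at_within)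
  qed
  show "\<phi> 0 = 0" "\<phi> 1 = 0"
    using assms unfolding test_function_def by force+
qed

lemma primitive_test_function:
  assumes f: "primitive f q" and \<phi>: "test_function \<phi>"
  shows "(\<integral>t. f t * deriv \<phi> t \<partial>unit_leb) = - (\<integral>t. q t * \<phi> t \<partial>unit_leb)"
  using primitive_by_parts[OF f test_function_primitive(1)[OF \<phi>]] test_function_primitive(2,3)[OF \<phi>]
  by simp

lemma primitive_imp_weak_deriv:
  assumes f: "primitive f q"
  shows "has_L2_weak_deriv f q"
  unfolding has_L2_weak_deriv_def
proof (intro conjI allI impI)
  note q = primitive_L2[OF f] and f2 = L2_continuous[OF primitive_continuous[OF f]]
  show "L2_unit q" using q by (simp add: L2_unit_iff)
  fix \<phi> assume \<phi>: "test_function \<phi>"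
  note p = test_function_primitive(1)[OF \<phi>]
  show "(LINT t:{0<..<1}|lborel. f t * deriv \<phi> t) = - (LINT t:{0<..<1}|lborel. q t * \<phi> t)"
    using primitive_test_function[OF f \<phi>] L2_mult_integrable[OF f2 primitive_L2[OF p]]
      L2_mult_integrable[OF q L2_continuous[OF primitive_continuous[OF p]]]
    by (simp add: integral_unit_eq)
qed

text \<open>
  The hat function of half-width \<open>\<epsilon>\<close>, and its antiderivative, which rises from zero to the square
  of \<open>\<epsilon>\<close>. Second differences of \<open>max 0\<close> and of half its square make the derivative immediate.
\<close>

definition tent :: "real \<Rightarrow> real \<Rightarrow> real" where
  "tent \<epsilon> x = max 0 (x + \<epsilon>) - 2 * max 0 x + max 0 (x - \<epsilon>)"

definition smooth_step :: "real \<Rightarrow> real \<Rightarrow> real" where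
  "smooth_step \<epsilon> x = (max 0 (x + \<epsilon>))\<^sup>2 / 2 - (max 0 x)\<^sup>2 + (max 0 (x - \<epsilon>))\<^sup>2 / 2"

lemma tent_nonneg: "\<epsilon> > 0 \<Longrightarrow> tent \<epsilon> x \<ge> 0"
  by (auto simp: tent_def max_def)

lemma tent_outside: "\<epsilon> > 0 \<Longrightarrow> \<epsilon> \<le> \<bar>x\<bar> \<Longrightarrow> tent \<epsilon> x = 0"
  by (auto simp: tent_def max_def)

lemma continuous_on_tent: "continuous_on A (\<lambda>t. tent \<epsilon> (t - c))"
  unfolding tent_def by (intro continuous_intros)

lemma smooth_step_left: "\<epsilon> > 0 \<Longrightarrow> x \<le> - \<epsilon> \<Longrightarrow> smooth_step \<epsilon> x = 0"
  by (auto simp: smooth_step_def max_def)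

lemma smooth_step_right: "\<epsilon> > 0 \<Longrightarrow> \<epsilon> \<le> x \<Longrightarrow> smooth_step \<epsilon> x = \<epsilon>\<^sup>2"
  by (auto simp: smooth_step_def max_def power2_eq_square field_simps)

lemma has_real_derivative_max_sq:
  "((\<lambda>x. (max 0 x)\<^sup>2) has_real_derivative 2 * max 0 x) (at x)" for x :: real
proof (cases "x = 0")
  case True
  have "((\<lambda>h::real. max 0 h) \<longlongrightarrow> max 0 0) (at 0)"
    by (intro tendsto_intros)
  moreover have "\<forall>\<^sub>F h in at (0::real). max 0 h = ((max 0 (0 + h))\<^sup>2 - (max 0 0)\<^sup>2) / h"
    by (rule eventually_at_ball'[THEN eventually_mono, of 1]) (auto simp: max_def power2_eq_square)
  ultimately show ?thesis
    unfolding DERIV_def True by (auto elim!: Lim_transform_eventually)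
next
  case False
  then consider "x > 0" | "x < 0" by linarith
  then show ?thesis
  proof cases
    case 1
    have "((\<lambda>x. x\<^sup>2) has_real_derivative 2 * max 0 x) (at x)"
      using 1 by (auto intro!: derivative_eq_intros)
    then show ?thesis
      by (rule has_field_derivative_transform_within_open[of _ _ _ "{0<..}"]) (use 1 in auto)
  next
    case 2
    have "((\<lambda>x. 0) has_real_derivative 2 * max 0 x) (at x)"
      using 2 by auto
    then show ?thesis
      by (rule has_field_derivative_transform_within_open[of _ _ _ "{..<0}"]) (use 2 in auto)
  qed
qed

lemma smooth_step_deriv:
  "((\<lambda>t. smooth_step \<epsilon> (t - c)) has_real_derivative tent \<epsilon> (t - c)) (at t)"
proof -
  have *: "((\<lambda>t. (max 0 (t - c + d))\<^sup>2) has_real_derivative 2 * max 0 (t - c + d)) (at t)" for d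
  proof -
    have "((\<lambda>t. t - c + d) has_real_derivative 1) (at t)"
      by (auto intro!: derivative_eq_intros)
    from DERIV_chain2[where f = "\<lambda>x. (max 0 x)\<^sup>2" and g = "\<lambda>t. t - c + d",
        OF has_real_derivative_max_sq this] show ?thesis by simp
  qed
  have "((\<lambda>t. (max 0 (t - c + \<epsilon>))\<^sup>2 / 2 - (max 0 (t - c + 0))\<^sup>2 + (max 0 (t - c + - \<epsilon>))\<^sup>2 / 2)
     has_real_derivative 2 * max 0 (t - c + \<epsilon>) / 2 - 2 * max 0 (t - c + 0) + 2 * max 0 (t - c + - \<epsilon>) / 2) (at t)"
    by (intro DERIV_add DERIV_diff DERIV_cdivide *)
  then show ?thesis by (simp add: smooth_step_def tent_def)
qed

text \<open>
  A test function is obtained by switching on near \<open>a\<close> and off near \<open>b\<close>.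
\<close>

lemma test_function_step_diff:
  assumes \<epsilon>: "\<epsilon> > 0" and ab: "\<epsilon> < a" "a \<le> b" "b + \<epsilon> < 1"
  shows "test_function (\<lambda>t. smooth_step \<epsilon> (t - a) - smooth_step \<epsilon> (t - b))" (is "test_function ?\<phi>")
    and "deriv (\<lambda>t. smooth_step \<epsilon> (t - a) - smooth_step \<epsilon> (t - b)) = (\<lambda>t. tent \<epsilon> (t - a) - tent \<epsilon> (t - b))"
proof -
  have D: "(?\<phi> has_real_derivative tent \<epsilon> (t - a) - tent \<epsilon> (t - b)) (at t)" for t
    by (intro DERIV_diff smooth_step_deriv)
  show d: "deriv ?\<phi> = (\<lambda>t. tent \<epsilon> (t - a) - tent \<epsilon> (t - b))"
    using DERIV_imp_deriv[OF D] by auto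
  show "test_function ?\<phi>"
    unfolding test_function_def d
  proof (rule conjI[OF _ conjI[OF _ exI[of _ "a - \<epsilon>", OF exI[of _ "b + \<epsilon>"]]]], goal_cases)
    case 1
    show ?case using D real_differentiable_def by blast
  next
    case 2
    show ?case by (intro continuous_on_diff continuous_on_tent)
  next
    case 3
    have "?\<phi> t = 0" if "t \<notin> {a - \<epsilon>..b + \<epsilon>}" for t
    proof (cases "t \<le> a - \<epsilon>")
      case True
      then show ?thesis using \<epsilon> ab by (simp add: smooth_step_left)
    next
      case False
      then have "\<epsilon> \<le> t - a" "\<epsilon> \<le> t - b" using that ab by auto
      then show ?thesis using \<epsilon> by (simp add: smooth_step_right)
    qed
    then show ?case using \<epsilon> ab by auto
  qed
qed

lemma integral_tent:
  assumes \<epsilon>: "\<epsilon> > 0" and c: "\<epsilon> \<le> c" "c + \<epsilon> \<le> 1"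
  shows "(\<integral>t. tent \<epsilon> (t - c) \<partial>unit_leb) = \<epsilon>\<^sup>2"
proof -
  have "primitive (\<lambda>t. smooth_step \<epsilon> (t - c)) (\<lambda>t. tent \<epsilon> (t - c))"
    by (intro primitive_C1 has_field_derivative_at_within[OF smooth_step_deriv] continuous_on_tent)
  from primitive_eq[OF this, of 1] show ?thesis
    using assms by (simp add: antideriv_1 smooth_step_left smooth_step_right)
qed

lemma tent_average:
  assumes k: "continuous_on {0..1} k" and \<epsilon>: "\<epsilon> > 0" and c: "\<epsilon> \<le> c" "c + \<epsilon> \<le> 1"
    and close: "\<And>t. t \<in> {0..1} \<Longrightarrow> \<bar>t - c\<bar> < \<epsilon> \<Longrightarrow> \<bar>k t - k c\<bar> \<le> \<delta>"
  shows "\<bar>(\<integral>t. k t * tent \<epsilon> (t - c) \<partial>unit_leb) - k c * \<epsilon>\<^sup>2\<bar> \<le> \<delta> * \<epsilon>\<^sup>2"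
proof -
  note I = continuous_on_integrable_unit[OF continuous_on_mult[OF k continuous_on_tent]]
    continuous_on_integrable_unit[OF continuous_on_tent]
  have "(\<integral>t. k t * tent \<epsilon> (t - c) \<partial>unit_leb) - k c * \<epsilon>\<^sup>2
      = (\<integral>t. k t * tent \<epsilon> (t - c) - k c * tent \<epsilon> (t - c) \<partial>unit_leb)"
    using I integral_tent[OF \<epsilon> c] by (subst Bochner_Integration.integral_diff) simp_all
  also have "\<bar>\<dots>\<bar> \<le> (\<integral>t. \<delta> * tent \<epsilon> (t - c) \<partial>unit_leb)"
  proof (rule integral_abs_bound_integral)
    fix t assume "t \<in> space unit_leb"
    then have t: "t \<in> {0..1}" by (simp add: space_unit_leb)
    show "\<bar>k t * tent \<epsilon> (t - c) - k c * tent \<epsilon> (t - c)\<bar> \<le> \<delta> * tent \<epsilon> (t - c)"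
    proof (cases "\<bar>t - c\<bar> < \<epsilon>")
      case True
      have "\<bar>k t * tent \<epsilon> (t - c) - k c * tent \<epsilon> (t - c)\<bar> = \<bar>k t - k c\<bar> * tent \<epsilon> (t - c)"
        using tent_nonneg[OF \<epsilon>] by (simp add: abs_mult flip: left_diff_distrib)
      also have "\<dots> \<le> \<delta> * tent \<epsilon> (t - c)"
        by (intro mult_right_mono close[OF t True] tent_nonneg[OF \<epsilon>])
      finally show ?thesis .
    qed (simp add: tent_outside[OF \<epsilon>])
  qed (use I in simp_all)
  finally show ?thesis using I integral_tent[OF \<epsilon> c] by simp
qed

text \<open>
  The fundamental lemma of du Bois-Reymond. Testing with a step that is switched on near \<open>a\<close> and
  off near \<open>b\<close> shows that \<open>k\<close> has the same average over narrow hats at \<open>a\<close> and at \<open>b\<close>.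
\<close>

lemma weak_deriv_zero_imp_constant:
  assumes k: "continuous_on {0..1} k"
    and 0: "\<And>\<phi>. test_function \<phi> \<Longrightarrow> (\<integral>t. k t * deriv \<phi> t \<partial>unit_leb) = 0"
    and t: "t \<in> {0..1}"
  shows "k t = k (1/2)"
proof -
  have le: "k a = k b" if ab: "0 < a" "a \<le> b" "b < 1" for a b
  proof (rule ccontr)
    assume ne: "k a \<noteq> k b"
    define \<delta> where "\<delta> = \<bar>k a - k b\<bar> / 3"
    have \<delta>: "\<delta> > 0" using ne by (simp add: \<delta>_def)
    have "\<exists>d>0. \<forall>t\<in>{0..1}. \<bar>t - c\<bar> < d \<longrightarrow> \<bar>k t - k c\<bar> \<le> \<delta>" if c: "c \<in> {0..1}" for c
    proof -
      obtain d where "d > 0" "\<forall>t\<in>{0..1}. dist t c < d \<longrightarrow> dist (k t) (k c) < \<delta>"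
        using k[unfolded continuous_on_iff, rule_format, OF c \<delta>] by blast
      then show ?thesis by (intro exI[of _ d]) (auto simp: dist_real_def intro: less_imp_le)
    qed
    from this[of a] this[of b] obtain d1 d2 where d: "d1 > 0" "d2 > 0"
      "\<And>t. t\<in>{0..1} \<Longrightarrow> \<bar>t - a\<bar> < d1 \<Longrightarrow> \<bar>k t - k a\<bar> \<le> \<delta>"
      "\<And>t. t\<in>{0..1} \<Longrightarrow> \<bar>t - b\<bar> < d2 \<Longrightarrow> \<bar>k t - k b\<bar> \<le> \<delta>"
      using ab by auto
    define \<epsilon> where "\<epsilon> = min (min d1 d2) (min a (1 - b)) / 2"
    have \<epsilon>: "\<epsilon> > 0" "\<epsilon> < d1" "\<epsilon> < d2" "\<epsilon> < a" "b + \<epsilon> < 1"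
      using d(1,2) ab by (auto simp: \<epsilon>_def min_def field_simps)
    note T = test_function_step_diff[OF \<epsilon>(1,4) ab(2) \<epsilon>(5)]
    have "(\<integral>t. k t * tent \<epsilon> (t - a) - k t * tent \<epsilon> (t - b) \<partial>unit_leb) = 0"
      using 0[OF T(1)] unfolding T(2) by (simp add: right_diff_distrib)
    then have "(\<integral>t. k t * tent \<epsilon> (t - a) \<partial>unit_leb) = (\<integral>t. k t * tent \<epsilon> (t - b) \<partial>unit_leb)"
      by (subst (asm) Bochner_Integration.integral_diff)
        (simp_all add: continuous_on_integrable_unit[OF continuous_on_mult[OF k continuous_on_tent]])
    moreover have "\<bar>(\<integral>t. k t * tent \<epsilon> (t - a) \<partial>unit_leb) - k a * \<epsilon>\<^sup>2\<bar> \<le> \<delta> * \<epsilon>\<^sup>2"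
      by (rule tent_average[OF k]) (use \<epsilon> d ab in auto)
    moreover have "\<bar>(\<integral>t. k t * tent \<epsilon> (t - b) \<partial>unit_leb) - k b * \<epsilon>\<^sup>2\<bar> \<le> \<delta> * \<epsilon>\<^sup>2"
      by (rule tent_average[OF k]) (use \<epsilon> d ab in auto)
    ultimately have "\<bar>k a * \<epsilon>\<^sup>2 - k b * \<epsilon>\<^sup>2\<bar> \<le> 2 * (\<delta> * \<epsilon>\<^sup>2)" by linarith
    then have "\<bar>k a - k b\<bar> * \<epsilon>\<^sup>2 \<le> (2 * \<delta>) * \<epsilon>\<^sup>2"
      by (simp add: abs_mult flip: left_diff_distrib)
    then have "\<bar>k a - k b\<bar> \<le> 2 * \<delta>" using \<epsilon>(1) by simp
    then show False using \<delta> by (simp add: \<delta>_def)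
  qed
  have const: "k x = k (1/2)" if "x \<in> {0<..<1}" for x
  proof (cases "x \<le> 1/2")
    case True
    show ?thesis by (rule le) (use that True in auto)
  next
    case False
    show ?thesis by (rule le[symmetric]) (use that False in auto)
  qed
  show ?thesis
    by (rule continuous_constant_on_closure[of "{0<..<1}" k, OF _ const]) (use k t in simp_all)
qed

text \<open>
  A continuous function with a weak derivative differs from the primitive of that derivative by a
  function with weak derivative zero.
\<close>

lemma weak_deriv_imp_primitive:
  assumes f: "continuous_on {0..1} f" and w: "has_L2_weak_deriv f q"
  shows "primitive f q"
proof -
  have q: "L2 q" using w by (simp add: has_L2_weak_deriv_def L2_unit_iff)
  note p = antideriv_primitive[OF q]
  define k where "k t = f t - antideriv q t" for t
  have k: "continuous_on {0..1} k"
    unfolding k_def by (intro continuous_on_diff f primitive_continuous[OF p])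
  have 0: "(\<integral>t. k t * deriv \<phi> t \<partial>unit_leb) = 0" if \<phi>: "test_function \<phi>" for \<phi>
  proof -
    note p\<phi> = test_function_primitive(1)[OF \<phi>]
    have i: "integrable unit_leb (\<lambda>t. f t * deriv \<phi> t)" "integrable unit_leb (\<lambda>t. antideriv q t * deriv \<phi> t)"
      "integrable unit_leb (\<lambda>t. q t * \<phi> t)"
      by (intro L2_mult_integrable L2_continuous f primitive_L2[OF p\<phi>] primitive_continuous[OF p]
          q primitive_continuous[OF p\<phi>])+
    have "(\<integral>t. f t * deriv \<phi> t \<partial>unit_leb) = - (\<integral>t. q t * \<phi> t \<partial>unit_leb)"
      using w[unfolded has_L2_weak_deriv_def, THEN conjunct2, rule_format, OF \<phi>]
      unfolding integral_unit_eq[OF i(1)] integral_unit_eq[OF i(3)] .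
    then show ?thesis
      using primitive_test_function[OF p \<phi>] i by (simp add: k_def left_diff_distrib)
  qed
  show ?thesis
  proof (rule primitiveI[OF q])
    show "f t = k (1/2) + antideriv q t" if "t \<in> {0..1}" for t
      using weak_deriv_zero_imp_constant[OF k 0 that] by (simp add: k_def)
  qed
qed

lemma H1_unit_primitive:
  assumes "continuous_on {0..1} f" "H1_unit f"
  shows "primitive f (weak_deriv f)"
proof -
  obtain g where "has_L2_weak_deriv f g" using assms(2) unfolding H1_unit_def by blast
  then have "has_L2_weak_deriv f (weak_deriv f)"
    unfolding weak_deriv_def by (rule someI[where P = "has_L2_weak_deriv f"])
  with assms(1) show ?thesis by (rule weak_deriv_imp_primitive)
qed

lemma primitive_H1_unit:
  assumes "primitive f q"
  shows "H1_unit f" "primitive f (weak_deriv f)"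
proof -
  note c = primitive_continuous[OF assms]
  show "H1_unit f"
    using primitive_imp_weak_deriv[OF assms] L2_continuous[OF c] by (auto simp: H1_unit_def L2_unit_iff)
  with c show "primitive f (weak_deriv f)" by (rule H1_unit_primitive)
qed

section \<open>The ground state representation on an edge\<close>

lemma antideriv_diff_abs_le:
  assumes "L2 r" "s \<in> {0..1}" "t \<in> {0..1}"
  shows "\<bar>antideriv r t - antideriv r s\<bar> \<le> (\<integral>x. \<bar>r x\<bar> \<partial>unit_leb)"
proof -
  have *: "\<bar>antideriv r t - antideriv r s\<bar> \<le> (\<integral>x. \<bar>r x\<bar> \<partial>unit_leb)" if "0 \<le> s" "s \<le> t" for s t
  proof -
    have i: "integrable unit_leb r" by (rule L2_integrable[OF assms(1)])
    have "\<bar>antideriv r t - antideriv r s\<bar> = \<bar>\<integral>x. indicator {s<..t} x * r x \<partial>unit_leb\<bar>"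
      using antideriv_diff[OF assms(1) that] by simp
    also have "\<dots> \<le> (\<integral>x. \<bar>r x\<bar> \<partial>unit_leb)"
    proof (rule integral_abs_bound_integral)
      show "integrable unit_leb (\<lambda>x. indicator {s<..t} x * r x)"
        by (rule integrable_indicator_unit[OF i]) simp
      show "integrable unit_leb (\<lambda>x. \<bar>r x\<bar>)" using i by simp
    qed (simp add: indicator_def)
    finally show ?thesis .
  qed
  show ?thesis
  proof (cases "s \<le> t")
    case True
    then show ?thesis using *[of s t] assms by simp
  next
    case False
    then show ?thesis using *[of t s] assms by (simp add: abs_minus_commute)
  qed
qed

lemma L2_abs: "L2 q \<Longrightarrow> L2 (\<lambda>t. \<bar>q t\<bar>)"
  by (simp add: L2_def borel_measurable_abs)

lemma integral_abs_mult_le: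
  assumes "L2 q" "L2 r"
  shows "(\<integral>t. \<bar>q t * r t\<bar> \<partial>unit_leb) \<le> sqrt ((\<integral>t. (q t)\<^sup>2 \<partial>unit_leb) * (\<integral>t. (r t)\<^sup>2 \<partial>unit_leb))"
  using Cauchy_Schwarz_unit[OF L2_abs[OF assms(1)] L2_abs[OF assms(2)]]
  by (intro real_le_rsqrt) (simp add: abs_mult)

text \<open>
  The derivative of the square is twice the product of the function and its derivative, so that
  the Cauchy-Schwarz inequality bounds the oscillation of the square.
\<close>

lemma primitive_sup_bound:
  assumes f: "primitive f q" and t: "t \<in> {0..1}"
  shows "(f t)\<^sup>2 \<le> (\<integral>x. (f x)\<^sup>2 \<partial>unit_leb)
    + 2 * sqrt ((\<integral>x. (f x)\<^sup>2 \<partial>unit_leb) * (\<integral>x. (q x)\<^sup>2 \<partial>unit_leb))"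
proof -
  note q = primitive_L2[OF f] and f2 = L2_continuous[OF primitive_continuous[OF f]]
  define B where "B = 2 * sqrt ((\<integral>x. (f x)\<^sup>2 \<partial>unit_leb) * (\<integral>x. (q x)\<^sup>2 \<partial>unit_leb))"
  define r where "r x = q x * f x + f x * q x" for x
  have p: "primitive (\<lambda>t. f t * f t) r"
    unfolding r_def by (rule primitive_mult[OF f f])
  have "(\<integral>x. \<bar>r x\<bar> \<partial>unit_leb) = 2 * (\<integral>x. \<bar>f x * q x\<bar> \<partial>unit_leb)"
    unfolding r_def by (subst integral_mult_right_zero[symmetric], rule integral_unit_cong) (simp add: mult.commute)
  also have "\<dots> \<le> B"
    unfolding B_def using integral_abs_mult_le[OF f2 q] by simp
  finally have r: "(\<integral>x. \<bar>r x\<bar> \<partial>unit_leb) \<le> B" .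
  have le: "(f t)\<^sup>2 \<le> (f s)\<^sup>2 + B" if s: "s \<in> {0..1}" for s
    using antideriv_diff_abs_le[OF primitive_L2[OF p] s t] primitive_eq[OF p t] primitive_eq[OF p s] r
    by (simp add: power2_eq_square)
  have i: "integrable unit_leb (\<lambda>s. (f s)\<^sup>2)" by (rule L2_sq_integrable[OF f2])
  have "(f t)\<^sup>2 = (\<integral>s. (f t)\<^sup>2 \<partial>unit_leb)" by (simp add: space_unit_leb measure_unit_leb_space)
  also have "\<dots> \<le> (\<integral>s. (f s)\<^sup>2 + B \<partial>unit_leb)"
    by (rule integral_mono) (use i le in \<open>simp_all add: space_unit_leb\<close>)
  also have "\<dots> = (\<integral>s. (f s)\<^sup>2 \<partial>unit_leb) + B"
    using i by (simp add: space_unit_leb measure_unit_leb_space)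
  finally show ?thesis by (simp add: B_def)
qed

text \<open>
  The radial function which equals \<open>cos (freq * t + phase)\<close> times the power \<open>- n / 2\<close> of two on
  level \<open>n\<close> is positive and satisfies the eigenvalue equation with eigenvalue \<open>freq\<^sup>2\<close> on the
  edges. It is continuous and satisfies the Kirchhoff condition at all vertices other than the
  root if and only if \<open>tan (freq + phase) = 2 * tan phase\<close> and
  \<open>cos phase = sqrt 2 * cos (freq + phase)\<close>. The first condition says that \<open>tan freq\<close> is
  \<open>x / (1 + 2 * x\<^sup>2)\<close> with \<open>x = tan phase\<close>. The second one holds where this is largest, at
  \<open>x = 1 / sqrt 2\<close>. The function just fails to be square integrable, and this identifies
  \<open>freq\<^sup>2\<close> as the bottom of the spectrum.
\<close>

definition freq :: real where "freq = arctan (1 / (2 * sqrt 2))"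
definition phase :: real where "phase = arctan (1 / sqrt 2)"
definition spec :: real where "spec = freq\<^sup>2"
text \<open>
  The logarithmic derivative of the function is \<open>- root_slope\<close> at the beginning of each edge and
  twice that at its end.
\<close>

definition root_slope :: real where "root_slope = freq / sqrt 2"

definition ground :: "real \<Rightarrow> real" where "ground t = cos (freq * t + phase)"
definition ground_log_deriv :: "real \<Rightarrow> real" where "ground_log_deriv t = - freq * tan (freq * t + phase)"

lemma freq_pos: "freq > 0" and phase_pos: "phase > 0" and spec_pos: "spec > 0"
  and root_slope_pos: "root_slope > 0"
  by (simp_all add: freq_def phase_def spec_def root_slope_def zero_less_arctan_iff)

lemma freq_plus_phase: "freq + phase = arctan (sqrt 2)"
proof -
  have s: "sqrt 2 * sqrt 2 = (2::real)" by simp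
  have "1 / sqrt 2 < (1::real)" by simp
  moreover have "1 / (2 * sqrt 2) \<le> (1::real)"
  proof -
    have "(1::real) \<le> 2 * sqrt 2" using real_sqrt_ge_one[of 2] by linarith
    then show ?thesis by simp
  qed
  ultimately have "freq + phase = arctan ((1 / (2 * sqrt 2) + 1 / sqrt 2) / (1 - 1 / (2 * sqrt 2) * (1 / sqrt 2)))"
    unfolding freq_def phase_def by (intro arctan_add) (simp_all add: abs_if)
  also have "(1 / (2 * sqrt 2) + 1 / sqrt 2) / (1 - 1 / (2 * sqrt 2) * (1 / sqrt 2)) = sqrt (2::real)"
    using s by (simp add: field_simps)
  finally show ?thesis .
qed

lemma angle_range:
  assumes "t \<in> {0..1}"
  shows "0 < freq * t + phase" "freq * t + phase < pi / 2"
proof -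
  show "0 < freq * t + phase"
    using assms freq_pos phase_pos by (simp add: add_nonneg_pos)
  have "freq * t \<le> freq" using assms freq_pos by simp
  then have "freq * t + phase \<le> arctan (sqrt 2)" using freq_plus_phase by linarith
  then show "freq * t + phase < pi / 2" using arctan_ubound[of "sqrt 2"] by linarith
qed

lemma ground_pos: "t \<in> {0..1} \<Longrightarrow> ground t > 0"
  unfolding ground_def using angle_range[of t] by (intro cos_gt_zero_pi) auto

lemma ground_antimono:
  assumes "0 \<le> s" "s \<le> t" "t \<le> 1" shows "ground t \<le> ground s"
proof -
  have "freq * s \<le> freq * t" using assms freq_pos by simp
  then show ?thesis unfolding ground_def
    using angle_range[of s] angle_range[of t] assms by (intro cos_monotone_0_pi_le) auto
qed

lemma ground_0_sq: "(ground 0)\<^sup>2 = 2 / 3" and ground_1_sq: "(ground 1)\<^sup>2 = 1 / 3"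
proof -
  have "ground 0 = 1 / sqrt (1 + (1 / sqrt 2)\<^sup>2)"
    by (simp add: ground_def phase_def cos_arctan)
  then show "(ground 0)\<^sup>2 = 2 / 3" by (simp add: power_divide)
  have "ground 1 = 1 / sqrt (1 + (sqrt 2)\<^sup>2)"
    by (simp add: ground_def freq_plus_phase cos_arctan)
  then show "(ground 1)\<^sup>2 = 1 / 3" by (simp add: power_divide)
qed

lemma ground_0_eq: "ground 0 = sqrt 2 * ground 1"
proof -
  have "(ground 0)\<^sup>2 = (sqrt 2 * ground 1)\<^sup>2" by (simp add: power_mult_distrib ground_0_sq ground_1_sq)
  then show ?thesis
    using ground_pos[of 0] ground_pos[of 1] by (simp add: power2_eq_iff_nonneg)
qed

lemma ground_log_deriv_ends: "ground_log_deriv 0 = - root_slope" "ground_log_deriv 1 = - 2 * root_slope"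
proof -
  show "ground_log_deriv 0 = - root_slope"
    by (simp add: ground_log_deriv_def root_slope_def phase_def tan_arctan)
  have "ground_log_deriv 1 = - freq * sqrt 2"
    by (simp add: ground_log_deriv_def freq_plus_phase tan_arctan)
  also have "\<dots> = - 2 * root_slope" by (simp add: root_slope_def field_simps)
  finally show "ground_log_deriv 1 = - 2 * root_slope" .
qed

lemma ground_sq_ge: "t \<in> {0..1} \<Longrightarrow> 1 / 3 \<le> (ground t)\<^sup>2"
  using power_mono[OF ground_antimono[of t 1] less_imp_le[OF ground_pos[of 1]], of 2] by (simp add: ground_1_sq)

lemma ground_sq_le: "t \<in> {0..1} \<Longrightarrow> (ground t)\<^sup>2 \<le> 1"
  unfolding ground_def by (simp add: abs_square_le_1)

lemma ground_deriv:
  assumes "t \<in> {0..1}"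
  shows "(ground has_real_derivative ground_log_deriv t * ground t) (at t within A)"
proof -
  have "(ground has_real_derivative - sin (freq * t + phase) * freq) (at t within A)"
    unfolding ground_def by (auto intro!: derivative_eq_intros)
  also have "- sin (freq * t + phase) * freq = ground_log_deriv t * ground t"
    using ground_pos[OF assms] by (simp add: ground_log_deriv_def ground_def tan_def)
  finally show ?thesis .
qed

text \<open>The Riccati equation is the eigenvalue equation for the logarithmic derivative.\<close>

lemma ground_log_deriv_deriv:
  assumes "t \<in> {0..1}"
  shows "(ground_log_deriv has_real_derivative - (spec + (ground_log_deriv t)\<^sup>2)) (at t within A)"
proof -
  have c: "cos (freq * t + phase) \<noteq> 0" using ground_pos[OF assms] by (simp add: ground_def)
  have "(ground_log_deriv has_real_derivative - freq * (inverse ((cos (freq * t + phase))\<^sup>2) * freq)) (at t within A)"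
    unfolding ground_log_deriv_def using c
    by (auto intro!: derivative_eq_intros simp: power_inverse)
  also have "inverse ((cos (freq * t + phase))\<^sup>2) = 1 + (tan (freq * t + phase))\<^sup>2"
    using tan_sec[OF c] by (simp add: power_inverse)
  also have "- freq * ((1 + (tan (freq * t + phase))\<^sup>2) * freq) = - (spec + (ground_log_deriv t)\<^sup>2)"
    by (simp add: spec_def ground_log_deriv_def power2_eq_square algebra_simps)
  finally show ?thesis .
qed

lemma continuous_on_ground_log_deriv: "continuous_on {0..1} ground_log_deriv"
  using DERIV_continuous_on[OF ground_log_deriv_deriv] by blast

lemma continuous_on_ground: "continuous_on {0..1} ground"
  using DERIV_continuous_on[OF ground_deriv] by blast

lemma primitive_ground_log_deriv: "primitive ground_log_deriv (\<lambda>t. - (spec + (ground_log_deriv t)\<^sup>2))"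
  by (rule primitive_C1[OF ground_log_deriv_deriv])
    (simp, intro continuous_intros continuous_on_ground_log_deriv)

text \<open>
  With \<open>q\<close> the derivative of \<open>f\<close>, this is the integral of the square of \<open>ground\<close> times the
  derivative of \<open>f / ground\<close>.
\<close>

definition excess :: "(real \<Rightarrow> real) \<Rightarrow> (real \<Rightarrow> real) \<Rightarrow> real" where
  "excess f q = (\<integral>t. (q t - ground_log_deriv t * f t)\<^sup>2 \<partial>unit_leb)"

lemma excess_nonneg: "excess f q \<ge> 0"
  by (simp add: excess_def)

text \<open>
  The ground state representation: expand the square, and integrate the derivative of
  \<open>ground_log_deriv * f\<^sup>2\<close> by means of the Riccati equation.
\<close>

lemma excess_eq:
  assumes f: "primitive f q"
  shows "excess f q = (\<integral>t. (q t)\<^sup>2 \<partial>unit_leb) - spec * (\<integral>t. (f t)\<^sup>2 \<partial>unit_leb)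
    + root_slope * (2 * (f 1)\<^sup>2 - (f 0)\<^sup>2)"
proof -
  let ?h = ground_log_deriv
  note q = primitive_L2[OF f] and f2 = L2_continuous[OF primitive_continuous[OF f]]
  let ?r = "\<lambda>t. - (spec + (?h t)\<^sup>2) * f t + ?h t * q t"
  have p: "primitive (\<lambda>t. ?h t * f t) ?r"
    by (rule primitive_mult[OF primitive_ground_log_deriv f])
  note hf = L2_continuous[OF primitive_continuous[OF p]]
  have i: "integrable unit_leb (\<lambda>t. ?r t * f t)" "integrable unit_leb (\<lambda>t. ?h t * f t * q t)"
    "integrable unit_leb (\<lambda>t. (q t)\<^sup>2)" "integrable unit_leb (\<lambda>t. (f t)\<^sup>2)"
    by (intro L2_mult_integrable primitive_L2[OF p] f2 hf q L2_sq_integrable)+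
  have "(\<integral>t. ?r t * f t \<partial>unit_leb) + (\<integral>t. ?h t * f t * q t \<partial>unit_leb) = ?h 1 * f 1 * f 1 - ?h 0 * f 0 * f 0"
    by (rule primitive_by_parts[OF p f])
  moreover have "excess f q = (\<integral>t. (q t)\<^sup>2 - (?r t * f t + ?h t * f t * q t) - spec * (f t)\<^sup>2 \<partial>unit_leb)"
    unfolding excess_def by (rule integral_unit_cong) (simp add: power2_eq_square algebra_simps)
  moreover have "\<dots> = (\<integral>t. (q t)\<^sup>2 \<partial>unit_leb) - ((\<integral>t. ?r t * f t \<partial>unit_leb) + (\<integral>t. ?h t * f t * q t \<partial>unit_leb))
      - spec * (\<integral>t. (f t)\<^sup>2 \<partial>unit_leb)"
    using i by simp
  ultimately show ?thesis
    by (simp add: ground_log_deriv_ends power2_eq_square algebra_simps)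
qed

text \<open>
  The constant is the reciprocal of the minimum of the square of \<open>ground\<close>.
\<close>

lemma excess_controls_oscillation:
  assumes f: "primitive f q" and t: "t \<in> {0..1}"
  shows "(f t / ground t - f 0 / ground 0)\<^sup>2 \<le> 3 * excess f q"
proof -
  let ?h = ground_log_deriv
  define w where "w t = q t - ?h t * f t" for t
  note q = primitive_L2[OF f] and f2 = L2_continuous[OF primitive_continuous[OF f]]
  have w: "L2 w"
    unfolding w_def by (intro L2_diff q L2_mult_continuous f2 continuous_on_ground_log_deriv)
  have ne: "ground t \<noteq> 0" if "t \<in> {0..1}" for t using ground_pos[OF that] by simp
  have ci: "continuous_on {0..1} (\<lambda>t. 1 / ground t)"
    using ne by (intro continuous_intros continuous_on_ground) auto
  have "primitive (\<lambda>t. 1 / ground t) (\<lambda>t. - ?h t / ground t)"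
  proof (rule primitive_C1)
    show "continuous_on {0..1} (\<lambda>t. - ?h t / ground t)"
      using ne by (intro continuous_intros continuous_on_ground continuous_on_ground_log_deriv) auto
    fix t :: real assume t: "t \<in> {0..1}"
    have "((\<lambda>t. 1 / ground t) has_real_derivative (0 * ground t - 1 * (?h t * ground t)) / (ground t * ground t)) (at t within {0..1})"
      by (intro DERIV_divide ground_deriv t DERIV_const ne)
    then show "((\<lambda>t. 1 / ground t) has_real_derivative - ?h t / ground t) (at t within {0..1})"
      using ne[OF t] by simp
  qed
  from primitive_mult[OF this f] have "primitive (\<lambda>t. 1 / ground t * f t) (\<lambda>t. 1 / ground t * w t)"
    by (rule primitive_cong) (simp_all add: w_def diff_divide_distrib)
  from primitive_holder[OF this, of 0 t] t
  have "(f t / ground t - f 0 / ground 0)\<^sup>2 \<le> t * (\<integral>t. (1 / ground t * w t)\<^sup>2 \<partial>unit_leb)" by simp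
  also have "\<dots> \<le> 1 * (\<integral>t. (1 / ground t * w t)\<^sup>2 \<partial>unit_leb)"
    using t by (intro mult_right_mono) auto
  also have "(\<integral>t. (1 / ground t * w t)\<^sup>2 \<partial>unit_leb) \<le> (\<integral>t. 3 * (w t)\<^sup>2 \<partial>unit_leb)"
  proof (rule integral_mono)
    show "integrable unit_leb (\<lambda>t. (1 / ground t * w t)\<^sup>2)"
      by (rule L2_sq_integrable[OF L2_mult_continuous[OF w ci]])
    show "integrable unit_leb (\<lambda>t. 3 * (w t)\<^sup>2)" using L2_sq_integrable[OF w] by simp
    fix t assume "t \<in> space unit_leb"
    then have t: "t \<in> {0..1}" by (simp add: space_unit_leb)
    have "1 / (ground t)\<^sup>2 \<le> 3" using ground_sq_ge[OF t] ground_pos[OF t] by (simp add: field_simps)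
    then have "1 / (ground t)\<^sup>2 * (w t)\<^sup>2 \<le> 3 * (w t)\<^sup>2" by (intro mult_right_mono) auto
    then show "(1 / ground t * w t)\<^sup>2 \<le> 3 * (w t)\<^sup>2" by (simp add: power_mult_distrib power_divide)
  qed
  also have "\<dots> = 3 * excess f q" by (simp add: excess_def w_def)
  finally show ?thesis by simp
qed

section \<open>Limits of square-integrable functions\<close>

lemma integral_Fatou_le:
  fixes f :: "nat \<Rightarrow> real \<Rightarrow> real"
  assumes i: "\<And>n. integrable M (f n)" and 0: "\<And>n t. 0 \<le> f n t"
    and K: "\<forall>\<^sub>F n in sequentially. (\<integral>t. f n t \<partial>M) \<le> K"
    and g: "g \<in> borel_measurable M" and lim: "AE t in M. (\<lambda>n. f n t) \<longlonglongrightarrow> g t"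
  shows "integrable M g" "(\<integral>t. g t \<partial>M) \<le> K"
proof -
  obtain N where N: "\<And>n. n \<ge> N \<Longrightarrow> (\<integral>t. f n t \<partial>M) \<le> K"
    using K by (auto simp: eventually_sequentially)
  have K0: "K \<ge> 0" using order_trans[OF Bochner_Integration.integral_nonneg[of M "f N"] N[of N]] 0 by simp
  have g0: "AE t in M. 0 \<le> g t"
    using lim by eventually_elim (rule LIMSEQ_le_const, auto simp: 0)
  have "(\<integral>\<^sup>+t. ennreal (g t) \<partial>M) = (\<integral>\<^sup>+t. liminf (\<lambda>n. ennreal (f n t)) \<partial>M)"
  proof (rule nn_integral_cong_AE)
    show "AE t in M. ennreal (g t) = liminf (\<lambda>n. ennreal (f n t))"
      using lim
    proof eventually_elim
      case (elim t)
      then have "(\<lambda>n. ennreal (f n t)) \<longlonglongrightarrow> ennreal (g t)" by (rule tendsto_ennrealI)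
      then show ?case by (simp add: lim_imp_Liminf)
    qed
  qed
  also have "\<dots> \<le> liminf (\<lambda>n. \<integral>\<^sup>+t. ennreal (f n t) \<partial>M)"
    by (rule nn_integral_liminf) (use i in auto)
  also have "\<dots> = liminf (\<lambda>n. ennreal (\<integral>t. f n t \<partial>M))"
    using i 0 by (simp add: nn_integral_eq_integral)
  also have "\<dots> \<le> liminf (\<lambda>n. ennreal K)"
    by (rule Liminf_mono) (use K in eventually_elim, auto intro: ennreal_leI)
  finally have le: "(\<integral>\<^sup>+t. ennreal (g t) \<partial>M) \<le> ennreal K" by (simp add: Liminf_const)
  show *: "integrable M g"
  proof (rule integrableI_nonneg[OF g g0])
    show "(\<integral>\<^sup>+t. ennreal (g t) \<partial>M) < \<infinity>" using le by (auto simp: less_top[symmetric] top_unique)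
  qed
  have "ennreal (\<integral>t. g t \<partial>M) \<le> ennreal K"
    using le nn_integral_eq_integral[OF * g0] by simp
  then show "(\<integral>t. g t \<partial>M) \<le> K" using K0 by simp
qed

text \<open>
  Completeness of the space of square-integrable functions: a subsequence whose increments are
  summable in mean converges almost everywhere, and Fatou's lemma turns this limit into a limit in
  the quadratic mean.
\<close>

lemma L2_complete:
  assumes q: "\<And>n. L2 (q n)"
    and cauchy: "\<And>e. e > 0 \<Longrightarrow> \<exists>N. \<forall>m\<ge>N. \<forall>n\<ge>N. (\<integral>t. (q m t - q n t)\<^sup>2 \<partial>unit_leb) \<le> e"
  obtains r g where "strict_mono (r :: nat \<Rightarrow> nat)" "L2 g"
    "AE t in unit_leb. (\<lambda>i. q (r i) t) \<longlonglongrightarrow> g t"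
    "(\<lambda>n. \<integral>t. (q n t - g t)\<^sup>2 \<partial>unit_leb) \<longlonglongrightarrow> 0"
proof -
  note L = L2_diff[OF q q]
  obtain N where N: "\<And>i m n. m \<ge> N i \<Longrightarrow> n \<ge> N i \<Longrightarrow> (\<integral>t. (q m t - q n t)\<^sup>2 \<partial>unit_leb) \<le> (1/4) ^ i"
    using cauchy[of "(1/4) ^ i" for i] by (auto simp: zero_less_power) metis
  define r where "r = rec_nat (N 0) (\<lambda>i x. max (Suc x) (N (Suc i)))"
  have rS: "r (Suc i) = max (Suc (r i)) (N (Suc i))" for i by (simp add: r_def)
  have r_mono: "strict_mono r" by (rule strict_mono_Suc_iff[THEN iffD2]) (simp add: rS less_max_iff_disj)
  have rN: "r i \<ge> N i" for i by (cases i) (simp_all add: rS, simp add: r_def)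
  define d where "d i t = q (r (Suc i)) t - q (r i) t" for i t
  have d: "L2 (d i)" for i unfolding d_def by (rule L)
  have d1: "(\<integral>t. \<bar>d i t\<bar> \<partial>unit_leb) \<le> (1/2) ^ i" for i
  proof -
    have "(\<integral>t. (d i t)\<^sup>2 \<partial>unit_leb) \<le> (1/4) ^ i"
      unfolding d_def by (rule N) (use rN[of i] rS[of i] in auto)
    moreover have "(\<integral>t. \<bar>d i t * 1\<bar> \<partial>unit_leb) \<le> sqrt ((\<integral>t. (d i t)\<^sup>2 \<partial>unit_leb) * (\<integral>t. 1\<^sup>2 \<partial>unit_leb))"
      by (rule integral_abs_mult_le[OF d L2_const])
    ultimately have "(\<integral>t. \<bar>d i t\<bar> \<partial>unit_leb) \<le> sqrt ((1/4) ^ i)"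
      by (simp add: space_unit_leb measure_unit_leb_space) (meson order_trans real_sqrt_le_mono)
    also have "sqrt ((1/4) ^ i) = (1/2::real) ^ i"
      by (simp add: real_sqrt_power real_sqrt_divide)
    finally show ?thesis .
  qed
  have ae: "AE t in unit_leb. summable (\<lambda>i. d i t)"
  proof -
    have "(\<integral>\<^sup>+t. (\<Sum>i. ennreal \<bar>d i t\<bar>) \<partial>unit_leb) = (\<Sum>i. \<integral>\<^sup>+t. ennreal \<bar>d i t\<bar> \<partial>unit_leb)"
      by (rule nn_integral_suminf) (use L2_measurable[OF d] in measurable)
    also have "\<dots> \<le> (\<Sum>i. ennreal ((1/2) ^ i))"
    proof (rule suminf_le)
      show "(\<integral>\<^sup>+t. ennreal \<bar>d i t\<bar> \<partial>unit_leb) \<le> ennreal ((1/2) ^ i)" for i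
        using nn_integral_eq_integral[of unit_leb "\<lambda>t. \<bar>d i t\<bar>"] L2_integrable[OF d[of i]] d1[of i]
        by (simp add: ennreal_leI)
    qed auto
    also have "\<dots> = ennreal (\<Sum>i. (1/2) ^ i)"
      by (rule suminf_ennreal2) (auto intro!: summable_geometric)
    finally have "(\<integral>\<^sup>+t. (\<Sum>i. ennreal \<bar>d i t\<bar>) \<partial>unit_leb) \<noteq> \<infinity>"
      by (auto simp: top_unique)
    then have "AE t in unit_leb. (\<Sum>i. ennreal \<bar>d i t\<bar>) \<noteq> \<infinity>"
      by (intro nn_integral_PInf_AE) (use L2_measurable[OF d] in measurable)
    then show ?thesis
    proof eventually_elim
      case (elim t)
      then have "summable (\<lambda>i. \<bar>d i t\<bar>)"
        by (intro summable_suminf_not_top) auto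
      then show ?case by (rule summable_rabs_cancel)
    qed
  qed
  define g where "g t = lim (\<lambda>i. q (r i) t)" for t
  have lim: "AE t in unit_leb. (\<lambda>i. q (r i) t) \<longlonglongrightarrow> g t"
    using ae
  proof eventually_elim
    case (elim t)
    have tel: "(\<Sum>i<n. d i t) = q (r n) t - q (r 0) t" for n
      unfolding d_def by (rule sum_lessThan_telescope)
    have "(\<lambda>n. (\<Sum>i<n. d i t) + q (r 0) t) \<longlonglongrightarrow> suminf (\<lambda>i. d i t) + q (r 0) t"
      by (intro tendsto_intros summable_LIMSEQ elim)
    then have "(\<lambda>n. q (r n) t) \<longlonglongrightarrow> suminf (\<lambda>i. d i t) + q (r 0) t" by (simp add: tel)
    then show ?case unfolding g_def by (simp add: limI)
  qed
  have gm: "g \<in> borel_measurable unit_leb"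
    unfolding g_def by (rule borel_measurable_lim_metric) (rule L2_measurable[OF q])
  have close: "L2 (\<lambda>t. q n t - g t)" "(\<integral>t. (q n t - g t)\<^sup>2 \<partial>unit_leb) \<le> (1/4) ^ k" if n: "n \<ge> N k" for n k
  proof -
    have F: "integrable unit_leb (\<lambda>t. (q n t - g t)\<^sup>2)" "(\<integral>t. (q n t - g t)\<^sup>2 \<partial>unit_leb) \<le> (1/4) ^ k"
    proof (atomize (full), rule conjI)
      let ?f = "\<lambda>i t. (q n t - q (r i) t)\<^sup>2"
      have 1: "\<And>i. integrable unit_leb (?f i)" by (rule L2_sq_integrable[OF L])
      have "r i \<ge> N k" if "i \<ge> k" for i
        using rN[of k] strict_mono_leD[OF r_mono that] by linarith
      then have 2: "\<forall>\<^sub>F i in sequentially. (\<integral>t. ?f i t \<partial>unit_leb) \<le> (1/4) ^ k"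
        using N[OF n] by (auto simp: eventually_sequentially)
      have 3: "(\<lambda>t. (q n t - g t)\<^sup>2) \<in> borel_measurable unit_leb"
        by (intro borel_measurable_power borel_measurable_diff L2_measurable[OF q] gm)
      have 4: "AE t in unit_leb. (\<lambda>i. ?f i t) \<longlonglongrightarrow> (q n t - g t)\<^sup>2"
        using lim by eventually_elim (intro tendsto_intros)
      note FF = integral_Fatou_le[of unit_leb ?f, OF 1 _ 2 3 4]
      show "integrable unit_leb (\<lambda>t. (q n t - g t)\<^sup>2)" by (rule FF) simp
      show "(\<integral>t. (q n t - g t)\<^sup>2 \<partial>unit_leb) \<le> (1/4) ^ k" by (rule FF) simp
    qed
    then show "L2 (\<lambda>t. q n t - g t)" "(\<integral>t. (q n t - g t)\<^sup>2 \<partial>unit_leb) \<le> (1/4) ^ k"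
      using borel_measurable_diff[OF L2_measurable[OF q[of n]] gm] by (simp_all add: L2_def)
  qed
  have "L2 g" using L2_diff[OF q[of "N 0"] close(1)[of 0 "N 0"]] by simp
  moreover have "(\<lambda>n. \<integral>t. (q n t - g t)\<^sup>2 \<partial>unit_leb) \<longlonglongrightarrow> 0"
  proof (rule LIMSEQ_I)
    fix e :: real assume "e > 0"
    then obtain k where k: "(1/4) ^ k < e" using real_arch_pow_inv[of e "1/4"] by auto
    show "\<exists>no. \<forall>n\<ge>no. norm ((\<integral>t. (q n t - g t)\<^sup>2 \<partial>unit_leb) - 0) < e"
      using close(2)[of k] k by (intro exI[of _ "N k"]) (auto intro: le_less_trans)
  qed
  ultimately show ?thesis using that r_mono lim by blast
qed

text \<open>
  The weak limit is replaced by a strong limit of convex combinations. Among the functions that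
  approximate \<open>f\<close> pointwise as well as the tail of the sequence does, choose one of almost minimal
  Dirichlet integral; this class is closed under midpoints, and so the parallelogram identity makes
  the chosen derivatives a Cauchy sequence.
\<close>

lemma primitive_lower_semicontinuous:
  assumes F: "\<And>j. primitive (F j) (Q j)"
    and lim: "\<And>t. t \<in> {0..1} \<Longrightarrow> (\<lambda>j. F j t) \<longlonglongrightarrow> f t"
    and K: "\<And>j. (\<integral>t. (Q j t)\<^sup>2 \<partial>unit_leb) \<le> K"
  obtains q where "primitive f q" "(\<integral>t. (q t)\<^sup>2 \<partial>unit_leb) \<le> K"
proof -
  define close where "close n G \<longleftrightarrow>
    (\<forall>t\<in>{0..1}. \<forall>\<epsilon>. (\<forall>k\<ge>n. \<bar>F k t - f t\<bar> \<le> \<epsilon>) \<longrightarrow> \<bar>G t - f t\<bar> \<le> \<epsilon>)" for n :: nat and G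
  define S where "S n = {q. \<exists>G. primitive G q \<and> close n G}" for n
  define I where "I q = (\<integral>t. (q t)\<^sup>2 \<partial>unit_leb)" for q :: "real \<Rightarrow> real"
  define d where "d n = Inf (I ` S n)" for n
  have I0: "I q \<ge> 0" for q by (simp add: I_def)
  have bdd: "bdd_below (I ` A)" for A by (rule bdd_belowI[of _ 0]) (auto simp: I0)
  have QS: "Q k \<in> S n" if "k \<ge> n" for k n
    unfolding S_def close_def using that F[of k] by blast
  have S_L2: "L2 q" if "q \<in> S n" for q n using that by (auto simp: S_def primitive_L2)
  have S_mono: "S m \<subseteq> S n" if "n \<le> m" for m n
    unfolding S_def close_def using order_trans[OF that] by blast
  have d_le: "d n \<le> I q" if "q \<in> S n" for q n
    unfolding d_def by (rule cInf_lower[OF imageI[OF that] bdd])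
  have dK: "d n \<le> K" for n using d_le[OF QS[of n n]] K[of n] by (simp add: I_def)
  have d_mono: "d n \<le> d m" if "n \<le> m" for n m
    unfolding d_def using QS[of m m] S_mono[OF that]
    by (intro cInf_superset_mono bdd image_mono) auto
  have "\<exists>q\<in>S n. I q < d n + 1 / Suc n" for n
    using cInf_lessD[of "I ` S n" "d n + 1 / Suc n"] QS[of n n] by (auto simp: d_def)
  then obtain q where qS: "\<And>n. q n \<in> S n" and qd: "\<And>n. I (q n) < d n + 1 / Suc n" by metis
  have mid: "(\<lambda>t. 1/2 * q n t + 1/2 * q m t) \<in> S n" if nm: "n \<le> m" for n m
  proof -
    have "q m \<in> S n" using qS[of m] S_mono[OF nm] by blast
    then obtain G where G: "primitive G (q m)" "close n G" by (auto simp: S_def)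
    obtain H where H: "primitive H (q n)" "close n H" using qS[of n] by (auto simp: S_def)
    have "primitive (\<lambda>t. 1/2 * H t + 1/2 * G t) (\<lambda>t. 1/2 * q n t + 1/2 * q m t)"
      by (intro primitive_add primitive_cmult G H)
    moreover have "close n (\<lambda>t. 1/2 * H t + 1/2 * G t)"
      unfolding close_def
    proof (intro ballI allI impI)
      fix t \<epsilon> :: real assume t: "t \<in> {0..1}" and e: "\<forall>k\<ge>n. \<bar>F k t - f t\<bar> \<le> \<epsilon>"
      have "\<bar>H t - f t\<bar> \<le> \<epsilon>" "\<bar>G t - f t\<bar> \<le> \<epsilon>"
        using G(2) H(2) t e unfolding close_def by blast+
      then show "\<bar>1/2 * H t + 1/2 * G t - f t\<bar> \<le> \<epsilon>" by linarith
    qed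
    ultimately show ?thesis by (auto simp: S_def)
  qed
  have par: "I (\<lambda>t. q m t - q n t) \<le> 2 * (d m - d n) + 4 / Suc n" if nm: "n \<le> m" for n m
  proof -
    note L = S_L2[OF qS]
    have i: "integrable unit_leb (\<lambda>t. (q n t)\<^sup>2)" for n by (rule L2_sq_integrable[OF L])
    have i2: "integrable unit_leb (\<lambda>t. (1/2 * q n t + 1/2 * q m t)\<^sup>2)"
      by (rule L2_sq_integrable[OF L2_add[OF L2_cmult[OF L] L2_cmult[OF L]]])
    have "I (\<lambda>t. q m t - q n t)
      = (\<integral>t. 2 * (q m t)\<^sup>2 + 2 * (q n t)\<^sup>2 - 4 * (1/2 * q n t + 1/2 * q m t)\<^sup>2 \<partial>unit_leb)"
      unfolding I_def by (rule integral_unit_cong) (simp add: power2_eq_square algebra_simps)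
    also have "\<dots> = 2 * I (q m) + 2 * I (q n) - 4 * I (\<lambda>t. 1/2 * q n t + 1/2 * q m t)"
      using i i2 by (simp add: I_def)
    finally have "I (\<lambda>t. q m t - q n t) = 2 * I (q m) + 2 * I (q n) - 4 * I (\<lambda>t. 1/2 * q n t + 1/2 * q m t)" .
    moreover have "d n \<le> I (\<lambda>t. 1/2 * q n t + 1/2 * q m t)" by (rule d_le[OF mid[OF nm]])
    moreover have "(1::real) / Suc m \<le> 1 / Suc n" using nm by (simp add: frac_le)
    ultimately show ?thesis using qd[of n] qd[of m] by simp
  qed
  have "convergent d"
  proof (rule Bseq_mono_convergent)
    have "0 \<le> d n" for n
      unfolding d_def using QS[of n n] I0 by (intro cInf_greatest) auto
    then show "Bseq d" using dK by (intro BseqI'[of d K]) simp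
  qed (use d_mono in blast)
  then have "Cauchy d" by (rule convergent_Cauchy)
  obtain r g where r: "strict_mono r" "L2 g" "AE t in unit_leb. (\<lambda>i. q (r i) t) \<longlonglongrightarrow> g t"
    and conv: "(\<lambda>n. \<integral>t. (q n t - g t)\<^sup>2 \<partial>unit_leb) \<longlonglongrightarrow> 0"
  proof (rule L2_complete)
    show "L2 (q n)" for n by (rule S_L2[OF qS])
    fix e :: real assume e: "e > 0"
    have "e / 4 > 0" using e by simp
    then obtain N1 where N1: "\<And>m n. m \<ge> N1 \<Longrightarrow> n \<ge> N1 \<Longrightarrow> \<bar>d m - d n\<bar> < e / 4"
      using CauchyD[OF \<open>Cauchy d\<close>, of "e/4"] unfolding real_norm_def by blast
    obtain N2 where N2: "1 / Suc N2 < e / 8" using nat_approx_posE[of "e/8"] e by auto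
    have *: "I (\<lambda>t. q m t - q n t) \<le> e" if "n \<ge> max N1 N2" "n \<le> m" for m n
    proof -
      have "(1::real) / Suc n \<le> 1 / Suc N2" using that by (simp add: frac_le)
      then have "4 / Suc n \<le> e / 2" using N2 by simp
      moreover have "\<bar>d m - d n\<bar> < e / 4" by (rule N1) (use that in auto)
      then have "d m - d n < e / 4" by (rule le_less_trans[OF abs_ge_self])
      then have "2 * (d m - d n) \<le> e / 2" by simp
      ultimately show ?thesis using par[OF that(2)] by linarith
    qed
    have "I (\<lambda>t. q m t - q n t) \<le> e" if "n \<ge> max N1 N2" "m \<ge> max N1 N2" for m n
    proof (cases "n \<le> m")
      case True
      then show ?thesis using * that by blast
    next
      case False
      then have "I (\<lambda>t. q n t - q m t) \<le> e" using * that by simp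
      then show ?thesis by (simp add: I_def power2_commute)
    qed
    then show "\<exists>N. \<forall>m\<ge>N. \<forall>n\<ge>N. (\<integral>t. (q m t - q n t)\<^sup>2 \<partial>unit_leb) \<le> e"
      unfolding I_def by blast
  qed
  have "I g \<le> K"
    unfolding I_def
  proof (rule field_le_epsilon)
    fix e :: real assume e: "e > 0"
    show "(\<integral>t. (g t)\<^sup>2 \<partial>unit_leb) \<le> K + e"
    proof (rule integral_Fatou_le(2)[of unit_leb "\<lambda>i t. (q (r i) t)\<^sup>2"])
      show "integrable unit_leb (\<lambda>t. (q (r n) t)\<^sup>2)" for n by (rule L2_sq_integrable[OF S_L2[OF qS]])
      obtain N where N: "1 / Suc N < e" using nat_approx_posE[OF e] by auto
      have "I (q (r n)) \<le> K + e" if "n \<ge> N" for n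
      proof -
        have "N \<le> r n" using that seq_suble[OF r(1), of n] by linarith
        then have "(1::real) / Suc (r n) \<le> 1 / Suc N" by (simp add: frac_le)
        then show ?thesis using N qd[of "r n"] dK[of "r n"] by linarith
      qed
      then show "\<forall>\<^sub>F n in sequentially. (\<integral>t. (q (r n) t)\<^sup>2 \<partial>unit_leb) \<le> K + e"
        by (auto simp: eventually_sequentially I_def)
      show "(\<lambda>t. (g t)\<^sup>2) \<in> borel_measurable unit_leb"
        by (intro borel_measurable_power L2_measurable r)
      show "AE t in unit_leb. (\<lambda>i. (q (r i) t)\<^sup>2) \<longlonglongrightarrow> (g t)\<^sup>2"
        using r(3) by eventually_elim (intro tendsto_intros)
    qed simp
  qed
  moreover have "primitive f g"
  proof (rule primitiveI[OF r(2)])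
    obtain G where G: "\<And>n. primitive (G n) (q n)" "\<And>n. close n (G n)"
      using qS unfolding S_def by (auto simp: mem_Collect_eq) metis
    have Gf: "(\<lambda>n. G n t) \<longlonglongrightarrow> f t" if t: "t \<in> {0..1}" for t
    proof (rule LIMSEQ_I)
      fix e :: real assume e: "e > 0"
      then obtain N where N: "\<And>k. k \<ge> N \<Longrightarrow> \<bar>F k t - f t\<bar> < e / 2"
        using LIMSEQ_D[OF lim[OF t], of "e/2"] by auto
      have "norm (G n t - f t) < e" if "n \<ge> N" for n
      proof -
        have "\<forall>k\<ge>n. \<bar>F k t - f t\<bar> \<le> e / 2"
          using N order_trans[OF that] less_imp_le by blast
        then have "\<bar>G n t - f t\<bar> \<le> e / 2"
          using G(2)[of n] t unfolding close_def by blast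
        then show ?thesis using e by simp
      qed
      then show "\<exists>no. \<forall>n\<ge>no. norm (G n t - f t) < e" by blast
    qed
    fix t :: real assume t: "t \<in> {0..1}"
    have "(\<lambda>n. antideriv (q n) t - antideriv g t) \<longlonglongrightarrow> 0"
    proof (rule Lim_null_comparison)
      show "(\<lambda>n. sqrt (\<integral>t. (q n t - g t)\<^sup>2 \<partial>unit_leb)) \<longlonglongrightarrow> 0"
        using tendsto_real_sqrt[OF conv] by simp
      show "\<forall>\<^sub>F n in sequentially. norm (antideriv (q n) t - antideriv g t) \<le> sqrt (\<integral>t. (q n t - g t)\<^sup>2 \<partial>unit_leb)"
      proof (intro always_eventually allI)
        fix n
        have L: "L2 (\<lambda>t. q n t - g t)" by (intro L2_diff S_L2[OF qS] r)
        note p = antideriv_primitive[OF L]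
        have "antideriv (q n) t - antideriv g t = antideriv (\<lambda>t. q n t - g t) t"
          using antideriv_add[OF L2_integrable[OF S_L2[OF qS]] L2_integrable[OF L2_cmult[OF r(2), of "-1"]], of n t]
          unfolding antideriv_cmult by (simp only: mult_minus1 add_uminus_conv_diff)
        moreover have "(antideriv (\<lambda>t. q n t - g t) t)\<^sup>2 \<le> 1 * (\<integral>t. (q n t - g t)\<^sup>2 \<partial>unit_leb)"
          using primitive_holder[OF p, of 0 t] t
          by (intro order_trans[OF _ mult_right_mono[of t 1]]) (auto simp: antideriv_0)
        ultimately show "norm (antideriv (q n) t - antideriv g t) \<le> sqrt (\<integral>t. (q n t - g t)\<^sup>2 \<partial>unit_leb)"
          by (simp add: real_le_rsqrt)
      qed
    qed
    then have "(\<lambda>n. G n 0 + (antideriv (q n) t - antideriv g t) + antideriv g t) \<longlonglongrightarrow> f 0 + 0 + antideriv g t"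
      by (intro tendsto_intros Gf) simp_all
    moreover have "G n 0 + (antideriv (q n) t - antideriv g t) + antideriv g t = G n t" for n
      using primitive_eq[OF G(1) t] by simp
    ultimately have "(\<lambda>n. G n t) \<longlonglongrightarrow> f 0 + antideriv g t" by simp
    then show "f t = f 0 + antideriv g t" using Gf[OF t] LIMSEQ_unique by blast
  qed
  ultimately show ?thesis using that by (simp add: I_def)
qed

section \<open>Radial profiles\<close>

definition dirichlet :: "(real \<Rightarrow> real) \<Rightarrow> real" where
  "dirichlet f = (\<integral>t. (weak_deriv f t)\<^sup>2 \<partial>unit_leb)"

definition sq_norm :: "(real \<Rightarrow> real) \<Rightarrow> real" where
  "sq_norm f = (\<integral>t. (f t)\<^sup>2 \<partial>unit_leb)"

definition pow_norm :: "real \<Rightarrow> (real \<Rightarrow> real) \<Rightarrow> real" where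
  "pow_norm p f = (\<integral>t. \<bar>f t\<bar> powr p \<partial>unit_leb)"

lemma dirichlet_nonneg: "dirichlet f \<ge> 0" and sq_norm_nonneg: "sq_norm f \<ge> 0"
  and pow_norm_nonneg: "pow_norm p f \<ge> 0"
  by (simp_all add: dirichlet_def sq_norm_def pow_norm_def)

lemma dirichlet_eq: "primitive f q \<Longrightarrow> dirichlet f = (\<integral>t. (q t)\<^sup>2 \<partial>unit_leb)"
  unfolding dirichlet_def using primitive_unique_energy primitive_H1_unit(2) by blast

lemma dirichlet_cong:
  assumes "primitive f q" "\<And>t. t \<in> {0..1} \<Longrightarrow> f t = g t"
  shows "dirichlet f = dirichlet g"
  using dirichlet_eq[OF assms(1)] dirichlet_eq[OF primitive_cong[OF assms(1), of g q]] assms(2) by simp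

lemma sq_norm_cong: "(\<And>t. t \<in> {0..1} \<Longrightarrow> f t = g t) \<Longrightarrow> sq_norm f = sq_norm g"
  unfolding sq_norm_def by (rule integral_unit_cong) simp

lemma pow_norm_cong: "(\<And>t. t \<in> {0..1} \<Longrightarrow> f t = g t) \<Longrightarrow> pow_norm p f = pow_norm p g"
  unfolding pow_norm_def by (rule integral_unit_cong) simp

lemma continuous_on_abs_powr:
  fixes f :: "real \<Rightarrow> real"
  assumes "continuous_on A f" "p > 0"
  shows "continuous_on A (\<lambda>t. \<bar>f t\<bar> powr p)"
  using assms by (intro continuous_on_powr' continuous_intros) auto

lemma pow_norm_le:
  assumes f: "continuous_on {0..1} f" and p: "p > 0"
    and K: "\<And>t. t \<in> {0..1} \<Longrightarrow> (f t)\<^sup>2 \<le> K"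
  shows "pow_norm p f \<le> K powr (p / 2)"
  unfolding pow_norm_def
proof (rule integral_unit_bound)
  show "integrable unit_leb (\<lambda>t. \<bar>f t\<bar> powr p)"
    by (rule continuous_on_integrable_unit[OF continuous_on_abs_powr[OF f p]])
  fix t :: real assume t: "t \<in> {0..1}"
  have "\<bar>f t\<bar> powr p = ((f t)\<^sup>2) powr (p / 2)"
  proof (cases "f t = 0")
    case False
    then have sq: "(f t)\<^sup>2 = \<bar>f t\<bar> powr 2" by simp
    show ?thesis unfolding sq powr_powr by simp
  qed simp
  also have "\<dots> \<le> K powr (p / 2)"
    using K[OF t] p by (intro powr_mono2) auto
  finally show "\<bar>f t\<bar> powr p \<le> K powr (p / 2)" .
qed

lemma pow_norm_le_sq_norm:
  assumes f: "continuous_on {0..1} f" and p: "p > 2"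
    and K: "\<And>t. t \<in> {0..1} \<Longrightarrow> (f t)\<^sup>2 \<le> K"
  shows "pow_norm p f \<le> K powr ((p - 2) / 2) * sq_norm f"
proof -
  have "pow_norm p f \<le> (\<integral>t. K powr ((p - 2) / 2) * (f t)\<^sup>2 \<partial>unit_leb)"
    unfolding pow_norm_def
  proof (rule integral_mono)
    show "integrable unit_leb (\<lambda>t. \<bar>f t\<bar> powr p)"
      by (rule continuous_on_integrable_unit[OF continuous_on_abs_powr[OF f]]) (use p in simp)
    show "integrable unit_leb (\<lambda>t. K powr ((p - 2) / 2) * (f t)\<^sup>2)"
      by (intro integrable_mult_right L2_sq_integrable L2_continuous f)
    fix t assume "t \<in> space unit_leb"
    then have t: "t \<in> {0..1}" by (simp add: space_unit_leb)
    show "\<bar>f t\<bar> powr p \<le> K powr ((p - 2) / 2) * (f t)\<^sup>2"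
    proof (cases "f t = 0")
      case False
      have sq: "(f t)\<^sup>2 = \<bar>f t\<bar> powr 2" using False by simp
      have "\<bar>f t\<bar> powr p = ((f t)\<^sup>2) powr ((p - 2) / 2) * (f t)\<^sup>2"
      proof -
        have "2 * ((p - 2) / 2) + 2 = p" by (simp add: field_simps)
        then show ?thesis unfolding sq powr_powr powr_add[symmetric] by simp
      qed
      also have "\<dots> \<le> K powr ((p - 2) / 2) * (f t)\<^sup>2"
        using K[OF t] p by (intro mult_right_mono powr_mono2) auto
      finally show ?thesis .
    qed simp
  qed
  then show ?thesis by (simp add: sq_norm_def)
qed

text \<open>
  Radial functions of finite \<open>H\<^sup>1\<close> norm on the rooted tree, where level \<open>n\<close> consists of two to
  the power \<open>n\<close> edges and \<open>U n\<close> is the restriction to each of them. Level \<open>n\<close> begins at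
  distance \<open>n\<close> from the root.
\<close>

definition profile :: "(nat \<Rightarrow> real \<Rightarrow> real) \<Rightarrow> bool" where
  "profile U \<longleftrightarrow> (\<forall>n. primitive (U n) (weak_deriv (U n))) \<and> (\<forall>n. U n 1 = U (Suc n) 0)
    \<and> summable (\<lambda>n. 2 ^ n * sq_norm (U n)) \<and> summable (\<lambda>n. 2 ^ n * dirichlet (U n))"

definition mass :: "(nat \<Rightarrow> real \<Rightarrow> real) \<Rightarrow> real" where
  "mass U = (\<Sum>n. 2 ^ n * sq_norm (U n))"

definition kinetic :: "(nat \<Rightarrow> real \<Rightarrow> real) \<Rightarrow> real" where
  "kinetic U = (\<Sum>n. 2 ^ n * dirichlet (U n))"

definition potential :: "real \<Rightarrow> (nat \<Rightarrow> real \<Rightarrow> real) \<Rightarrow> real" where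
  "potential p U = (\<Sum>n. 2 ^ n * pow_norm p (U n))"

text \<open>
  The part of the kinetic energy that exceeds the cost of the mass at the bottom of the spectrum.
\<close>

definition deficit :: "(nat \<Rightarrow> real \<Rightarrow> real) \<Rightarrow> real" where
  "deficit U = kinetic U - spec * mass U"

definition level_excess :: "(nat \<Rightarrow> real \<Rightarrow> real) \<Rightarrow> nat \<Rightarrow> real" where
  "level_excess U n = 2 ^ n * excess (U n) (weak_deriv (U n))"

lemma profileI:
  assumes "\<And>n. primitive (U n) (Q n)" "\<And>n. U n 1 = U (Suc n) 0"
    "summable (\<lambda>n. 2 ^ n * sq_norm (U n))" "summable (\<lambda>n. 2 ^ n * dirichlet (U n))"
  shows "profile U"
  unfolding profile_def using assms primitive_H1_unit(2) by blast

context
  fixes U assumes U: "profile U"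
begin

lemma profile_primitive: "primitive (U n) (weak_deriv (U n))"
  and profile_glue: "U n 1 = U (Suc n) 0"
  and profile_summable: "summable (\<lambda>n. 2 ^ n * sq_norm (U n))" "summable (\<lambda>n. 2 ^ n * dirichlet (U n))"
  using U by (simp_all add: profile_def)

lemma profile_continuous: "continuous_on {0..1} (U n)"
  by (rule primitive_continuous[OF profile_primitive])

lemma partial_mass_le: "(\<Sum>n<N. 2 ^ n * sq_norm (U n)) \<le> mass U"
  unfolding mass_def by (rule sum_le_suminf[OF profile_summable(1)]) (auto simp: sq_norm_nonneg)

lemma partial_kinetic_le: "(\<Sum>n<N. 2 ^ n * dirichlet (U n)) \<le> kinetic U"
  unfolding kinetic_def by (rule sum_le_suminf[OF profile_summable(2)]) (auto simp: dirichlet_nonneg)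

lemma mass_nonneg: "mass U \<ge> 0" and kinetic_nonneg: "kinetic U \<ge> 0"
  using partial_mass_le[of 0] partial_kinetic_le[of 0] by simp_all

lemma level_le:
  "2 ^ n * sq_norm (U n) \<le> mass U" "2 ^ n * dirichlet (U n) \<le> kinetic U"
proof -
  have "2 ^ n * sq_norm (U n) \<le> (\<Sum>i<Suc n. 2 ^ i * sq_norm (U i))"
    by (rule member_le_sum) (auto simp: sq_norm_nonneg)
  then show "2 ^ n * sq_norm (U n) \<le> mass U" using partial_mass_le[of "Suc n"] by linarith
  have "2 ^ n * dirichlet (U n) \<le> (\<Sum>i<Suc n. 2 ^ i * dirichlet (U i))"
    by (rule member_le_sum) (auto simp: dirichlet_nonneg)
  then show "2 ^ n * dirichlet (U n) \<le> kinetic U" using partial_kinetic_le[of "Suc n"] by linarith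
qed

lemma sq_norm_le_mass: "sq_norm (U n) \<le> mass U" and dirichlet_le_kinetic: "dirichlet (U n) \<le> kinetic U"
proof -
  have *: "x \<le> 2 ^ n * x" if "x \<ge> 0" for x :: real
    using that mult_right_mono[of 1 "2 ^ n" x] by simp
  show "sq_norm (U n) \<le> mass U" using *[OF sq_norm_nonneg] level_le(1) order_trans by blast
  show "dirichlet (U n) \<le> kinetic U" using *[OF dirichlet_nonneg] level_le(2) order_trans by blast
qed

lemma level_sup_bound:
  "t \<in> {0..1} \<Longrightarrow> (U n t)\<^sup>2 \<le> sq_norm (U n) + 2 * sqrt (sq_norm (U n) * dirichlet (U n))"
  using primitive_sup_bound[OF profile_primitive] by (simp add: sq_norm_def dirichlet_def)

lemma sup_bound:
  assumes "t \<in> {0..1}"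
  shows "(U n t)\<^sup>2 \<le> mass U + 2 * sqrt (mass U * kinetic U)"
proof -
  have "sq_norm (U n) * dirichlet (U n) \<le> mass U * kinetic U"
    by (intro mult_mono sq_norm_le_mass dirichlet_le_kinetic mass_nonneg dirichlet_nonneg)
  then have "sqrt (sq_norm (U n) * dirichlet (U n)) \<le> sqrt (mass U * kinetic U)" by simp
  then show ?thesis using level_sup_bound[OF assms, of n] sq_norm_le_mass[of n] by linarith
qed

text \<open>
  The value at a vertex is controlled by the mass and the kinetic energy of the adjacent edge, and
  the sums of both over a level tend to zero.
\<close>

lemma vertex_sum_tendsto_0: "(\<lambda>n. 2 ^ n * (U n 0)\<^sup>2) \<longlonglongrightarrow> 0"
proof (rule tendsto_sandwich)
  show "\<forall>\<^sub>F n in sequentially. 0 \<le> 2 ^ n * (U n 0)\<^sup>2" by simp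
  show "\<forall>\<^sub>F n in sequentially. 2 ^ n * (U n 0)\<^sup>2 \<le> 2 * (2 ^ n * sq_norm (U n)) + 2 ^ n * dirichlet (U n)"
  proof (intro always_eventually allI)
    fix n
    have "2 * sqrt (sq_norm (U n) * dirichlet (U n)) \<le> sq_norm (U n) + dirichlet (U n)"
      using arith_geo_mean_sqrt[OF sq_norm_nonneg dirichlet_nonneg, of "U n" "U n"] by simp
    then have "(U n 0)\<^sup>2 \<le> 2 * sq_norm (U n) + dirichlet (U n)"
      using level_sup_bound[of 0 n] by simp
    from mult_left_mono[OF this, of "2 ^ n"]
    show "2 ^ n * (U n 0)\<^sup>2 \<le> 2 * (2 ^ n * sq_norm (U n)) + 2 ^ n * dirichlet (U n)"
      by (simp add: algebra_simps)
  qed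
  have "(\<lambda>n. 2 * (2 ^ n * sq_norm (U n)) + 2 ^ n * dirichlet (U n)) \<longlonglongrightarrow> 2 * 0 + 0"
    by (intro tendsto_intros summable_LIMSEQ_zero profile_summable)
  then show "(\<lambda>n. 2 * (2 ^ n * sq_norm (U n)) + 2 ^ n * dirichlet (U n)) \<longlonglongrightarrow> 0" by simp
qed simp

lemma level_excess_nonneg: "level_excess U n \<ge> 0"
  by (simp add: level_excess_def excess_nonneg)

lemma level_excess_eq:
  "level_excess U n = 2 ^ n * dirichlet (U n) - spec * (2 ^ n * sq_norm (U n))
    + root_slope * (2 ^ Suc n * (U (Suc n) 0)\<^sup>2 - 2 ^ n * (U n 0)\<^sup>2)"
  unfolding level_excess_def excess_eq[OF profile_primitive] dirichlet_def sq_norm_def profile_glue[symmetric]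
  by (simp add: algebra_simps)

text \<open>The vertex terms of consecutive levels cancel, leaving the one at the root.\<close>

lemma level_excess_sums: "level_excess U sums (deficit U - root_slope * (U 0 0)\<^sup>2)"
proof -
  have "(\<lambda>n. 2 ^ Suc n * (U (Suc n) 0)\<^sup>2 - 2 ^ n * (U n 0)\<^sup>2) sums (0 - 2 ^ 0 * (U 0 0)\<^sup>2)"
    by (rule telescope_sums[OF vertex_sum_tendsto_0])
  note tel = this
  have "(\<lambda>n. 2 ^ n * dirichlet (U n) - spec * (2 ^ n * sq_norm (U n))
    + root_slope * (2 ^ Suc n * (U (Suc n) 0)\<^sup>2 - 2 ^ n * (U n 0)\<^sup>2))
    sums (kinetic U - spec * mass U + root_slope * (0 - 2 ^ 0 * (U 0 0)\<^sup>2))"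
    unfolding kinetic_def mass_def
    by (rule sums_add[OF sums_diff[OF summable_sums[OF profile_summable(2)]
          sums_mult[OF summable_sums[OF profile_summable(1)]]] sums_mult[OF tel]])
  moreover have "level_excess U = (\<lambda>n. 2 ^ n * dirichlet (U n) - spec * (2 ^ n * sq_norm (U n))
    + root_slope * (2 ^ Suc n * (U (Suc n) 0)\<^sup>2 - 2 ^ n * (U n 0)\<^sup>2))"
    by (rule ext) (rule level_excess_eq)
  ultimately show ?thesis by (simp only: deficit_def) simp
qed

lemma partial_excess_le: "root_slope * (U 0 0)\<^sup>2 + (\<Sum>n<N. level_excess U n) \<le> deficit U"
  using sum_le_suminf[OF sums_summable[OF level_excess_sums], of "{..<N}"] sums_unique[OF level_excess_sums]
  by (simp add: level_excess_nonneg)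

lemma deficit_nonneg: "deficit U \<ge> 0"
proof -
  have "root_slope * (U 0 0)\<^sup>2 \<ge> 0" using root_slope_pos by simp
  then show ?thesis using partial_excess_le[of 0] by simp
qed

end

text \<open>
  Twice the constant \<open>3\<close> of \<open>excess_controls_oscillation\<close> for the excesses, and twice the
  reciprocal of the square of \<open>ground 0\<close> for the value at the root.
\<close>

definition decay_const :: real where "decay_const = 6 + 3 / root_slope"

lemma decay_const_pos: "decay_const > 0"
  using root_slope_pos by (simp add: decay_const_def add_pos_pos)

text \<open>
  In terms of \<open>U\<close> divided by the generalised ground state, which on level \<open>n\<close> is \<open>ground\<close> times
  the power \<open>- n / 2\<close> of two, the deficit is a one-dimensional Dirichlet integral plus a multiple of the square of the
  value at the root. The quotient therefore grows at most like the square root of the distance.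
\<close>

lemma profile_decay:
  assumes U: "profile U" and t: "t \<in> {0..1}"
  shows "2 ^ n * (U n t)\<^sup>2 \<le> decay_const * (real n + 2) * deficit U"
proof -
  define v where "v n = sqrt 2 ^ n * (U n 0 / ground 0)" for n
  define \<delta> where "\<delta> i = (if i = 0 then v 0 else v i - v (i - 1))" for i
  have pow: "(sqrt 2 ^ n)\<^sup>2 = (2 ^ n :: real)" for n
    by (metis mult.commute power_mult real_sqrt_pow2 zero_le_numeral)
  have step: "(v (Suc n) - v n)\<^sup>2 \<le> 3 * level_excess U n" for n
  proof -
    have "v (Suc n) = sqrt 2 ^ n * (U n 1 / ground 1)"
      using ground_pos[of 1] by (simp add: v_def profile_glue[OF U] ground_0_eq)
    then have "v (Suc n) - v n = sqrt 2 ^ n * (U n 1 / ground 1 - U n 0 / ground 0)"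
      by (simp only: v_def[of n] right_diff_distrib)
    then have "(v (Suc n) - v n)\<^sup>2 = 2 ^ n * (U n 1 / ground 1 - U n 0 / ground 0)\<^sup>2"
      by (simp only: power_mult_distrib pow)
    also have "\<dots> \<le> 2 ^ n * (3 * excess (U n) (weak_deriv (U n)))"
      by (intro mult_left_mono excess_controls_oscillation profile_primitive[OF U]) auto
    finally show ?thesis by (simp add: level_excess_def)
  qed
  have v: "v n = (\<Sum>i<Suc n. \<delta> i)" for n
    by (induction n) (simp_all add: \<delta>_def)
  have v0: "(\<delta> 0)\<^sup>2 = 3 / 2 * (U 0 0)\<^sup>2"
    by (simp add: \<delta>_def v_def power_divide ground_0_sq)
  \<comment> \<open>The root term of the deficit controls the first summand \<open>\<delta> 0\<close>, the excesses the other ones.\<close>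
  have U0: "(U 0 0)\<^sup>2 \<le> deficit U / root_slope"
    using partial_excess_le[OF U, of 0] root_slope_pos by (simp add: field_simps)
  have v_sq: "(v n)\<^sup>2 \<le> (real n + 1) * (decay_const / 2 * deficit U)" for n
  proof -
    have "(v n)\<^sup>2 \<le> (\<Sum>i<Suc n. (\<delta> i)\<^sup>2) * card {..<Suc n}"
      unfolding v by (rule sum_squared_le_sum_of_squares)
    moreover have "(\<Sum>i<Suc n. (\<delta> i)\<^sup>2) \<le> decay_const / 2 * deficit U"
    proof -
      have "(\<Sum>i<Suc n. (\<delta> i)\<^sup>2) = (\<delta> 0)\<^sup>2 + (\<Sum>i<n. (v (Suc i) - v i)\<^sup>2)"
        unfolding sum.lessThan_Suc_shift by (simp add: \<delta>_def)
      also have "\<dots> \<le> 3 / 2 * (U 0 0)\<^sup>2 + 3 * (\<Sum>i<n. level_excess U i)"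
        unfolding v0 sum_distrib_left by (intro add_left_mono sum_mono step)
      also have "\<dots> \<le> 3 / 2 * (U 0 0)\<^sup>2 + 3 * deficit U"
      proof -
        have "root_slope * (U 0 0)\<^sup>2 \<ge> 0" using root_slope_pos by simp
        then show ?thesis using partial_excess_le[OF U, of n] by simp
      qed
      also have "\<dots> \<le> 3 / 2 * (deficit U / root_slope) + 3 * deficit U" using U0 by simp
      also have "\<dots> = decay_const / 2 * deficit U" by (simp add: decay_const_def algebra_simps)
      finally show ?thesis .
    qed
    ultimately have "(v n)\<^sup>2 \<le> decay_const / 2 * deficit U * card {..<Suc n}"
      using order_trans mult_right_mono[of _ _ "real (card {..<Suc n})"] of_nat_0_le_iff by blast
    then show ?thesis by (simp add: mult.commute add.commute)
  qed
  have gt: "ground t > 0" "(ground t)\<^sup>2 \<le> 1" using ground_pos[OF t] ground_sq_le[OF t] by auto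
  have "(U n t)\<^sup>2 \<le> (U n t / ground t)\<^sup>2"
    using gt by (simp add: power_divide le_divide_eq mult_left_le)
  also have "\<dots> \<le> 2 * (U n 0 / ground 0)\<^sup>2 + 2 * (U n t / ground t - U n 0 / ground 0)\<^sup>2"
  proof -
    have "(x::real)\<^sup>2 \<le> 2 * y\<^sup>2 + 2 * (x - y)\<^sup>2" for x y
      using zero_le_power2[of "x - 2 * y"] by (simp add: power2_eq_square algebra_simps)
    then show ?thesis .
  qed
  also have "\<dots> \<le> 2 * (U n 0 / ground 0)\<^sup>2 + 6 * excess (U n) (weak_deriv (U n))"
    using excess_controls_oscillation[OF profile_primitive[OF U] t, of n] by simp
  finally have "2 ^ n * (U n t)\<^sup>2 \<le> 2 ^ n * (2 * (U n 0 / ground 0)\<^sup>2 + 6 * excess (U n) (weak_deriv (U n)))"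
    by simp
  also have "\<dots> = 2 * (v n)\<^sup>2 + 6 * level_excess U n"
  proof -
    have "(v n)\<^sup>2 = 2 ^ n * (U n 0 / ground 0)\<^sup>2" by (simp only: v_def power_mult_distrib pow)
    then show ?thesis by (simp add: level_excess_def distrib_left)
  qed
  also have "\<dots> \<le> 2 * ((real n + 1) * (decay_const / 2 * deficit U)) + 6 * deficit U"
  proof -
    have "level_excess U n \<le> (\<Sum>i<Suc n. level_excess U i)"
      by (rule member_le_sum) (auto simp: level_excess_nonneg[OF U])
    moreover have "root_slope * (U 0 0)\<^sup>2 \<ge> 0" using root_slope_pos by simp
    ultimately have "level_excess U n \<le> deficit U" using partial_excess_le[OF U, of "Suc n"] by linarith
    then show ?thesis using v_sq[of n] by linarith
  qed
  also have "\<dots> \<le> decay_const * (real n + 2) * deficit U"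
  proof -
    have le: "6 * deficit U \<le> decay_const * deficit U"
      using deficit_nonneg[OF U] root_slope_pos by (intro mult_right_mono) (simp_all add: decay_const_def)
    have eq1: "2 * ((real n + 1) * (decay_const / 2 * deficit U)) = decay_const * (real n + 1) * deficit U"
      by simp
    have eq2: "decay_const * (real n + 2) * deficit U
        = decay_const * (real n + 1) * deficit U + decay_const * deficit U"
      by (simp add: algebra_simps)
    show ?thesis unfolding eq1 eq2 using le by (rule add_left_mono)
  qed
  finally show ?thesis .
qed

definition decay_weight :: "real \<Rightarrow> nat \<Rightarrow> real" where
  "decay_weight p n = 2 ^ n * (decay_const * (real n + 2) / 2 ^ n) powr (p / 2)"

lemma decay_weight_nonneg: "decay_weight p n \<ge> 0"
  by (simp add: decay_weight_def)

text \<open>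
  The decay of the integrand beats the growth of the number of edges because \<open>p / 2\<close> exceeds one.
\<close>

lemma summable_decay_weight:
  assumes "p > 2" shows "summable (decay_weight p)"
proof -
  define a where "a = p / 2 - 1"
  have a: "a > 0" using assms by (simp add: a_def)
  have eq: "decay_weight p n = decay_const powr (p / 2) * ((real n + 2) powr (p / 2) * (2 powr (- a)) ^ n)" for n
  proof -
    have "decay_weight p n = 2 ^ n * (decay_const powr (p / 2) * (real n + 2) powr (p / 2) / (2 ^ n) powr (p / 2))"
      unfolding decay_weight_def using decay_const_pos by (simp add: powr_divide powr_mult)
    also have "(2 ^ n) powr (p / 2) = (2::real) ^ n * (2 powr a) ^ n"
    proof -
      have e: "real n * (p / 2) = real n + a * real n" by (simp add: a_def algebra_simps)
      have "(2 ^ n) powr (p / 2) = ((2::real) powr real n) powr (p / 2)" by (simp add: powr_realpow)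
      also have "\<dots> = 2 powr real n * (2 powr a) powr real n"
        unfolding powr_powr e powr_add ..
      finally show ?thesis by (simp add: powr_realpow)
    qed
    finally show ?thesis by (simp add: powr_minus field_simps power_inverse)
  qed
  define b where "b = 2 powr (- a)"
  have b: "0 < b" "b < 1" using a by (simp_all add: b_def powr_less_one)
  define c where "c = (1 + b) / 2"
  have c: "b < c" "c < 1" "c > 0" using b by (auto simp: c_def)
  have "(\<lambda>n. (real n + 3) / (real n + 2)) \<longlonglongrightarrow> 1" by real_asymp
  then have "(\<lambda>n. ((real n + 3) / (real n + 2)) powr (p / 2) * b) \<longlonglongrightarrow> 1 powr (p / 2) * b"
    by (intro tendsto_intros) auto
  then have "\<forall>\<^sub>F n in sequentially. ((real n + 3) / (real n + 2)) powr (p / 2) * b < c"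
    using c(1) by (intro order_tendstoD(2)) auto
  then obtain N where N: "\<And>n. n \<ge> N \<Longrightarrow> ((real n + 3) / (real n + 2)) powr (p / 2) * b \<le> c"
    unfolding eventually_sequentially using less_imp_le by blast
  have "summable (\<lambda>n. (real n + 2) powr (p / 2) * b ^ n)"
  proof (rule summable_ratio_test[OF c(2), of N])
    fix n assume n: "n \<ge> N"
    have "(real (Suc n) + 2) powr (p / 2) = (real n + 2) powr (p / 2) * ((real n + 3) / (real n + 2)) powr (p / 2)"
      by (subst powr_mult[symmetric]) (simp_all add: add.commute)
    then have "(real (Suc n) + 2) powr (p / 2) * b ^ Suc n
        = (((real n + 3) / (real n + 2)) powr (p / 2) * b) * ((real n + 2) powr (p / 2) * b ^ n)"
      by (simp only: power_Suc ac_simps)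
    also have "\<dots> \<le> c * ((real n + 2) powr (p / 2) * b ^ n)"
      using b by (intro mult_right_mono N n) simp
    finally show "norm ((real (Suc n) + 2) powr (p / 2) * b ^ Suc n) \<le> c * norm ((real n + 2) powr (p / 2) * b ^ n)"
      using b by simp
  qed
  then show ?thesis unfolding eq b_def[symmetric] by (rule summable_mult)
qed

lemma pow_norm_level_le:
  assumes U: "profile U" and p: "p > 0"
  shows "2 ^ n * pow_norm p (U n) \<le> decay_weight p n * deficit U powr (p / 2)"
proof -
  have "pow_norm p (U n) \<le> (decay_const * (real n + 2) / 2 ^ n * deficit U) powr (p / 2)"
    using profile_decay[OF U, of _ n]
    by (intro pow_norm_le[OF profile_continuous[OF U] p]) (simp add: field_simps)
  also have "\<dots> = (decay_const * (real n + 2) / 2 ^ n) powr (p / 2) * deficit U powr (p / 2)"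
    by (rule powr_mult)
  finally show ?thesis by (simp add: decay_weight_def mult.assoc)
qed

lemma summable_potential:
  assumes U: "profile U" and p: "p > 2"
  shows "summable (\<lambda>n. 2 ^ n * pow_norm p (U n))"
proof (rule summable_comparison_test')
  show "summable (\<lambda>n. decay_weight p n * deficit U powr (p / 2))"
    by (rule summable_mult2[OF summable_decay_weight[OF p]])
  show "norm (2 ^ n * pow_norm p (U n)) \<le> decay_weight p n * deficit U powr (p / 2)" for n
    using pow_norm_level_le[OF U, of p n] p by (simp add: pow_norm_nonneg)
qed

lemma potential_le_deficit:
  assumes U: "profile U" and p: "p > 2"
  shows "potential p U \<le> (\<Sum>n. decay_weight p n) * deficit U powr (p / 2)"
  unfolding potential_def suminf_mult2[OF summable_decay_weight[OF p]]
  using p by (intro suminf_le pow_norm_level_le U summable_potential summable_mult2 summable_decay_weight) auto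

lemma potential_nonneg: "profile U \<Longrightarrow> p > 2 \<Longrightarrow> potential p U \<ge> 0"
  unfolding potential_def by (intro suminf_nonneg summable_potential) (simp_all add: pow_norm_nonneg)

text \<open>
  The supremum bound for all but two of the \<open>p\<close> factors.
\<close>

lemma potential_le_sup:
  assumes U: "profile U" and p: "p > 2"
  shows "potential p U \<le> (mass U + 2 * sqrt (mass U * kinetic U)) powr ((p - 2) / 2) * mass U"
proof -
  let ?K = "(mass U + 2 * sqrt (mass U * kinetic U)) powr ((p - 2) / 2)"
  have "2 ^ n * pow_norm p (U n) \<le> ?K * (2 ^ n * sq_norm (U n))" for n
    using pow_norm_le_sq_norm[OF profile_continuous[OF U] p sup_bound[OF U], of n]
    by (simp add: mult.left_commute)
  then have "potential p U \<le> (\<Sum>n. ?K * (2 ^ n * sq_norm (U n)))"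
    unfolding potential_def
    by (intro suminf_le summable_potential U p summable_mult profile_summable)
  then show ?thesis by (simp add: mass_def suminf_mult[OF profile_summable(1)[OF U]])
qed

lemma profile_eq_0:
  assumes U: "profile U" and 0: "mass U = 0" and t: "t \<in> {0..1}"
  shows "U n t = 0"
  using sup_bound[OF U t, of n] 0 by simp

lemma mass_0_imp:
  assumes U: "profile U" and 0: "mass U = 0"
  shows "kinetic U = 0" "potential p U = 0"
proof -
  have z: "primitive (\<lambda>t. 0) (\<lambda>t. 0)" by (rule primitive_C1) auto
  have "dirichlet (\<lambda>t. 0) = dirichlet (U n)" for n
    by (rule dirichlet_cong[OF z]) (rule profile_eq_0[OF U 0, symmetric])
  then have "dirichlet (U n) = 0" for n
    using dirichlet_eq[OF z] by (metis integral_zero power_zero_numeral)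
  then show "kinetic U = 0" by (simp add: kinetic_def)
  have "pow_norm p (U n) = pow_norm p (\<lambda>t. 0)" for n
    by (rule pow_norm_cong) (rule profile_eq_0[OF U 0])
  then show "potential p U = 0" by (simp add: potential_def pow_norm_def)
qed

lemma potential_pos:
  assumes U: "profile U" and p: "p > 2" and m: "mass U > 0"
  shows "potential p U > 0"
proof (rule ccontr)
  assume "\<not> potential p U > 0"
  then have P0: "potential p U = 0" using potential_nonneg[OF U p] by simp
  have "sq_norm (U n) = 0" for n
  proof -
    have "2 ^ n * pow_norm p (U n) = 0"
      using P0[unfolded potential_def] suminf_eq_zero_iff[OF summable_potential[OF U p]]
      by (auto simp: pow_norm_nonneg)
    then have "(\<integral>t. \<bar>U n t\<bar> powr p \<partial>unit_leb) = 0" by (simp add: pow_norm_def)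
    moreover have "integrable unit_leb (\<lambda>t. \<bar>U n t\<bar> powr p)"
      by (rule continuous_on_integrable_unit[OF continuous_on_abs_powr[OF profile_continuous[OF U]]]) (use p in simp)
    ultimately have "AE t in unit_leb. \<bar>U n t\<bar> powr p = 0"
      using integral_nonneg_eq_0_iff_AE[of unit_leb "\<lambda>t. \<bar>U n t\<bar> powr p"] by simp
    then have "AE t in unit_leb. (U n t)\<^sup>2 = 0" by eventually_elim simp
    then have "(\<integral>t. (U n t)\<^sup>2 \<partial>unit_leb) = 0" by (rule integral_eq_zero_AE)
    then show ?thesis by (simp add: sq_norm_def)
  qed
  then have "mass U = 0" by (simp add: mass_def)
  with m show False by simp
qed

lemma profile_scale:
  assumes U: "profile U" and c: "c \<ge> 0" and p: "p > 2"
  shows "profile (\<lambda>n t. sqrt c * U n t)" "mass (\<lambda>n t. sqrt c * U n t) = c * mass U"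
    "kinetic (\<lambda>n t. sqrt c * U n t) = c * kinetic U"
    "potential p (\<lambda>n t. sqrt c * U n t) = c powr (p / 2) * potential p U"
proof -
  note P = primitive_cmult[OF profile_primitive[OF U], of "sqrt c"]
  have 1: "sq_norm (\<lambda>t. sqrt c * U n t) = c * sq_norm (U n)" for n
    using c by (simp add: sq_norm_def power_mult_distrib)
  have 2: "dirichlet (\<lambda>t. sqrt c * U n t) = c * dirichlet (U n)" for n
    using c dirichlet_eq[OF P[of n]] by (simp add: dirichlet_def power_mult_distrib)
  have 3: "pow_norm p (\<lambda>t. sqrt c * U n t) = c powr (p / 2) * pow_norm p (U n)" for n
  proof -
    have "\<bar>sqrt c * x\<bar> powr p = c powr (p / 2) * \<bar>x\<bar> powr p" for x
    proof -
      have "sqrt c powr p = c powr (p / 2)"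
        unfolding powr_half_sqrt[OF c, symmetric] powr_powr by simp
      then show ?thesis using c by (simp add: abs_mult powr_mult)
    qed
    then show ?thesis by (simp add: pow_norm_def)
  qed
  have s: "summable (\<lambda>n. 2 ^ n * (c * sq_norm (U n)))" "summable (\<lambda>n. 2 ^ n * (c * dirichlet (U n)))"
    using summable_mult[OF profile_summable(1)[OF U], of c] summable_mult[OF profile_summable(2)[OF U], of c]
    by (simp_all add: mult.left_commute)
  show "profile (\<lambda>n t. sqrt c * U n t)"
    by (rule profileI[OF P]) (simp_all add: profile_glue[OF U] 1 2 s)
  show "mass (\<lambda>n t. sqrt c * U n t) = c * mass U"
    using suminf_mult[OF profile_summable(1)[OF U], of c] by (simp add: mass_def 1 mult.left_commute)
  show "kinetic (\<lambda>n t. sqrt c * U n t) = c * kinetic U"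
    using suminf_mult[OF profile_summable(2)[OF U], of c] by (simp add: kinetic_def 2 mult.left_commute)
  show "potential p (\<lambda>n t. sqrt c * U n t) = c powr (p / 2) * potential p U"
    using suminf_mult[OF summable_potential[OF U p], of "c powr (p / 2)"]
    by (simp add: potential_def 3 mult.left_commute)
qed

section \<open>The bottom of the radial spectrum\<close>

text \<open>
  Multiplying the generalised ground state by an exponential with small rate makes it square
  integrable. The profile is then geometric in the level, so that its Rayleigh quotient is that
  of a single edge.
\<close>

lemma geometric_profile:
  assumes e: "\<epsilon> > 0"
  obtains U where "profile U" "mass U > 0"
    "kinetic U \<le> (spec + \<epsilon>\<^sup>2 + 2 * root_slope * (exp (2 * \<epsilon>) - 1)) * mass U"
proof -
  define G where "G t = ground t * exp (- \<epsilon> * t)" for t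
  define r where "r t = (ground_log_deriv t - \<epsilon>) * G t" for t
  define a where "a = exp (- \<epsilon>) / sqrt 2"
  define y where "y = exp (- 2 * \<epsilon>)"
  define U where "U n t = a ^ n * G t" for n :: nat and t
  have G: "primitive G r"
  proof (rule primitive_C1)
    fix t :: real assume t: "t \<in> {0..1}"
    show "(G has_real_derivative r t) (at t within {0..1})"
      unfolding G_def[abs_def] r_def G_def
      by (rule derivative_eq_intros ground_deriv t refl)+ (simp add: algebra_simps)
  next
    show "continuous_on {0..1} r"
      unfolding r_def G_def by (intro continuous_intros continuous_on_ground continuous_on_ground_log_deriv)
  qed
  note P = primitive_cmult[OF G, of "a ^ n" for n, folded U_def]
  have y: "0 < y" "y < 1" using e by (simp_all add: y_def)
  have ay: "2 ^ n * (a ^ n)\<^sup>2 = y ^ n" for n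
  proof -
    have "2 * a\<^sup>2 = y" by (simp add: a_def y_def power_divide flip: exp_double)
    moreover have "(a ^ n)\<^sup>2 = (a\<^sup>2) ^ n" by (metis mult.commute power_mult)
    ultimately show ?thesis by (simp flip: power_mult_distrib)
  qed
  have mU: "2 ^ n * sq_norm (U n) = y ^ n * sq_norm G" for n
    unfolding ay[symmetric] by (simp add: sq_norm_def U_def power_mult_distrib)
  have kU: "2 ^ n * dirichlet (U n) = y ^ n * dirichlet G" for n
    unfolding ay[symmetric] dirichlet_eq[OF P] dirichlet_eq[OF G] by (simp add: power_mult_distrib)
  have s: "summable (\<lambda>n. y ^ n)" using y by simp
  have U: "profile U"
  proof (rule profileI[OF P])
    show "summable (\<lambda>n. 2 ^ n * sq_norm (U n))" "summable (\<lambda>n. 2 ^ n * dirichlet (U n))"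
      unfolding mU kU by (intro summable_mult2 s)+
    have "G 1 = a * G 0" by (simp add: G_def a_def ground_0_eq)
    then show "U n 1 = U (Suc n) 0" for n by (simp add: U_def)
  qed
  have M: "mass U = (\<Sum>n. y ^ n) * sq_norm G" and T: "kinetic U = (\<Sum>n. y ^ n) * dirichlet G"
    unfolding mass_def kinetic_def mU kU by (rule suminf_mult2[OF s, symmetric])+
  have S: "(\<Sum>n. y ^ n) > 0" using y by (simp add: suminf_geometric)
  have c: "continuous_on {0..1} G" by (rule primitive_continuous[OF G])
  have G_ge: "y / 3 \<le> (G t)\<^sup>2" if t: "t \<in> {0..1}" for t
  proof -
    have "exp (- \<epsilon> * t) \<ge> exp (- \<epsilon>)" using t e by simp
    then have "(exp (- \<epsilon> * t))\<^sup>2 \<ge> (exp (- \<epsilon>))\<^sup>2" by (intro power_mono) auto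
    moreover have "(exp (- \<epsilon>))\<^sup>2 = y" by (simp add: y_def flip: exp_double)
    ultimately have "1 / 3 * y \<le> (ground t)\<^sup>2 * (exp (- \<epsilon> * t))\<^sup>2"
      using ground_sq_ge[OF t] y by (intro mult_mono) auto
    then show ?thesis by (simp add: G_def power_mult_distrib)
  qed
  have "(\<integral>t. y / 3 \<partial>unit_leb) \<le> sq_norm G"
    unfolding sq_norm_def
    by (rule integral_mono) (use G_ge L2_sq_integrable[OF L2_continuous[OF c]] in \<open>simp_all add: space_unit_leb\<close>)
  then have m: "y / 3 \<le> sq_norm G" by (simp add: space_unit_leb measure_unit_leb_space)
  have "excess G r = \<epsilon>\<^sup>2 * sq_norm G"
    unfolding excess_def sq_norm_def r_def
    by (subst integral_mult_right_zero[symmetric], rule integral_unit_cong) (simp add: power2_eq_square algebra_simps)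
  moreover have "(G 1)\<^sup>2 = y / 3" "(G 0)\<^sup>2 = 2 / 3"
    by (simp_all add: G_def power_mult_distrib ground_0_sq ground_1_sq y_def flip: exp_double)
  ultimately have "dirichlet G = (spec + \<epsilon>\<^sup>2) * sq_norm G + root_slope * (2 / 3 * (1 - y))"
    using excess_eq[OF G] dirichlet_eq[OF G] by (simp add: sq_norm_def field_simps)
  also have "2 / 3 * (1 - y) = 2 * (y / 3) * (exp (2 * \<epsilon>) - 1)"
    using exp_add[of "2 * \<epsilon>" "- 2 * \<epsilon>"] by (simp add: y_def algebra_simps)
  also have "root_slope * (2 * (y / 3) * (exp (2 * \<epsilon>) - 1)) \<le> root_slope * (2 * sq_norm G * (exp (2 * \<epsilon>) - 1))"
    using m e root_slope_pos by (intro mult_left_mono mult_right_mono) auto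
  finally have "dirichlet G \<le> (spec + \<epsilon>\<^sup>2 + 2 * root_slope * (exp (2 * \<epsilon>) - 1)) * sq_norm G"
    by (simp add: algebra_simps)
  from mult_left_mono[OF this less_imp_le[OF S]]
  have "kinetic U \<le> (spec + \<epsilon>\<^sup>2 + 2 * root_slope * (exp (2 * \<epsilon>) - 1)) * mass U"
    unfolding T M by (simp only: mult.left_commute)
  moreover have "mass U > 0" using S m y by (simp add: M)
  ultimately show ?thesis using that U by blast
qed

lemma spec_approximated:
  assumes "\<delta> > 0"
  obtains U where "profile U" "mass U > 0" "kinetic U \<le> (spec + \<delta>) * mass U"
proof -
  have "((\<lambda>\<epsilon>. \<epsilon>\<^sup>2 + 2 * root_slope * (exp (2 * \<epsilon>) - 1)) \<longlongrightarrow> 0\<^sup>2 + 2 * root_slope * (exp (2 * 0) - 1)) (at_right 0)"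
    by (intro tendsto_intros)
  then have "\<forall>\<^sub>F \<epsilon> in at_right 0. \<epsilon>\<^sup>2 + 2 * root_slope * (exp (2 * \<epsilon>) - 1) < \<delta>"
    by (rule order_tendstoD(2)) (use assms in simp)
  moreover have "\<forall>\<^sub>F \<epsilon> in at_right 0. \<epsilon> > (0::real)" by (rule eventually_at_right_less)
  ultimately have "\<forall>\<^sub>F \<epsilon> in at_right 0. \<epsilon> > 0 \<and> \<epsilon>\<^sup>2 + 2 * root_slope * (exp (2 * \<epsilon>) - 1) < \<delta>"
    by eventually_elim simp
  then obtain \<epsilon> where \<epsilon>: "\<epsilon> > 0" "\<epsilon>\<^sup>2 + 2 * root_slope * (exp (2 * \<epsilon>) - 1) < \<delta>"
    using eventually_happens'[OF trivial_limit_at_right_real] by blast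
  from geometric_profile[OF \<epsilon>(1)] obtain U where U: "profile U" "mass U > 0"
    "kinetic U \<le> (spec + \<epsilon>\<^sup>2 + 2 * root_slope * (exp (2 * \<epsilon>) - 1)) * mass U" by blast
  have "(spec + \<epsilon>\<^sup>2 + 2 * root_slope * (exp (2 * \<epsilon>) - 1)) * mass U \<le> (spec + \<delta>) * mass U"
    using \<epsilon> U(2) by (intro mult_right_mono) auto
  then show ?thesis by (rule that[OF U(1,2) order_trans[OF U(3)]])
qed


section \<open>Compactness of radial profiles\<close>

text \<open>
  A diagonal sequence converges at all rational points, and equicontinuity does the rest.
\<close>

lemma pointwise_convergent_subsequence:
  fixes V :: "nat \<Rightarrow> nat \<Rightarrow> real \<Rightarrow> real"
  assumes V: "\<And>j n. primitive (V j n) (Q j n)"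
    and K: "\<And>j n. (\<integral>t. (Q j n t)\<^sup>2 \<partial>unit_leb) \<le> K"
    and M: "\<And>j n t. t \<in> {0..1} \<Longrightarrow> \<bar>V j n t\<bar> \<le> M"
  obtains k U where "strict_mono (k :: nat \<Rightarrow> nat)"
    "\<And>n t. t \<in> {0..1} \<Longrightarrow> (\<lambda>j. V (k j) n t) \<longlonglongrightarrow> U n t"
proof -
  let ?S = "(UNIV :: nat set) \<times> (\<rat> \<inter> {0..1})"
  obtain k where k: "strict_mono k"
    "\<And>x. x \<in> ?S \<Longrightarrow> \<exists>l. (\<lambda>j. V (k j) (fst x) (snd x)) \<longlonglongrightarrow> l"
  proof (rule function_convergent_subsequence[of ?S "\<lambda>j x. V j (fst x) (snd x)" M])
    show "countable ?S" by (intro countable_SIGMA countable_Int1 countable_rat) auto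
    show "norm (V j (fst x) (snd x)) \<le> M" if "x \<in> ?S" for j x
      using M that by auto
  next
    fix k :: "nat \<Rightarrow> nat"
    assume "strict_mono k" "\<And>x. x \<in> ?S \<Longrightarrow> \<exists>l. (\<lambda>j. V (k j) (fst x) (snd x)) \<longlonglongrightarrow> l"
    then show thesis by (rule that)
  qed
  have "convergent (\<lambda>j. V (k j) n t)" if t: "t \<in> {0..1}" for n t
  proof -
    have "Cauchy (\<lambda>j. V (k j) n t)"
    proof (rule CauchyI)
      fix e :: real assume e: "e > 0"
      have K0: "K \<ge> 0" using order_trans[OF _ K[of 0 0]] by simp
      define d where "d = (e / 3)\<^sup>2 / (K + 1)"
      have d: "d > 0" using e K0 by (simp add: d_def)
      have "\<exists>s\<in>\<rat>. s \<in> {0..1} \<and> \<bar>s - t\<bar> < d"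
      proof (cases "t < 1")
        case True
        then obtain s where "s \<in> \<rat>" "t < s" "s < min 1 (t + d)"
          using Rats_dense_in_real[of t "min 1 (t + d)"] d by auto
        then show ?thesis using t by (intro bexI[of _ s]) auto
      next
        case False
        then show ?thesis using t d by (intro bexI[of _ 1]) auto
      qed
      then obtain s where s: "s \<in> \<rat>" "s \<in> {0..1}" "\<bar>s - t\<bar> < d" by blast
      have near: "\<bar>V j n s - V j n t\<bar> < e / 3" for j
      proof -
        have "(V j n s - V j n t)\<^sup>2 \<le> \<bar>s - t\<bar> * (\<integral>x. (Q j n x)\<^sup>2 \<partial>unit_leb)"
          by (rule primitive_holder_abs[OF V t s(2)])
        also have "\<dots> \<le> \<bar>s - t\<bar> * (K + 1)"
          using K[of j n] by (intro mult_left_mono) auto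
        also have "\<dots> < d * (K + 1)" using s K0 by (intro mult_strict_right_mono) auto
        also have "\<dots> = (e / 3)\<^sup>2" using K0 by (simp add: d_def)
        finally have "\<bar>V j n s - V j n t\<bar>\<^sup>2 < (e / 3)\<^sup>2" by simp
        then show ?thesis by (rule power2_less_imp_less) (use e in simp)
      qed
      from k(2)[of "(n, s)"] s have "convergent (\<lambda>j. V (k j) n s)" by (auto simp: convergent_def)
      then have "Cauchy (\<lambda>j. V (k j) n s)" by (rule convergent_Cauchy)
      moreover have "e / 3 > 0" using e by simp
      ultimately obtain N where N: "\<And>i j. i \<ge> N \<Longrightarrow> j \<ge> N \<Longrightarrow> \<bar>V (k i) n s - V (k j) n s\<bar> < e / 3"
        using CauchyD[of "\<lambda>j. V (k j) n s" "e / 3"] unfolding real_norm_def by blast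
      have "norm (V (k i) n t - V (k j) n t) < e" if "i \<ge> N" "j \<ge> N" for i j
        using N[OF that] near[of "k i"] near[of "k j"] unfolding real_norm_def by linarith
      then show "\<exists>N. \<forall>i\<ge>N. \<forall>j\<ge>N. norm (V (k i) n t - V (k j) n t) < e" by blast
    qed
    then show ?thesis by (rule Cauchy_convergent)
  qed
  then have "(\<lambda>j. V (k j) n t) \<longlonglongrightarrow> lim (\<lambda>j. V (k j) n t)" if "t \<in> {0..1}" for n t
    using that convergent_LIMSEQ_iff by blast
  with k(1) show ?thesis by (rule that)
qed

lemma integral_unit_tendsto:
  fixes f :: "nat \<Rightarrow> real \<Rightarrow> real"
  assumes f: "\<And>j. continuous_on {0..1} (f j)" and g: "continuous_on {0..1} g"
    and lim: "\<And>t. t \<in> {0..1} \<Longrightarrow> (\<lambda>j. f j t) \<longlonglongrightarrow> g t"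
    and B: "\<And>j t. t \<in> {0..1} \<Longrightarrow> \<bar>f j t\<bar> \<le> B"
  shows "(\<lambda>j. \<integral>t. f j t \<partial>unit_leb) \<longlonglongrightarrow> (\<integral>t. g t \<partial>unit_leb)"
proof (rule integral_dominated_convergence[where w = "\<lambda>_. B"])
  show "g \<in> borel_measurable unit_leb" "\<And>j. f j \<in> borel_measurable unit_leb"
    by (intro continuous_on_borel_measurable_unit f g)+
  show "integrable unit_leb (\<lambda>_. B)" by simp
  show "AE t in unit_leb. (\<lambda>j. f j t) \<longlonglongrightarrow> g t" "\<And>j. AE t in unit_leb. norm (f j t) \<le> B"
    by (rule AE_I2, simp add: space_unit_leb lim B)+
qed

lemma dirichlet_le_limit:
  assumes V: "\<And>j. primitive (V j) (Q j)"
    and lim: "\<And>t. t \<in> {0..1} \<Longrightarrow> (\<lambda>j. V j t) \<longlonglongrightarrow> U t"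
    and \<tau>: "(\<lambda>j. dirichlet (V j)) \<longlonglongrightarrow> \<tau>"
  shows "primitive U (weak_deriv U)" "dirichlet U \<le> \<tau>"
proof -
  have *: "primitive U (weak_deriv U) \<and> dirichlet U \<le> \<tau> + e" if e: "e > 0" for e
  proof -
    have "\<forall>\<^sub>F j in sequentially. dirichlet (V j) < \<tau> + e"
      by (rule order_tendstoD(2)[OF \<tau>]) (use e in simp)
    then obtain N where N: "\<And>j. j \<ge> N \<Longrightarrow> dirichlet (V j) \<le> \<tau> + e"
      unfolding eventually_sequentially using less_imp_le by blast
    obtain q where q: "primitive U q" "(\<integral>t. (q t)\<^sup>2 \<partial>unit_leb) \<le> \<tau> + e"
    proof (rule primitive_lower_semicontinuous[of "\<lambda>j. V (j + N)" "\<lambda>j. Q (j + N)" U "\<tau> + e"])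
      show "(\<lambda>j. V (j + N) t) \<longlonglongrightarrow> U t" if "t \<in> {0..1}" for t
        using LIMSEQ_ignore_initial_segment[OF lim[OF that]] .
      show "(\<integral>t. (Q (j + N) t)\<^sup>2 \<partial>unit_leb) \<le> \<tau> + e" for j
        using N[of "j + N"] dirichlet_eq[OF V] by simp
    qed (use V in auto)
    then show ?thesis using dirichlet_eq[OF q(1)] primitive_H1_unit(2)[OF q(1)] by simp
  qed
  from *[of 1] show "primitive U (weak_deriv U)" by simp
  show "dirichlet U \<le> \<tau>" by (rule field_le_epsilon) (use * in blast)
qed

text \<open>
  Bounded energy gives pointwise convergence along a subsequence. The decay estimate makes the
  potential continuous along it, whereas mass may escape to infinity; the escaping mass carries at
  least its share of the bottom of the spectrum, so that the deficit is lower semicontinuous.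
\<close>

lemma profile_compactness:
  assumes V: "\<And>j. profile (V j)" and p: "p > 2"
    and m: "(\<lambda>j. mass (V j)) \<longlonglongrightarrow> m" and d: "(\<lambda>j. deficit (V j)) \<longlonglongrightarrow> d"
    and P: "(\<lambda>j. potential p (V j)) \<longlonglongrightarrow> P"
  obtains U where "profile U" "mass U \<le> m" "deficit U \<le> d" "potential p U = P"
proof -
  obtain M0 where M0: "\<And>j. mass (V j) \<le> M0"
    using convergent_imp_Bseq[OF convergentI[OF m]] unfolding Bseq_def real_norm_def
    using abs_le_D1 by blast
  obtain D0 where D0: "\<And>j. deficit (V j) \<le> D0"
    using convergent_imp_Bseq[OF convergentI[OF d]] unfolding Bseq_def real_norm_def
    using abs_le_D1 by blast
  define K where "K = D0 + spec * M0"
  have kin: "kinetic (V j) \<le> K" for j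
    using M0[of j] D0[of j] spec_pos mult_left_mono[of "mass (V j)" M0 spec]
    unfolding K_def deficit_def by linarith
  have M0_nonneg: "M0 \<ge> 0" using mass_nonneg[OF V] M0[of 0] order_trans by blast
  define B where "B = M0 + 2 * sqrt (M0 * K)"
  have B: "(V j n t)\<^sup>2 \<le> B" if "t \<in> {0..1}" for j n t
  proof -
    have "mass (V j) * kinetic (V j) \<le> M0 * K"
      by (intro mult_mono M0 kin M0_nonneg kinetic_nonneg V)
    then have "sqrt (mass (V j) * kinetic (V j)) \<le> sqrt (M0 * K)" by simp
    then show ?thesis using sup_bound[OF V that, of j n] M0[of j] unfolding B_def by linarith
  qed
  have absB: "\<bar>V j n t\<bar> \<le> sqrt B" if "t \<in> {0..1}" for j n t
    using B[OF that, of j n] by (metis real_sqrt_abs real_sqrt_le_iff)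
  note VP = profile_primitive[OF V]
  have dir: "dirichlet (V j n) \<le> K" for j n
    using dirichlet_le_kinetic[OF V, of j n] kin[of j] by linarith
  obtain k1 U where k1: "strict_mono k1" and U1: "\<And>n t. t \<in> {0..1} \<Longrightarrow> (\<lambda>j. V (k1 j) n t) \<longlonglongrightarrow> U n t"
  proof (rule pointwise_convergent_subsequence[of V "\<lambda>j n. weak_deriv (V j n)" K "sqrt B"])
    show "(\<integral>t. (weak_deriv (V j n) t)\<^sup>2 \<partial>unit_leb) \<le> K" for j n
      using dir unfolding dirichlet_def .
    show "primitive (V j n) (weak_deriv (V j n))" for j n by (rule VP)
    show "\<bar>V j n t\<bar> \<le> sqrt B" if "t \<in> {0..1}" for j n t by (rule absB[OF that])
  next
    fix k :: "nat \<Rightarrow> nat" and U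
    assume "strict_mono k" "\<And>n t. t \<in> {0..1} \<Longrightarrow> (\<lambda>j. V (k j) n t) \<longlonglongrightarrow> U n t"
    then show thesis by (rule that)
  qed
  obtain k2 where k2: "strict_mono k2" "\<And>n. n \<in> UNIV \<Longrightarrow> \<exists>l. (\<lambda>j. dirichlet (V (k1 (k2 j)) n)) \<longlonglongrightarrow> l"
  proof (rule function_convergent_subsequence[of "UNIV :: nat set" "\<lambda>j n. dirichlet (V (k1 j) n)" K])
    show "norm (dirichlet (V (k1 j) n)) \<le> K" for j n using dir dirichlet_nonneg by simp
  next
    fix k :: "nat \<Rightarrow> nat"
    assume "strict_mono k" "\<And>n. n \<in> UNIV \<Longrightarrow> \<exists>l. (\<lambda>j. dirichlet (V (k1 (k j)) n)) \<longlonglongrightarrow> l"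
    then show thesis by (rule that)
  qed simp
  then obtain \<tau> where \<tau>: "\<And>n. (\<lambda>j. dirichlet (V (k1 (k2 j)) n)) \<longlonglongrightarrow> \<tau> n"
    using choice[of "\<lambda>n l. (\<lambda>j. dirichlet (V (k1 (k2 j)) n)) \<longlonglongrightarrow> l"] by blast
  define k where "k = k1 \<circ> k2"
  define W where "W j = V (k j)" for j
  have k: "strict_mono k" unfolding k_def by (rule strict_mono_o[OF k1 k2(1)])
  have W: "profile (W j)" for j by (simp add: W_def V)
  note WP = profile_primitive[OF W]
  have lim: "(\<lambda>j. W j n t) \<longlonglongrightarrow> U n t" if "t \<in> {0..1}" for n t
    using LIMSEQ_subseq_LIMSEQ[OF U1[OF that] k2(1)] by (simp add: W_def k_def o_def)
  have W\<tau>: "(\<lambda>j. dirichlet (W j n)) \<longlonglongrightarrow> \<tau> n" for n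
    using \<tau> by (simp add: W_def k_def)
  have Wm: "(\<lambda>j. mass (W j)) \<longlonglongrightarrow> m" and Wd: "(\<lambda>j. deficit (W j)) \<longlonglongrightarrow> d"
    and WP': "(\<lambda>j. potential p (W j)) \<longlonglongrightarrow> P"
    using LIMSEQ_subseq_LIMSEQ[OF m k] LIMSEQ_subseq_LIMSEQ[OF d k] LIMSEQ_subseq_LIMSEQ[OF P k]
    by (simp_all add: W_def o_def)
  have UP: "primitive (U n) (weak_deriv (U n))" and Ud: "dirichlet (U n) \<le> \<tau> n" for n
    using dirichlet_le_limit[OF WP lim W\<tau>] by blast+
  note cU = primitive_continuous[OF UP] and cW = profile_continuous[OF W]
  have sq: "(\<lambda>j. sq_norm (W j n)) \<longlonglongrightarrow> sq_norm (U n)" for n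
    unfolding sq_norm_def
  proof (rule integral_unit_tendsto[where B = B])
    show "\<bar>(W j n t)\<^sup>2\<bar> \<le> B" if "t \<in> {0..1}" for j t using B[OF that] by (simp add: W_def)
    show "(\<lambda>j. (W j n t)\<^sup>2) \<longlonglongrightarrow> (U n t)\<^sup>2" if "t \<in> {0..1}" for t by (intro tendsto_intros lim that)
  qed (intro continuous_intros cU cW)+
  have pow: "(\<lambda>j. pow_norm p (W j n)) \<longlonglongrightarrow> pow_norm p (U n)" for n
    unfolding pow_norm_def
  proof (rule integral_unit_tendsto[where B = "sqrt B powr p"])
    show "\<bar>\<bar>W j n t\<bar> powr p\<bar> \<le> sqrt B powr p" if "t \<in> {0..1}" for j t
      using absB[OF that] p by (simp add: W_def powr_mono2)
    show "(\<lambda>j. \<bar>W j n t\<bar> powr p) \<longlonglongrightarrow> \<bar>U n t\<bar> powr p" if "t \<in> {0..1}" for t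
      using p by (intro tendsto_powr' tendsto_intros lim that) auto
  qed (use p in \<open>intro continuous_on_abs_powr cU cW, simp\<close>)+
  have mass_part: "(\<Sum>n<N. 2 ^ n * sq_norm (U n)) \<le> m" for N
  proof (rule LIMSEQ_le[OF _ Wm])
    show "(\<lambda>j. \<Sum>n<N. 2 ^ n * sq_norm (W j n)) \<longlonglongrightarrow> (\<Sum>n<N. 2 ^ n * sq_norm (U n))"
      by (intro tendsto_intros sq)
  qed (use partial_mass_le[OF W] in blast)
  have "(\<lambda>j. deficit (W j) + spec * mass (W j)) \<longlonglongrightarrow> d + spec * m"
    by (intro tendsto_intros Wm Wd)
  then have Wk: "(\<lambda>j. kinetic (W j)) \<longlonglongrightarrow> d + spec * m" by (simp add: deficit_def)
  have kin_part: "(\<Sum>n<N. 2 ^ n * dirichlet (U n)) \<le> d + spec * m" for N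
  proof -
    have "(\<Sum>n<N. 2 ^ n * dirichlet (U n)) \<le> (\<Sum>n<N. 2 ^ n * \<tau> n)"
      by (intro sum_mono mult_left_mono Ud) simp
    also have "\<dots> \<le> d + spec * m"
    proof (rule LIMSEQ_le[OF _ Wk])
      show "(\<lambda>j. \<Sum>n<N. 2 ^ n * dirichlet (W j n)) \<longlonglongrightarrow> (\<Sum>n<N. 2 ^ n * \<tau> n)"
        by (intro tendsto_intros W\<tau>)
    qed (use partial_kinetic_le[OF W] in blast)
    finally show ?thesis .
  qed
  have U: "profile U"
  proof (rule profileI[OF UP])
    show "summable (\<lambda>n. 2 ^ n * sq_norm (U n))"
      by (rule summableI_nonneg_bounded[OF _ mass_part]) (simp add: sq_norm_nonneg)
    show "summable (\<lambda>n. 2 ^ n * dirichlet (U n))"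
      by (rule summableI_nonneg_bounded[OF _ kin_part]) (simp add: dirichlet_nonneg)
    show "U n 1 = U (Suc n) 0" for n
    proof (rule LIMSEQ_unique)
      show "(\<lambda>j. W j n 1) \<longlonglongrightarrow> U n 1" by (rule lim) simp
      show "(\<lambda>j. W j n 1) \<longlonglongrightarrow> U (Suc n) 0"
        unfolding profile_glue[OF W] by (rule lim) simp
    qed
  qed
  have mU: "mass U \<le> m"
    unfolding mass_def by (rule suminf_le_const[OF profile_summable(1)[OF U] mass_part])
  have "(\<Sum>n<N. level_excess U n) \<le> d - root_slope * (U 0 0)\<^sup>2" for N
  proof -
    let ?L = "\<lambda>n. 2 ^ n * \<tau> n - spec * (2 ^ n * sq_norm (U n))
      + root_slope * (2 ^ Suc n * (U (Suc n) 0)\<^sup>2 - 2 ^ n * (U n 0)\<^sup>2)"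
    have "(\<Sum>n<N. level_excess U n) \<le> (\<Sum>n<N. ?L n)"
      by (rule sum_mono) (simp add: level_excess_eq[OF U] Ud)
    also have "\<dots> \<le> d - root_slope * (U 0 0)\<^sup>2"
    proof (rule LIMSEQ_le)
      show "(\<lambda>j. \<Sum>n<N. level_excess (W j) n) \<longlonglongrightarrow> (\<Sum>n<N. ?L n)"
        unfolding level_excess_eq[OF W] by (intro tendsto_intros W\<tau> sq lim) auto
      show "(\<lambda>j. deficit (W j) - root_slope * (W j 0 0)\<^sup>2) \<longlonglongrightarrow> d - root_slope * (U 0 0)\<^sup>2"
        by (intro tendsto_intros Wd lim) auto
      have "(\<Sum>n<N. level_excess (W j) n) \<le> deficit (W j) - root_slope * (W j 0 0)\<^sup>2" for j
        using partial_excess_le[OF W, of j N] by linarith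
      then show "\<exists>M. \<forall>j\<ge>M. (\<Sum>n<N. level_excess (W j) n) \<le> deficit (W j) - root_slope * (W j 0 0)\<^sup>2" by blast
    qed
    finally show ?thesis .
  qed
  from suminf_le_const[OF sums_summable[OF level_excess_sums[OF U]] this]
  have dU: "deficit U \<le> d" using sums_unique[OF level_excess_sums[OF U]] by simp
  have "(\<lambda>j. \<Sum>n. 2 ^ n * pow_norm p (W j n)) \<longlonglongrightarrow> (\<Sum>n. 2 ^ n * pow_norm p (U n))"
  proof (rule tannerys_theorem[THEN conjunct2, THEN conjunct2])
    show "(\<lambda>j. 2 ^ n * pow_norm p (W j n)) \<longlonglongrightarrow> 2 ^ n * pow_norm p (U n)" for n
      by (intro tendsto_intros pow)
    show "summable (\<lambda>n. decay_weight p n * D0 powr (p / 2))"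
      by (rule summable_mult2[OF summable_decay_weight[OF p]])
    have "norm (2 ^ n * pow_norm p (W j n)) \<le> decay_weight p n * D0 powr (p / 2)" for n j
    proof -
      have "2 ^ n * pow_norm p (W j n) \<le> decay_weight p n * deficit (W j) powr (p / 2)"
        by (rule pow_norm_level_le[OF W]) (use p in simp)
      also have "\<dots> \<le> decay_weight p n * D0 powr (p / 2)"
        using D0 deficit_nonneg[OF W] p
        by (intro mult_left_mono powr_mono2 decay_weight_nonneg) (auto simp: W_def)
      finally show ?thesis by (simp add: pow_norm_nonneg)
    qed
    then show "\<forall>\<^sub>F (n, j) in sequentially \<times>\<^sub>F sequentially.
        norm (2 ^ n * pow_norm p (W j n)) \<le> decay_weight p n * D0 powr (p / 2)"
      by (intro always_eventually) auto
  qed simp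
  then have "potential p U = P"
    using WP' LIMSEQ_unique unfolding potential_def by blast
  with U mU dU that show ?thesis by blast
qed

section \<open>The variational argument\<close>

text \<open>
  The rest of the argument uses only the set of triples (mass, kinetic energy, potential energy)
  that are attained. The level is studied through the deficit, the kinetic energy in excess of
  \<open>lam\<close> times the mass.
\<close>

locale nls_triples =
  fixes S :: "(real \<times> real \<times> real) set" and lam p :: real
  assumes p: "2 < p" and lam: "0 < lam"
    and scale: "(m, t, P) \<in> S \<Longrightarrow> 0 \<le> c \<Longrightarrow> (c * m, c * t, c powr (p / 2) * P) \<in> S"
    and nonneg: "(m, t, P) \<in> S \<Longrightarrow> 0 \<le> m \<and> lam * m \<le> t \<and> 0 \<le> P"
    and mass_zero: "(0, t, P) \<in> S \<Longrightarrow> t = 0 \<and> P = 0"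
    and pot_pos: "(m, t, P) \<in> S \<Longrightarrow> 0 < m \<Longrightarrow> 0 < P"
    and approx: "0 < \<delta> \<Longrightarrow> \<exists>m t P. (m, t, P) \<in> S \<and> 0 < m \<and> t \<le> (lam + \<delta>) * m"
    and local_bound: "\<exists>C. \<forall>m t P. (m, t, P) \<in> S \<longrightarrow> P \<le> C * (t - lam * m) powr (p / 2)"
    and growth: "0 < \<epsilon> \<Longrightarrow> \<exists>K. \<forall>t P. (1, t, P) \<in> S \<longrightarrow> P \<le> \<epsilon> * t + K"
    and compactness: "(\<And>j::nat. (mj j, tj j, Pj j) \<in> S) \<Longrightarrow> mj \<longlonglongrightarrow> m0 \<Longrightarrow>
      (\<lambda>j. tj j - lam * mj j) \<longlonglongrightarrow> d \<Longrightarrow> Pj \<longlonglongrightarrow> P0 \<Longrightarrow>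
      \<exists>m' t'. (m', t', P0) \<in> S \<and> m' \<le> m0 \<and> t' - lam * m' \<le> d"
begin

definition en :: "real \<Rightarrow> real \<Rightarrow> real" where
  "en t P = 1/2 * t - 1/p * P"

definition level :: "real \<Rightarrow> real" where
  "level \<mu> = Inf {en t P | t P. (\<mu>, t, P) \<in> S}"

definition critical :: "real set" where
  "critical = {\<mu>. 0 \<le> \<mu> \<and> level \<mu> = 1/2 * lam * \<mu>}"

definition threshold :: real where
  "threshold = Sup critical"

lemma slice_nonempty:
  assumes "0 \<le> \<mu>" obtains t P where "(\<mu>, t, P) \<in> S"
proof -
  obtain m t P where "(m, t, P) \<in> S" "0 < m" using approx[of 1] by auto
  then show ?thesis using scale[of m t P "\<mu> / m"] that assms by auto
qed

text \<open>
  Rescaling to mass one carries the growth condition over to all bounded masses.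
\<close>

lemma growth_bounded_mass:
  assumes M: "0 < M" and \<epsilon>: "0 < \<epsilon>"
  obtains K where "0 \<le> K" "\<And>m t P. (m, t, P) \<in> S \<Longrightarrow> m \<le> M \<Longrightarrow> P \<le> \<epsilon> * t + K"
proof -
  define a where "a = p / 2 - 1"
  have a: "a > 0" using p by (simp add: a_def)
  have "0 < \<epsilon> / M powr a" using M \<epsilon> by simp
  then obtain K0 where K0: "\<And>t P. (1, t, P) \<in> S \<Longrightarrow> P \<le> \<epsilon> / M powr a * t + K0"
    using growth by blast
  show ?thesis
  proof (rule that)
    show "0 \<le> \<bar>K0\<bar> * M powr (p / 2)" by simp
    fix m t P assume S: "(m, t, P) \<in> S" and mM: "m \<le> M"
    note n = nonneg[OF S]
    have t0: "t \<ge> 0" using n mult_nonneg_nonneg[of lam m] lam by linarith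
    show "P \<le> \<epsilon> * t + \<bar>K0\<bar> * M powr (p / 2)"
    proof (cases "m = 0")
      case True
      then have "P = 0" using mass_zero S by simp
      then show ?thesis using t0 \<epsilon> by simp
    next
      case False
      then have m: "m > 0" using n by simp
      have "(1, t / m, (1 / m) powr (p / 2) * P) \<in> S"
        using scale[OF S, of "1 / m"] m by simp
      from K0[OF this] have "(1 / m) powr (p / 2) * P \<le> \<epsilon> / M powr a * (t / m) + K0" .
      then have "P / m powr (p / 2) \<le> \<epsilon> / M powr a * (t / m) + \<bar>K0\<bar>"
        using m by (simp add: powr_divide)
      then have "P \<le> (\<epsilon> / M powr a * (t / m) + \<bar>K0\<bar>) * m powr (p / 2)"
        using m by (simp add: pos_divide_le_eq)
      also have "\<dots> = \<epsilon> * t * (m powr a / M powr a) + \<bar>K0\<bar> * m powr (p / 2)"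
      proof -
        have "m powr (p / 2) = m powr a * m"
          using m by (simp add: a_def powr_diff)
        then show ?thesis using m M by (simp add: field_simps)
      qed
      also have "\<dots> \<le> \<epsilon> * t * 1 + \<bar>K0\<bar> * M powr (p / 2)"
      proof (intro add_mono mult_left_mono)
        show "m powr a / M powr a \<le> 1" using m M mM a by (simp add: powr_mono2)
        show "m powr (p / 2) \<le> M powr (p / 2)" using m mM p by (intro powr_mono2) auto
      qed (use \<epsilon> t0 in auto)
      finally show ?thesis by simp
    qed
  qed
qed

lemma kinetic_bound:
  assumes M: "0 < M"
  obtains K where "0 \<le> K" "\<And>m t P. (m, t, P) \<in> S \<Longrightarrow> m \<le> M \<Longrightarrow> t \<le> 4 * (en t P + K)"
    "\<And>m t P. (m, t, P) \<in> S \<Longrightarrow> m \<le> M \<Longrightarrow> P \<le> p / 4 * t + p * K"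
    "\<And>m t P. (m, t, P) \<in> S \<Longrightarrow> m \<le> M \<Longrightarrow> - K \<le> en t P"
proof -
  obtain K where K: "0 \<le> K" "\<And>m t P. (m, t, P) \<in> S \<Longrightarrow> m \<le> M \<Longrightarrow> P \<le> p / 4 * t + K"
  proof (rule growth_bounded_mass[OF M, of "p / 4"])
    fix K assume "0 \<le> K" "\<And>m t P. (m, t, P) \<in> S \<Longrightarrow> m \<le> M \<Longrightarrow> P \<le> p / 4 * t + K"
    then show thesis by (rule that)
  qed (use p in simp)
  have 1: "t / 4 - K / p \<le> en t P" if "(m, t, P) \<in> S" "m \<le> M" for m t P
  proof -
    have "P / p \<le> (p / 4 * t + K) / p" using K(2)[OF that] p by (intro divide_right_mono) auto
    then show ?thesis using p by (simp add: en_def add_divide_distrib)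
  qed
  show ?thesis
  proof (rule that[of "K / p"])
    show "0 \<le> K / p" using K p by simp
    fix m t P assume S: "(m, t, P) \<in> S" "m \<le> M"
    show "t \<le> 4 * (en t P + K / p)" using 1[OF S] by simp
    show "P \<le> p / 4 * t + p * (K / p)" using K(2)[OF S] p by simp
    have "t \<ge> 0" using nonneg[OF S(1)] mult_nonneg_nonneg[of lam m] lam by linarith
    then show "- (K / p) \<le> en t P" using 1[OF S] by linarith
  qed
qed

lemma slice_bdd_below: "bdd_below {en t P | t P. (\<mu>, t, P) \<in> S}"
proof -
  obtain K where K: "\<And>m t P. (m, t, P) \<in> S \<Longrightarrow> m \<le> \<bar>\<mu>\<bar> + 1 \<Longrightarrow> - K \<le> en t P"
  proof (rule kinetic_bound[of "\<bar>\<mu>\<bar> + 1"])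
    fix K assume "\<And>m t P. (m, t, P) \<in> S \<Longrightarrow> m \<le> \<bar>\<mu>\<bar> + 1 \<Longrightarrow> - K \<le> en t P"
    then show thesis by (rule that)
  qed simp
  have "- K \<le> x" if x: "x \<in> {en t P | t P. (\<mu>, t, P) \<in> S}" for x
  proof -
    obtain t P where tP: "x = en t P" "(\<mu>, t, P) \<in> S" using x by blast
    show ?thesis unfolding tP(1) by (rule K[OF tP(2)]) simp
  qed
  then show ?thesis by (rule bdd_belowI)
qed

lemma level_le: "(\<mu>, t, P) \<in> S \<Longrightarrow> level \<mu> \<le> en t P"
  unfolding level_def by (rule cInf_lower[OF _ slice_bdd_below]) blast

lemma level_ge:
  assumes "0 \<le> \<mu>" "\<And>t P. (\<mu>, t, P) \<in> S \<Longrightarrow> x \<le> en t P"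
  shows "x \<le> level \<mu>"
proof -
  obtain t P where "(\<mu>, t, P) \<in> S" by (rule slice_nonempty[OF assms(1)])
  then have "{en t P | t P. (\<mu>, t, P) \<in> S} \<noteq> {}" by blast
  moreover have "x \<le> y" if "y \<in> {en t P | t P. (\<mu>, t, P) \<in> S}" for y
    using that assms(2) by blast
  ultimately show ?thesis unfolding level_def by (rule cInf_greatest)
qed

lemma level_approx:
  assumes "0 \<le> \<mu>" "level \<mu> < x"
  obtains t P where "(\<mu>, t, P) \<in> S" "en t P < x"
proof -
  have "\<exists>t P. (\<mu>, t, P) \<in> S \<and> en t P < x"
  proof (rule ccontr)
    assume none: "\<not> ?thesis"
    have "x \<le> level \<mu>" by (rule level_ge[OF assms(1)]) (use none not_le in blast)
    then show False using assms(2) by simp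
  qed
  then show ?thesis using that by blast
qed

lemma level_0: "level 0 = 0"
proof -
  have en_0: "en t P = 0" if "(0, t, P) \<in> S" for t P using mass_zero[OF that] by (simp add: en_def)
  obtain t P where S: "(0, t, P) \<in> S" by (rule slice_nonempty[of 0]) simp_all
  have "level 0 \<le> 0" using level_le[OF S] en_0[OF S] by simp
  moreover have "0 \<le> level 0" by (rule level_ge) (simp_all add: en_0)
  ultimately show ?thesis by simp
qed

lemma level_le_spec:
  assumes \<mu>: "0 \<le> \<mu>" shows "level \<mu> \<le> 1/2 * lam * \<mu>"
proof (rule field_le_epsilon)
  fix e :: real assume e: "e > 0"
  define \<delta> where "\<delta> = e / (\<mu> + 1)"
  have \<delta>: "\<delta> > 0" "\<delta> * \<mu> \<le> e"
  proof -
    show "\<delta> > 0" using e \<mu> by (simp add: \<delta>_def)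
    have "\<mu> / (\<mu> + 1) \<le> 1" using \<mu> by simp
    then show "\<delta> * \<mu> \<le> e" using mult_left_mono[of "\<mu> / (\<mu> + 1)" 1 e] e by (simp add: \<delta>_def)
  qed
  obtain m t P where S: "(m, t, P) \<in> S" "0 < m" "t \<le> (lam + \<delta>) * m" using approx[OF \<delta>(1)] by blast
  have S': "(\<mu>, \<mu> / m * t, (\<mu> / m) powr (p / 2) * P) \<in> S"
    using scale[OF S(1), of "\<mu> / m"] S(2) \<mu> by simp
  have "level \<mu> \<le> 1/2 * (\<mu> / m * t)"
  proof -
    have "1/p * ((\<mu> / m) powr (p / 2) * P) \<ge> 0" using nonneg[OF S'] p by simp
    then show ?thesis using level_le[OF S'] unfolding en_def by linarith
  qed
  moreover have "\<mu> / m * t \<le> \<mu> / m * ((lam + \<delta>) * m)" using S \<mu> by (intro mult_left_mono) auto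
  moreover have "\<mu> / m * ((lam + \<delta>) * m) = lam * \<mu> + \<delta> * \<mu>" using S(2) by (simp add: field_simps)
  ultimately show "level \<mu> \<le> 1/2 * lam * \<mu> + e" using \<delta> e by simp
qed

text \<open>
  Rescaled to mass \<open>\<mu>\<close>, a triple of mass one has an energy that is a concave function of \<open>\<mu>\<close>,
  because \<open>p / 2\<close> is at least one.
\<close>

lemma level_concave: "concave_on {0..} level"
proof -
  have cvx: "(u * x + v * y) powr (p / 2) \<le> u * x powr (p / 2) + v * y powr (p / 2)"
    if uv: "0 < u" "0 < v" "u + v = 1" and xy: "0 \<le> x" "0 \<le> y" for u v x y
  proof -
    have small: "w powr (p / 2) \<le> w" if "0 < w" "w < 1" for w :: real
      using powr_mono'[of 1 "p / 2" w] p that by simp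
    consider "x = 0" | "y = 0" | "0 < x" "0 < y" using xy unfolding le_less by blast
    then show ?thesis
    proof cases
      case 1
      have "v powr (p / 2) * y powr (p / 2) \<le> v * y powr (p / 2)"
        using small[of v] uv by (intro mult_right_mono) auto
      then show ?thesis using 1 uv xy by (simp add: powr_mult)
    next
      case 2
      have "u powr (p / 2) * x powr (p / 2) \<le> u * x powr (p / 2)"
        using small[of u] uv by (intro mult_right_mono) auto
      then show ?thesis using 2 uv xy by (simp add: powr_mult)
    next
      case 3
      have "convex_on {0<..} (\<lambda>x. x powr (p / 2))" using p by (intro powr_convex) simp
      from convex_onD[OF this, of v x y] have "((1 - v) * x + v * y) powr (p / 2)
          \<le> (1 - v) * x powr (p / 2) + v * y powr (p / 2)" using uv 3 by simp
      moreover have "1 - v = u" using uv by simp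
      ultimately show ?thesis by simp
    qed
  qed
  have main: "u * level x + v * level y \<le> level (u * x + v * y)"
    if uv: "0 < u" "0 < v" "u + v = 1" and xy: "0 \<le> x" "0 \<le> y" for u v x y
  proof (cases "u * x + v * y = 0")
    case True
    then have "x = 0" "y = 0" using uv xy by (simp_all add: add_nonneg_eq_0_iff)
    then show ?thesis by (simp add: level_0)
  next
    case False
    define z where "z = u * x + v * y"
    have "z \<ge> 0" using uv xy by (simp add: z_def)
    then have z: "z > 0" using False by (simp add: z_def)
    show ?thesis
    proof (rule level_ge)
      show "0 \<le> u * x + v * y" using z by (simp add: z_def)
      fix t P assume S: "(u * x + v * y, t, P) \<in> S"
      define T Q where "T = t / z" and "Q = P / z powr (p / 2)"
      have "(1, T, Q) \<in> S"
        using scale[OF S, of "1 / z"] z by (simp add: T_def Q_def z_def[symmetric] powr_divide)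
      note le = level_le[OF scale[OF this], unfolded mult_1_right]
      have Q0: "Q \<ge> 0" using nonneg[OF S] by (simp add: Q_def)
      have "u * level x + v * level y \<le> u * en (x * T) (x powr (p / 2) * Q) + v * en (y * T) (y powr (p / 2) * Q)"
        using le xy uv by (intro add_mono mult_left_mono) auto
      also have "\<dots> = 1/2 * (z * T) - 1/p * ((u * x powr (p / 2) + v * y powr (p / 2)) * Q)"
        by (simp add: en_def z_def algebra_simps)
      also have "\<dots> \<le> 1/2 * (z * T) - 1/p * (z powr (p / 2) * Q)"
        using cvx[OF uv xy] Q0 p unfolding z_def
        by (intro diff_left_mono mult_left_mono mult_right_mono) auto
      also have "\<dots> = en t P" using z by (simp add: en_def T_def Q_def)
      finally show "u * level x + v * level y \<le> en t P" .
    qed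
  qed
  have *: "- level (u * x + v * y) \<le> u * - level x + v * - level y"
    if "0 < u" "0 < v" "u + v = 1" "0 \<le> x" "0 \<le> y" for u v x y
    using main[OF that] by simp
  show ?thesis
    unfolding concave_on_def
  proof (rule convex_onI)
    fix v x y :: real assume "0 < v" "v < 1" "x \<in> {0..}" "y \<in> {0..}"
    then show "- level ((1 - v) *\<^sub>R x + v *\<^sub>R y) \<le> (1 - v) * - level x + v * - level y"
      using *[of "1 - v" v x y] by simp
  qed simp
qed

text \<open>
  Concavity on the segment from mass zero, where the level vanishes.
\<close>

lemma level_ratio:
  assumes "0 \<le> m" "m \<le> \<mu>" "0 < \<mu>"
  shows "m / \<mu> * level \<mu> \<le> level m"
proof -
  have "m / \<mu> * level \<mu> + (1 - m / \<mu>) * level 0 \<le> level (m / \<mu> * \<mu> + (1 - m / \<mu>) * 0)"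
    using convex_onD[OF level_concave[unfolded concave_on_def], of "m / \<mu>" 0 \<mu>] assms
    by (simp add: algebra_simps)
  then show ?thesis using assms by (simp add: level_0)
qed

lemma critical_downward:
  assumes "\<mu> \<in> critical" "0 \<le> m" "m \<le> \<mu>" shows "m \<in> critical"
proof (cases "\<mu> = 0")
  case False
  then have \<mu>: "\<mu> > 0" "level \<mu> = 1/2 * lam * \<mu>" using assms by (auto simp: critical_def)
  have eq: "m / \<mu> * level \<mu> = 1/2 * lam * m" unfolding \<mu>(2) using \<mu>(1) by simp
  have "1/2 * lam * m \<le> level m" using level_ratio[OF assms(2,3) \<mu>(1)] unfolding eq .
  then show ?thesis using level_le_spec[OF assms(2)] assms(2) by (simp add: critical_def)
qed (use assms in simp)

text \<open>
  The local bound is of order \<open>p / 2\<close>, which exceeds one, in the deficit. For small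
  deficit it is therefore below the linear bound.
\<close>

lemma deficit_gap:
  obtains d0 where "0 < d0"
    "\<And>m t P. (m, t, P) \<in> S \<Longrightarrow> t - lam * m \<le> d0 \<Longrightarrow> P \<le> p / 2 * (t - lam * m)"
proof -
  define a where "a = p / 2 - 1"
  have a: "a > 0" "p / 2 = a + 1" using p by (simp_all add: a_def)
  obtain C0 where C0: "\<And>m t P. (m, t, P) \<in> S \<Longrightarrow> P \<le> C0 * (t - lam * m) powr (p / 2)"
    using local_bound by blast
  define C where "C = max C0 1"
  have C: "P \<le> C * (t - lam * m) powr (p / 2)" if "(m, t, P) \<in> S" for m t P
    using C0[OF that] mult_right_mono[of C0 C "(t - lam * m) powr (p / 2)"] unfolding C_def by simp
  have C_pos: "C > 0" by (simp add: C_def)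
  define d0 where "d0 = (p / (2 * C)) powr (1 / a)"
  have d0: "d0 > 0" "C * d0 powr a = p / 2"
    using p C_pos a(1) by (simp_all add: d0_def powr_powr)
  show ?thesis
  proof (rule that[OF d0(1)])
    fix m t P assume S: "(m, t, P) \<in> S" and le: "t - lam * m \<le> d0"
    define D where "D = t - lam * m"
    have D: "0 \<le> D" "D \<le> d0" using nonneg[OF S] le by (simp_all add: D_def)
    have "P \<le> C * D powr (p / 2)" using C[OF S] by (simp add: D_def)
    also have "\<dots> = C * D powr a * D" unfolding a(2) powr_add using D by simp
    also have "\<dots> \<le> C * d0 powr a * D"
      using D a C_pos by (intro mult_right_mono mult_left_mono powr_mono2) auto
    finally show "P \<le> p / 2 * (t - lam * m)" using d0 by (simp add: D_def)
  qed
qed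

text \<open>
  At small mass the potential energy is dominated by the deficit: by the local bound if the
  deficit is small, and because of its higher homogeneity in the mass otherwise.
\<close>

lemma small_mass_critical: "\<exists>m>0. m \<in> critical"
proof -
  define a where "a = p / 2 - 1"
  have a: "a > 0" using p by (simp add: a_def)
  obtain d0 where d0: "d0 > 0"
    "\<And>m t P. (m, t, P) \<in> S \<Longrightarrow> t - lam * m \<le> d0 \<Longrightarrow> P \<le> p / 2 * (t - lam * m)"
    by (rule deficit_gap) (rule that)
  obtain K0 where K0: "\<And>t P. (1, t, P) \<in> S \<Longrightarrow> P \<le> 1 * t + K0" using growth[of 1] by auto
  define K where "K = \<bar>K0\<bar>"
  have K: "P \<le> t + K" if "(1, t, P) \<in> S" for t P using K0[OF that] by (simp add: K_def)
  \<comment> \<open>If \<open>D\<close> is at least \<open>d0\<close>, then \<open>D + lam + K \<le> A * D\<close>.\<close>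
  define A where "A = 1 + (lam + K) / d0"
  have A: "A > 0" using lam d0(1) by (simp add: A_def K_def add_pos_nonneg)
  define m0 where "m0 = min 1 ((p / (2 * A)) powr (1 / a))"
  have m0: "m0 > 0" "m0 \<le> 1" using p A by (simp_all add: m0_def)
  have "m0 powr a \<le> ((p / (2 * A)) powr (1 / a)) powr a"
    using a m0(1) by (intro powr_mono2) (auto simp: m0_def)
  then have m0a: "m0 powr a * A \<le> p / 2" using p A a by (simp add: powr_powr field_simps)
  have "1/2 * lam * m0 \<le> level m0"
  proof (rule level_ge)
    show "0 \<le> m0" using m0 by simp
    fix t P assume S: "(m0, t, P) \<in> S"
    define D where "D = t - lam * m0"
    have D: "D \<ge> 0" using nonneg[OF S] by (simp add: D_def)
    have pa: "p / 2 = a + 1" by (simp add: a_def)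
    have "P \<le> p / 2 * D"
    proof (cases "D \<le> d0")
      case True
      then show ?thesis using d0(2)[OF S] by (simp add: D_def)
    next
      case False
      have "(1, t / m0, P / m0 powr (p / 2)) \<in> S"
        using scale[OF S, of "1 / m0"] m0 by (simp add: powr_divide)
      from K[OF this] have "P \<le> (t / m0 + K) * m0 powr (p / 2)"
        using m0 by (simp add: pos_divide_le_eq)
      also have "\<dots> = m0 powr a * (t + K * m0)"
        unfolding pa powr_add using m0 by (simp add: field_simps)
      also have "\<dots> \<le> m0 powr a * (D * A)"
      proof (intro mult_left_mono)
        have "lam * m0 \<le> lam" "K * m0 \<le> K" using m0 lam by (simp_all add: K_def mult_left_le)
        then have "t + K * m0 \<le> D + (lam + K)" by (simp add: D_def)
        also have "lam + K \<le> D * ((lam + K) / d0)"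
        proof -
          have "1 \<le> D / d0" "0 \<le> lam + K" using False d0(1) lam by (simp_all add: K_def)
          from mult_left_mono[OF this] show ?thesis by (simp add: mult.commute)
        qed
        finally show "t + K * m0 \<le> D * A" by (simp add: A_def distrib_left)
      qed simp
      also have "\<dots> = (m0 powr a * A) * D" by simp
      also have "\<dots> \<le> p / 2 * D" using m0a D by (rule mult_right_mono)
      finally show ?thesis .
    qed
    then have "1/p * P \<le> 1/2 * D" using p by (simp add: field_simps)
    then show "1/2 * lam * m0 \<le> en t P" by (simp add: en_def D_def algebra_simps)
  qed
  then show ?thesis using m0 level_le_spec[of m0] by (intro exI[of _ m0]) (auto simp: critical_def)
qed

lemma level_eventually_negative: "\<forall>\<^sub>F \<mu> in at_top. level \<mu> < 0"
proof -
  define a where "a = p / 2 - 1"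
  have a: "a > 0" using p by (simp add: a_def)
  obtain t P where S: "(1, t, P) \<in> S" using slice_nonempty[of 1] by auto
  have P: "P > 0" using pot_pos[OF S] by simp
  have "filterlim (\<lambda>\<mu>::real. \<mu> powr a) at_top at_top" using a by real_asymp
  then have "\<forall>\<^sub>F \<mu> in at_top. \<mu> powr a > p * t / (2 * P)" by (simp add: filterlim_at_top_dense)
  with eventually_gt_at_top[of 0] show ?thesis
  proof eventually_elim
    case (elim \<mu>)
    have "level \<mu> \<le> en (\<mu> * t) (\<mu> powr (p / 2) * P)"
      using level_le[OF scale[OF S, of \<mu>]] elim by simp
    also have "\<mu> powr (p / 2) = \<mu> powr a * \<mu>" using elim by (simp add: a_def powr_diff)
    also have "en (\<mu> * t) (\<mu> powr a * \<mu> * P) = \<mu> * (t / 2 - \<mu> powr a * P / p)"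
      by (simp add: en_def algebra_simps)
    also have "\<dots> < 0"
    proof (rule mult_pos_neg)
      show "t / 2 - \<mu> powr a * P / p < 0" using elim P p by (simp add: field_simps)
    qed (use elim in simp)
    finally show ?case .
  qed
qed

lemma critical_bdd_above: "bdd_above critical"
proof -
  obtain N where N: "\<And>\<mu>. \<mu> \<ge> N \<Longrightarrow> level \<mu> < 0"
    using level_eventually_negative by (auto simp: eventually_at_top_linorder)
  show ?thesis
  proof (rule bdd_aboveI)
    fix \<mu> assume \<mu>: "\<mu> \<in> critical"
    then have "0 \<le> \<mu>" "level \<mu> = 1/2 * lam * \<mu>" by (simp_all add: critical_def)
    moreover from this have "0 \<le> 1/2 * lam * \<mu>" using lam by simp
    ultimately have "0 \<le> level \<mu>" by simp
    then show "\<mu> \<le> N" using N[of \<mu>] by linarith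
  qed
qed

lemma threshold_pos: "threshold > 0"
proof -
  obtain m where "m > 0" "m \<in> critical" using small_mass_critical by blast
  then show ?thesis
    using cSup_upper[OF _ critical_bdd_above, of m] by (simp add: threshold_def)
qed

lemma below_threshold:
  assumes "0 \<le> \<mu>" "\<mu> < threshold" shows "\<mu> \<in> critical"
proof -
  obtain m where "m \<in> critical" "\<mu> < m"
    using less_cSupD[of critical \<mu>] small_mass_critical assms unfolding threshold_def by blast
  then show ?thesis using critical_downward[OF _ assms(1)] less_imp_le by blast
qed

text \<open>
  A triple at the threshold, scaled down slightly, has critical mass; let the factor tend to one.
\<close>

lemma threshold_critical: "threshold \<in> critical"
proof -
  have "1/2 * lam * threshold \<le> level threshold"
  proof (rule level_ge)
    show "0 \<le> threshold" using threshold_pos by simp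
    fix t P assume S: "(threshold, t, P) \<in> S"
    have "((\<lambda>c. en (c * t) (c powr (p / 2) * P) - 1/2 * lam * (c * threshold))
      \<longlongrightarrow> en (1 * t) (1 powr (p / 2) * P) - 1/2 * lam * (1 * threshold)) (at_left 1)"
      unfolding en_def by (intro tendsto_intros) auto
    moreover have "\<forall>\<^sub>F c in at_left 1. 0 \<le> en (c * t) (c powr (p / 2) * P) - 1/2 * lam * (c * threshold)"
    proof (rule eventually_at_leftI[of 0])
      fix c :: real assume c: "c \<in> {0<..<1}"
      have "c * threshold \<in> critical"
        by (rule below_threshold) (use c threshold_pos in auto)
      then show "0 \<le> en (c * t) (c powr (p / 2) * P) - 1/2 * lam * (c * threshold)"
        using level_le[OF scale[OF S, of c]] c by (simp add: critical_def)
    qed simp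
    ultimately have "0 \<le> en (1 * t) (1 powr (p / 2) * P) - 1/2 * lam * (1 * threshold)"
      by (rule tendsto_lowerbound) simp
    then show "1/2 * lam * threshold \<le> en t P" by simp
  qed
  then show ?thesis
    using threshold_pos level_le_spec[of threshold] by (simp add: critical_def)
qed

lemma critical_iff: "\<mu> \<in> critical \<longleftrightarrow> 0 \<le> \<mu> \<and> \<mu> \<le> threshold"
proof
  assume "\<mu> \<in> critical"
  then show "0 \<le> \<mu> \<and> \<mu> \<le> threshold"
    using cSup_upper[OF _ critical_bdd_above] by (auto simp: threshold_def critical_def)
next
  assume "0 \<le> \<mu> \<and> \<mu> \<le> threshold"
  then show "\<mu> \<in> critical" using critical_downward[OF threshold_critical] by blast
qed

lemma threshold_Greatest: "(GREATEST \<mu>. 0 \<le> \<mu> \<and> level \<mu> = 1/2 * lam * \<mu>) = threshold"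
proof -
  have eq: "(0 \<le> \<mu> \<and> level \<mu> = 1/2 * lam * \<mu>) = (0 \<le> \<mu> \<and> \<mu> \<le> threshold)" for \<mu>
    using critical_iff[of \<mu>] unfolding critical_def mem_Collect_eq .
  show ?thesis unfolding eq by (rule Greatest_equality) (use threshold_pos in auto)
qed

lemma above_threshold:
  assumes "threshold < \<mu>" shows "level \<mu> < 1/2 * lam * \<mu>"
proof -
  have "0 \<le> \<mu>" "\<mu> \<notin> critical" using assms threshold_pos critical_iff[of \<mu>] by auto
  then show ?thesis using level_le_spec[of \<mu>] by (simp add: critical_def less_le)
qed

text \<open>A minimiser below the threshold, rescaled to the threshold, would beat the level there.\<close>

lemma no_minimiser_below_threshold:
  assumes \<mu>: "0 < \<mu>" "\<mu> < threshold" and S: "(\<mu>, t, P) \<in> S"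
  shows "level \<mu> < en t P"
proof -
  define c where "c = threshold / \<mu>"
  have c: "c > 1" using \<mu> by (simp add: c_def)
  have P: "P > 0" by (rule pot_pos[OF S \<mu>(1)])
  have cp: "c < c powr (p / 2)" using powr_less_mono[of 1 "p / 2" c] c p by simp
  have "1/2 * lam * threshold = level threshold" using threshold_critical by (simp add: critical_def)
  also have "\<dots> \<le> en (c * t) (c powr (p / 2) * P)"
    using level_le[OF scale[OF S, of c]] c \<mu> by (simp add: c_def)
  also have "\<dots> < c * en t P"
    using cp P p by (simp add: en_def algebra_simps divide_strict_right_mono)
  finally have lt: "1/2 * lam * threshold < c * en t P" .
  have eq: "1/2 * lam * threshold = c * (1/2 * lam * \<mu>)" using \<mu> by (simp add: c_def)
  have "c * (1/2 * lam * \<mu>) < c * en t P" using lt unfolding eq .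
  moreover have "level \<mu> = 1/2 * lam * \<mu>" using critical_iff[of \<mu>] \<mu> by (simp add: critical_def)
  ultimately show ?thesis using c by simp
qed

text \<open>
  Bounded energy bounds the kinetic and the potential energy, so that both converge along a
  subsequence.
\<close>

lemma limit_triple:
  assumes S: "\<And>j. (m j, t j, P j) \<in> S" and m: "m \<longlonglongrightarrow> m0" and E: "\<And>j. en (t j) (P j) \<le> B"
  obtains k d P0 m' t' where "strict_mono (k :: nat \<Rightarrow> nat)"
    "(\<lambda>j. t (k j) - lam * m (k j)) \<longlonglongrightarrow> d" "(\<lambda>j. P (k j)) \<longlonglongrightarrow> P0"
    "(m', t', P0) \<in> S" "m' \<le> m0" "t' - lam * m' \<le> d"
proof -
  obtain M where M: "M > 0" "\<And>j. \<bar>m j\<bar> \<le> M"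
    using convergent_imp_Bseq[OF convergentI[OF m]] unfolding Bseq_def real_norm_def by blast
  have mM: "m j \<le> M" for j using M(2)[of j] by linarith
  obtain K where K: "\<And>m t P. (m, t, P) \<in> S \<Longrightarrow> m \<le> M \<Longrightarrow> t \<le> 4 * (en t P + K)"
    "\<And>m t P. (m, t, P) \<in> S \<Longrightarrow> m \<le> M \<Longrightarrow> P \<le> p / 4 * t + p * K"
  proof (rule kinetic_bound[OF M(1)])
    fix K assume "\<And>m t P. (m, t, P) \<in> S \<Longrightarrow> m \<le> M \<Longrightarrow> t \<le> 4 * (en t P + K)"
      "\<And>m t P. (m, t, P) \<in> S \<Longrightarrow> m \<le> M \<Longrightarrow> P \<le> p / 4 * t + p * K"
    then show thesis by (rule that)
  qed
  define T where "T = 4 * (B + K)"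
  have tT: "t j \<le> T" for j using K(1)[OF S mM, of j] E[of j] by (simp add: T_def)
  define Q where "Q = p / 4 * T + p * K"
  have PQ: "P j \<le> Q" for j
    using K(2)[OF S mM, of j] mult_left_mono[OF tT, of "p / 4" j] p unfolding Q_def by linarith
  have t0: "0 \<le> t j" "0 \<le> P j" for j
    using nonneg[OF S, of j] mult_nonneg_nonneg[of lam "m j"] lam by linarith+
  obtain k where k: "strict_mono k"
    "\<And>b. b \<in> UNIV \<Longrightarrow> \<exists>l. (\<lambda>j. (\<lambda>j b. if b then t j else P j) (k j) b) \<longlonglongrightarrow> l"
  proof (rule function_convergent_subsequence[of "UNIV :: bool set" "\<lambda>j b. if b then t j else P j" "max T Q"])
    show "norm (if b then t j else P j) \<le> max T Q" for j b
      using tT[of j] PQ[of j] t0[of j] by auto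
  next
    fix k :: "nat \<Rightarrow> nat"
    assume "strict_mono k" "\<And>b. b \<in> UNIV \<Longrightarrow> \<exists>l. (\<lambda>j. if b then t (k j) else P (k j)) \<longlonglongrightarrow> l"
    then show thesis by (rule that)
  qed simp
  from k(2)[of True] k(2)[of False] obtain t1 P0 where
    t1: "(\<lambda>j. t (k j)) \<longlonglongrightarrow> t1" and P0: "(\<lambda>j. P (k j)) \<longlonglongrightarrow> P0" by auto
  have mk: "(\<lambda>j. m (k j)) \<longlonglongrightarrow> m0" using LIMSEQ_subseq_LIMSEQ[OF m k(1)] by (simp add: o_def)
  have d: "(\<lambda>j. t (k j) - lam * m (k j)) \<longlonglongrightarrow> t1 - lam * m0" by (intro tendsto_intros t1 mk)
  from compactness[OF S mk d P0] obtain m' t' where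
    "(m', t', P0) \<in> S" "m' \<le> m0" "t' - lam * m' \<le> t1 - lam * m0" by blast
  then show ?thesis by (rule that[OF k(1) d P0])
qed

text \<open>
  Above the threshold, losing mass in the limit would contradict the strict decrease of the level
  minus \<open>lam / 2\<close> times the mass.
\<close>

lemma minimiser_above_threshold:
  assumes \<mu>: "threshold < \<mu>"
  obtains t P where "(\<mu>, t, P) \<in> S" "en t P = level \<mu>"
proof -
  have \<mu>0: "\<mu> > 0" using \<mu> threshold_pos by simp
  have "\<exists>t P. (\<mu>, t, P) \<in> S \<and> en t P < level \<mu> + 1 / Suc j" for j
    by (rule level_approx[of \<mu> "level \<mu> + 1 / Suc j"]) (use \<mu>0 in auto)
  then obtain t P where S: "\<And>j. (\<mu>, t j, P j) \<in> S" and E: "\<And>j. en (t j) (P j) < level \<mu> + 1 / Suc j"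
    by metis
  have EB: "en (t j) (P j) \<le> level \<mu> + 1" for j
  proof -
    have "(1::real) / Suc j \<le> 1" by simp
    then show ?thesis using E[of j] by linarith
  qed
  obtain k d P0 m t' where k: "strict_mono k" and d: "(\<lambda>j. t (k j) - lam * \<mu>) \<longlonglongrightarrow> d"
    and P0: "(\<lambda>j. P (k j)) \<longlonglongrightarrow> P0" and S': "(m, t', P0) \<in> S" "m \<le> \<mu>" "t' - lam * m \<le> d"
    by (rule limit_triple[of "\<lambda>_. \<mu>" t P \<mu> "level \<mu> + 1", OF S tendsto_const EB]) (rule that)
  have "1/2 * d - 1/p * P0 \<le> level \<mu> - 1/2 * lam * \<mu>"
  proof (rule LIMSEQ_le)
    show "(\<lambda>j. 1/2 * (t (k j) - lam * \<mu>) - 1/p * P (k j)) \<longlonglongrightarrow> 1/2 * d - 1/p * P0"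
      by (intro tendsto_intros d P0)
    have "(\<lambda>j. 1 / real (Suc j)) \<longlonglongrightarrow> 0" by (rule LIMSEQ_inverse_real_of_nat[unfolded inverse_eq_divide])
    then have "(\<lambda>j. 1 / real (Suc (k j))) \<longlonglongrightarrow> 0"
      using LIMSEQ_subseq_LIMSEQ[OF _ k, of "\<lambda>j. 1 / real (Suc j)"] by (simp add: o_def)
    from tendsto_add[OF tendsto_const[of "level \<mu> - 1/2 * lam * \<mu>"] this]
    show "(\<lambda>j. level \<mu> - 1/2 * lam * \<mu> + 1 / real (Suc (k j))) \<longlonglongrightarrow> level \<mu> - 1/2 * lam * \<mu>" by simp
    have "1/2 * (t (k j) - lam * \<mu>) - 1/p * P (k j) \<le> level \<mu> - 1/2 * lam * \<mu> + 1 / real (Suc (k j))" for j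
      using E[of "k j"] by (simp add: en_def algebra_simps)
    then show "\<exists>N. \<forall>j\<ge>N. 1/2 * (t (k j) - lam * \<mu>) - 1/p * P (k j)
        \<le> level \<mu> - 1/2 * lam * \<mu> + 1 / real (Suc (k j))" by blast
  qed
  then have en': "en t' P0 - 1/2 * lam * m \<le> level \<mu> - 1/2 * lam * \<mu>"
    using S'(3) by (simp add: en_def algebra_simps)
  have m0: "m \<ge> 0" using nonneg[OF S'(1)] by simp
  have "\<not> m < \<mu>"
  proof
    assume m\<mu>: "m < \<mu>"
    have g: "level \<mu> - 1/2 * lam * \<mu> < 0" using above_threshold[OF \<mu>] by simp
    have "m / \<mu> * (level \<mu> - 1/2 * lam * \<mu>) = m / \<mu> * level \<mu> - 1/2 * lam * m"
      using \<mu>0 by (simp add: field_simps)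
    also have "\<dots> \<le> level m - 1/2 * lam * m" using level_ratio[OF m0 S'(2) \<mu>0] by simp
    also have "\<dots> \<le> level \<mu> - 1/2 * lam * \<mu>" using level_le[OF S'(1)] en' by linarith
    finally have "m / \<mu> * (level \<mu> - 1/2 * lam * \<mu>) \<le> 1 * (level \<mu> - 1/2 * lam * \<mu>)" by simp
    then have "1 \<le> m / \<mu>" using g by (simp only: mult_le_cancel_right)
    then show False using m\<mu> \<mu>0 by simp
  qed
  then have "m = \<mu>" using S'(2) by simp
  then show ?thesis using that[of t' P0] S'(1) en' level_le[OF S'(1)] by simp
qed

text \<open>
  At the threshold, take a limit of good competitors of slightly larger mass. Their deficits stay
  away from zero by the local bound, so that the potential energy of the limit is positive.
\<close>

lemma minimiser_at_threshold:
  obtains t P where "(threshold, t, P) \<in> S" "en t P = level threshold"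
proof -
  define m where "m j = threshold + 1 / real (Suc j)" for j
  have m_gt: "m j > threshold" for j by (simp add: m_def)
  have "\<exists>t P. (m j, t, P) \<in> S \<and> en t P < 1/2 * lam * m j" for j
    by (rule level_approx[OF _ above_threshold[OF m_gt[of j]]]) (use m_gt[of j] threshold_pos in auto)
  then obtain t P where S: "\<And>j. (m j, t j, P j) \<in> S" and E: "\<And>j. en (t j) (P j) < 1/2 * lam * m j"
    by metis
  have m_le: "m j \<le> threshold + 1" for j by (simp add: m_def)
  have m: "m \<longlonglongrightarrow> threshold"
    using tendsto_add[OF tendsto_const[of threshold] LIMSEQ_inverse_real_of_nat[unfolded inverse_eq_divide]]
    by (simp add: m_def[abs_def])
  have EB: "en (t j) (P j) \<le> 1/2 * lam * (threshold + 1)" for j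
  proof -
    have "1/2 * lam * m j \<le> 1/2 * lam * (threshold + 1)"
      using m_le lam by (intro mult_left_mono) auto
    then show ?thesis using E[of j] by linarith
  qed
  obtain k d P0 m' t' where k: "strict_mono k" and d: "(\<lambda>j. t (k j) - lam * m (k j)) \<longlonglongrightarrow> d"
    and P0: "(\<lambda>j. P (k j)) \<longlonglongrightarrow> P0"
    and S': "(m', t', P0) \<in> S" "m' \<le> threshold" "t' - lam * m' \<le> d"
    by (rule limit_triple[OF S m EB]) (rule that)
  define D where "D j = t j - lam * m j" for j
  have DP: "1/2 * D j < 1/p * P j" for j using E[of j] by (simp add: D_def en_def algebra_simps)
  have "1/2 * d - 1/p * P0 \<le> 0"
  proof (rule LIMSEQ_le_const2)
    show "(\<lambda>j. 1/2 * (t (k j) - lam * m (k j)) - 1/p * P (k j)) \<longlonglongrightarrow> 1/2 * d - 1/p * P0"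
      by (intro tendsto_intros d P0)
    have "1/2 * (t (k j) - lam * m (k j)) - 1/p * P (k j) \<le> 0" for j
      using DP[of "k j"] unfolding D_def by linarith
    then show "\<exists>N. \<forall>j\<ge>N. 1/2 * (t (k j) - lam * m (k j)) - 1/p * P (k j) \<le> 0" by blast
  qed
  then have en': "en t' P0 \<le> 1/2 * lam * m'" using S'(3) by (simp add: en_def algebra_simps)
  obtain d0 where d0: "d0 > 0"
    "\<And>m t P. (m, t, P) \<in> S \<Longrightarrow> t - lam * m \<le> d0 \<Longrightarrow> P \<le> p / 2 * (t - lam * m)"
    by (rule deficit_gap) (rule that)
  have D_ge: "d0 \<le> D j" for j
  proof (rule ccontr)
    assume "\<not> ?thesis"
    then have "P j \<le> p / 2 * D j" using d0(2)[OF S, of j] by (simp add: D_def)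
    then have "1/p * P j \<le> 1/2 * D j" using p by (simp add: field_simps)
    then show False using DP[of j] by simp
  qed
  have "p / 2 * d0 \<le> P0"
  proof (rule LIMSEQ_le_const[OF P0])
    have "p / 2 * d0 \<le> P j" for j
    proof -
      have "p / 2 * d0 \<le> p / 2 * D j" using D_ge p by (intro mult_left_mono) auto
      also have "\<dots> \<le> P j" using DP[of j] p by (simp add: field_simps)
      finally show ?thesis .
    qed
    then show "\<exists>N. \<forall>j\<ge>N. p / 2 * d0 \<le> P (k j)" by blast
  qed
  moreover have "p / 2 * d0 > 0" using d0(1) p by simp
  ultimately have "P0 > 0" by linarith
  have "m' \<noteq> 0"
  proof
    assume "m' = 0"
    then have "(0, t', P0) \<in> S" using S'(1) by simp
    from mass_zero[OF this] show False using \<open>P0 > 0\<close> by simp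
  qed
  then have m': "m' > 0" using nonneg[OF S'(1)] by simp
  have "\<not> m' < threshold"
  proof
    assume lt: "m' < threshold"
    then have "level m' = 1/2 * lam * m'" using critical_iff[of m'] m' by (simp add: critical_def)
    then show False using no_minimiser_below_threshold[OF m' lt S'(1)] en' by simp
  qed
  then have "m' = threshold" using S'(2) by simp
  then show ?thesis
    using that[of t' P0] S'(1) en' level_le[OF S'(1)] threshold_critical by (simp add: critical_def)
qed

end

section \<open>Integration over a tree\<close>

definition level_edges :: "nat \<Rightarrow> nat \<Rightarrow> nat list set" where
  "level_edges k n = {w \<in> tree_verts k. length w = Suc n}"

lemma arcs_eq_levels: "arcs (binary_tree k) = (\<Union>n. level_edges k n)"
proof
  show "arcs (binary_tree k) \<subseteq> (\<Union>n. level_edges k n)"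
  proof
    fix w assume "w \<in> arcs (binary_tree k)"
    then have w: "w \<in> tree_verts k" "w \<noteq> []" by auto
    then obtain i v where "w = i # v" by (cases w) auto
    then show "w \<in> (\<Union>n. level_edges k n)" using w by (auto simp: level_edges_def)
  qed
qed (auto simp: level_edges_def)

lemma level_edges_arcs: "e \<in> level_edges k n \<Longrightarrow> e \<in> arcs (binary_tree k)"
  using arcs_eq_levels by blast

lemma arcs_level: "e \<in> arcs (binary_tree k) \<Longrightarrow> e \<in> level_edges k (length e - 1)"
  unfolding arcs_eq_levels by (auto simp: level_edges_def)

lemma level_edges_0: "level_edges k 0 = (\<lambda>i. [i]) ` {..<k}"
proof -
  have "w \<in> level_edges k 0 \<longleftrightarrow> w \<in> (\<lambda>i. [i]) ` {..<k}" for w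
  proof (cases w)
    case (Cons i v)
    then show ?thesis by (auto simp: level_edges_def Cons_in_tree_verts tree_verts.root)
  qed (auto simp: level_edges_def)
  then show ?thesis by blast
qed

lemma level_edges_Suc:
  "level_edges k (Suc n) = (\<lambda>(i, w). i # w) ` ({..<2} \<times> level_edges k n)"
proof -
  have "v \<in> level_edges k (Suc n) \<longleftrightarrow> v \<in> (\<lambda>(i, w). i # w) ` ({..<2} \<times> level_edges k n)" for v
  proof (cases v)
    case (Cons i w)
    show ?thesis
    proof (cases "w = []")
      case False
      then show ?thesis using Cons by (auto simp: level_edges_def Cons_in_tree_verts)
    qed (use Cons in \<open>auto simp: level_edges_def\<close>)
  qed (auto simp: level_edges_def)
  then show ?thesis by blast
qed

lemma inj_cons_pair: "inj_on (\<lambda>(i, w). i # w) A"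
  by (auto simp: inj_on_def)

lemma finite_level_edges: "finite (level_edges k n)"
  by (induction n) (simp_all add: level_edges_0 level_edges_Suc)

lemma card_level_edges: "card (level_edges k n) = k * 2 ^ n"
proof (induction n)
  case 0
  show ?case by (simp add: level_edges_0 card_image inj_on_def)
next
  case (Suc n)
  then show ?case by (simp add: level_edges_Suc card_image[OF inj_cons_pair] card_cartesian_product)
qed

text \<open>
  Each edge is followed by two edges of the next level.
\<close>

lemma sum_level_edges_tl:
  fixes f :: "nat list \<Rightarrow> real"
  shows "(\<Sum>e\<in>level_edges k (Suc n). f (tl e)) = 2 * (\<Sum>e\<in>level_edges k n. f e)"
proof -
  have "(\<Sum>e\<in>level_edges k (Suc n). f (tl e)) = (\<Sum>(i, w)\<in>{..<2::nat} \<times> level_edges k n. f w)"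
    unfolding level_edges_Suc by (subst sum.reindex[OF inj_cons_pair]) (simp add: case_prod_unfold)
  also have "\<dots> = (\<Sum>i<2::nat. \<Sum>w\<in>level_edges k n. f w)"
    by (rule sum.cartesian_product[symmetric])
  finally show ?thesis by simp
qed

text \<open>
  An integral over the tree is a series of finite sums, because each level has finitely many edges.
\<close>

lemma integral_length_measure:
  fixes F :: "nat list \<times> real \<Rightarrow> real"
  assumes nonneg: "\<And>x. 0 \<le> F x"
    and int: "\<And>e. e \<in> arcs (binary_tree k) \<Longrightarrow> integrable unit_leb (\<lambda>t. F (e, t))"
  defines "A \<equiv> \<lambda>n. \<Sum>e\<in>level_edges k n. \<integral>t. F (e, t) \<partial>unit_leb"
  shows "integrable (length_measure (binary_tree k)) F \<longleftrightarrow> summable A"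
    and "summable A \<Longrightarrow> (\<integral>x. F x \<partial>length_measure (binary_tree k)) = (\<Sum>n. A n)"
proof -
  let ?E = "arcs (binary_tree k)" and ?M = "length_measure (binary_tree k)"
  let ?I = "\<lambda>e. \<integral>t. F (e, t) \<partial>unit_leb"
  have I0: "0 \<le> ?I e" for e using nonneg by simp
  have A0: "0 \<le> A n" for n unfolding A_def by (intro sum_nonneg I0)
  have meas: "F \<in> borel_measurable ?M"
    unfolding length_measure_def
    by (rule measurable_pair_measure_countable1) (use int in auto)
  have "(\<integral>\<^sup>+x. ennreal (F x) \<partial>?M) = (\<integral>\<^sup>+e. \<integral>\<^sup>+t. ennreal (F (e, t)) \<partial>unit_leb \<partial>count_space ?E)"
    using meas unfolding length_measure_def by (intro unit_leb.nn_integral_fst[symmetric]) simp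
  also have "\<dots> = (\<integral>\<^sup>+e. ennreal (?I e) \<partial>count_space ?E)"
    by (rule nn_integral_cong) (use int nonneg in \<open>simp add: nn_integral_eq_integral\<close>)
  also have "\<dots> = (\<integral>\<^sup>+e. (\<Sum>n. ennreal (?I e) * indicator (level_edges k n) e) \<partial>count_space ?E)"
  proof (rule nn_integral_cong)
    fix e assume "e \<in> space (count_space ?E)"
    then have e: "e \<in> level_edges k (length e - 1)" using arcs_level by simp
    have "ennreal (?I e) * indicator (level_edges k n) e = (if n = length e - 1 then ennreal (?I e) else 0)" for n
      using e by (auto simp: level_edges_def indicator_def)
    then show "ennreal (?I e) = (\<Sum>n. ennreal (?I e) * indicator (level_edges k n) e)"
      using sums_unique[OF sums_single[of "length e - 1" "\<lambda>_. ennreal (?I e)"]] by simp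
  qed
  also have "\<dots> = (\<Sum>n. \<integral>\<^sup>+e. ennreal (?I e) * indicator (level_edges k n) e \<partial>count_space ?E)"
    by (rule nn_integral_suminf) simp
  also have "\<dots> = (\<Sum>n. ennreal (A n))"
  proof (rule suminf_cong)
    fix n
    have "(\<integral>\<^sup>+e. ennreal (?I e) * indicator (level_edges k n) e \<partial>count_space ?E)
        = (\<integral>\<^sup>+e. ennreal (?I e) * indicator (level_edges k n) e \<partial>count_space (level_edges k n))"
      by (rule nn_integral_count_space_eq) (use level_edges_arcs in \<open>auto simp: indicator_def\<close>)
    also have "\<dots> = (\<Sum>e\<in>level_edges k n. ennreal (?I e) * indicator (level_edges k n) e)"
      by (rule nn_integral_count_space_finite[OF finite_level_edges])
    also have "\<dots> = (\<Sum>e\<in>level_edges k n. ennreal (?I e))"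
      by (rule sum.cong) simp_all
    also have "\<dots> = ennreal (A n)" unfolding A_def by (rule sum_ennreal) (rule I0)
    finally show "(\<integral>\<^sup>+e. ennreal (?I e) * indicator (level_edges k n) e \<partial>count_space ?E) = ennreal (A n)" .
  qed
  finally have eq: "(\<integral>\<^sup>+x. ennreal (F x) \<partial>?M) = (\<Sum>n. ennreal (A n))" .
  have "integrable ?M F \<longleftrightarrow> (\<integral>\<^sup>+x. ennreal (F x) \<partial>?M) < \<infinity>"
    unfolding integrable_iff_bounded using meas nonneg by simp
  also have "\<dots> \<longleftrightarrow> summable A"
  proof
    assume "(\<integral>\<^sup>+x. ennreal (F x) \<partial>?M) < \<infinity>"
    then have "(\<Sum>n. ennreal (A n)) \<noteq> top" unfolding eq by (simp add: less_top)
    then show "summable A" by (intro summable_suminf_not_top A0) 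
  next
    assume "summable A"
    then show "(\<integral>\<^sup>+x. ennreal (F x) \<partial>?M) < \<infinity>"
      unfolding eq by (simp add: suminf_ennreal2 A0)
  qed
  finally show iff: "integrable ?M F \<longleftrightarrow> summable A" .
  assume s: "summable A"
  then have "ennreal (\<integral>x. F x \<partial>?M) = (\<integral>\<^sup>+x. ennreal (F x) \<partial>?M)"
    using iff nonneg by (intro nn_integral_eq_integral[symmetric]) auto
  also have "\<dots> = ennreal (\<Sum>n. A n)" unfolding eq by (rule suminf_ennreal2[OF A0 s])
  finally show "(\<integral>x. F x \<partial>?M) = (\<Sum>n. A n)"
    using nonneg suminf_nonneg[OF s A0] by (simp add: ennreal_inj)
qed

definition edge_fun :: "(nat list \<times> real \<Rightarrow> real) \<Rightarrow> nat list \<Rightarrow> real \<Rightarrow> real" where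
  "edge_fun u e = (\<lambda>t. u (e, t))"

definition level_mass :: "nat \<Rightarrow> (nat list \<times> real \<Rightarrow> real) \<Rightarrow> nat \<Rightarrow> real" where
  "level_mass k u n = (\<Sum>e\<in>level_edges k n. sq_norm (edge_fun u e))"

definition level_dirichlet :: "nat \<Rightarrow> (nat list \<times> real \<Rightarrow> real) \<Rightarrow> nat \<Rightarrow> real" where
  "level_dirichlet k u n = (\<Sum>e\<in>level_edges k n. dirichlet (edge_fun u e))"

lemma level_mass_nonneg: "0 \<le> level_mass k u n" and level_dirichlet_nonneg: "0 \<le> level_dirichlet k u n"
  by (simp_all add: level_mass_def level_dirichlet_def sum_nonneg sq_norm_nonneg dirichlet_nonneg)

lemma graph_integrals:
  assumes P: "\<And>e. e \<in> arcs (binary_tree k) \<Longrightarrow> primitive (edge_fun u e) (weak_deriv (edge_fun u e))"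
  shows "integrable (length_measure (binary_tree k)) (\<lambda>x. (graph_deriv u x)\<^sup>2 + (u x)\<^sup>2)
      \<longleftrightarrow> summable (level_mass k u) \<and> summable (level_dirichlet k u)"
    and "summable (level_mass k u) \<Longrightarrow>
      (\<integral>x. (u x)\<^sup>2 \<partial>length_measure (binary_tree k)) = (\<Sum>n. level_mass k u n)"
    and "summable (level_dirichlet k u) \<Longrightarrow>
      (\<integral>x. (graph_deriv u x)\<^sup>2 \<partial>length_measure (binary_tree k)) = (\<Sum>n. level_dirichlet k u n)"
proof -
  have i1: "integrable unit_leb (\<lambda>t. (u (e, t))\<^sup>2)" if "e \<in> arcs (binary_tree k)" for e
    using L2_sq_integrable[OF L2_continuous[OF primitive_continuous[OF P[OF that]]]]
    by (simp add: edge_fun_def)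
  have i2: "integrable unit_leb (\<lambda>t. (graph_deriv u (e, t))\<^sup>2)" if "e \<in> arcs (binary_tree k)" for e
    using L2_sq_integrable[OF primitive_L2[OF P[OF that]]]
    by (simp add: edge_fun_def graph_deriv_def)
  have m: "(\<Sum>e\<in>level_edges k n. \<integral>t. (u (e, t))\<^sup>2 \<partial>unit_leb) = level_mass k u n" for n
    by (simp add: level_mass_def sq_norm_def edge_fun_def)
  have d: "(\<Sum>e\<in>level_edges k n. \<integral>t. (graph_deriv u (e, t))\<^sup>2 \<partial>unit_leb) = level_dirichlet k u n" for n
    by (simp add: level_dirichlet_def dirichlet_def edge_fun_def graph_deriv_def)
  have md: "(\<Sum>e\<in>level_edges k n. \<integral>t. (graph_deriv u (e, t))\<^sup>2 + (u (e, t))\<^sup>2 \<partial>unit_leb)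
      = level_dirichlet k u n + level_mass k u n" for n
    unfolding m[symmetric] d[symmetric] sum.distrib[symmetric]
    by (intro sum.cong refl Bochner_Integration.integral_add i1 i2 level_edges_arcs)
  note M = integral_length_measure[of "\<lambda>x. (u x)\<^sup>2" k, unfolded m, OF zero_le_power2 i1]
  note D = integral_length_measure[of "\<lambda>x. (graph_deriv u x)\<^sup>2" k, unfolded d, OF zero_le_power2 i2]
  note MD = integral_length_measure[of "\<lambda>x. (graph_deriv u x)\<^sup>2 + (u x)\<^sup>2" k, unfolded md,
      OF add_nonneg_nonneg[OF zero_le_power2 zero_le_power2] Bochner_Integration.integrable_add[OF i2 i1]]
  have "summable (\<lambda>n. level_dirichlet k u n + level_mass k u n)
      \<longleftrightarrow> summable (level_mass k u) \<and> summable (level_dirichlet k u)"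
  proof
    assume s: "summable (\<lambda>n. level_dirichlet k u n + level_mass k u n)"
    have "summable (level_mass k u)" "summable (level_dirichlet k u)"
      by (rule summable_comparison_test'[OF s, of 0],
          simp add: level_mass_nonneg level_dirichlet_nonneg)+
    then show "summable (level_mass k u) \<and> summable (level_dirichlet k u)" by blast
  qed (auto intro: summable_add)
  then show "integrable (length_measure (binary_tree k)) (\<lambda>x. (graph_deriv u x)\<^sup>2 + (u x)\<^sup>2)
      \<longleftrightarrow> summable (level_mass k u) \<and> summable (level_dirichlet k u)"
    using MD(1) by blast
  show "summable (level_mass k u) \<Longrightarrow>
      (\<integral>x. (u x)\<^sup>2 \<partial>length_measure (binary_tree k)) = (\<Sum>n. level_mass k u n)" by (rule M(2))
  show "summable (level_dirichlet k u) \<Longrightarrow>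
      (\<integral>x. (graph_deriv u x)\<^sup>2 \<partial>length_measure (binary_tree k)) = (\<Sum>n. level_dirichlet k u n)"
    by (rule D(2))
qed

lemma H1_primitive:
  assumes "u \<in> H1 (binary_tree k)" "e \<in> arcs (binary_tree k)"
  shows "primitive (edge_fun u e) (weak_deriv (edge_fun u e))"
  using assms unfolding H1_def continuous_on_graph_def edge_fun_def
  by (intro H1_unit_primitive) blast+

lemma H1_summable:
  assumes "u \<in> H1 (binary_tree k)"
  shows "summable (level_mass k u)" "summable (level_dirichlet k u)"
proof -
  have "integrable (length_measure (binary_tree k)) (\<lambda>x. (graph_deriv u x)\<^sup>2 + (u x)\<^sup>2)"
    using assms by (simp add: H1_def)
  then have "summable (level_mass k u) \<and> summable (level_dirichlet k u)"
    using graph_integrals(1)[of k u, OF H1_primitive[OF assms]] by simp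
  then show "summable (level_mass k u)" "summable (level_dirichlet k u)" by auto
qed

lemma H1_mass_eq: "u \<in> H1 (binary_tree k) \<Longrightarrow>
    (\<integral>x. (u x)\<^sup>2 \<partial>length_measure (binary_tree k)) = (\<Sum>n. level_mass k u n)"
  by (rule graph_integrals(2)[OF H1_primitive H1_summable(1)])

lemma H1_dirichlet_eq: "u \<in> H1 (binary_tree k) \<Longrightarrow>
    (\<integral>x. (graph_deriv u x)\<^sup>2 \<partial>length_measure (binary_tree k)) = (\<Sum>n. level_dirichlet k u n)"
  by (rule graph_integrals(3)[OF H1_primitive H1_summable(2)])


section \<open>Radial functions on a tree\<close>

definition spread :: "(nat \<Rightarrow> real \<Rightarrow> real) \<Rightarrow> nat list \<times> real \<Rightarrow> real" where
  "spread U = (\<lambda>(w, t). U (length w - 1) t)"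

text \<open>
  The words of zeros name the edges of a ray that starts at the root.
\<close>

definition ray_profile :: "(nat list \<times> real \<Rightarrow> real) \<Rightarrow> nat \<Rightarrow> real \<Rightarrow> real" where
  "ray_profile u n t = u (replicate (Suc n) 0, t)"

lemma replicate_in_level: "1 \<le> k \<Longrightarrow> replicate (Suc n) 0 \<in> level_edges k n"
proof (induction n)
  case (Suc n)
  then show ?case by (simp add: level_edges_def Cons_in_tree_verts)
qed (simp add: level_edges_def Cons_in_tree_verts tree_verts.root)

definition has_profile :: "nat \<Rightarrow> (nat list \<times> real \<Rightarrow> real) \<Rightarrow> (nat \<Rightarrow> real \<Rightarrow> real) \<Rightarrow> bool" where
  "has_profile k u U \<longleftrightarrow> (\<forall>n. \<forall>e\<in>level_edges k n. \<forall>t\<in>{0..1}. u (e, t) = U n t)"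

lemma has_profileD: "has_profile k u U \<Longrightarrow> e \<in> level_edges k n \<Longrightarrow> t \<in> {0..1} \<Longrightarrow> edge_fun u e t = U n t"
  by (simp add: has_profile_def edge_fun_def)

lemma has_profile_levels:
  assumes f: "has_profile k u U" and P: "\<And>n. primitive (U n) (Q n)"
  shows "level_mass k u n = real k * (2 ^ n * sq_norm (U n))"
    "level_dirichlet k u n = real k * (2 ^ n * dirichlet (U n))"
    "(\<Sum>e\<in>level_edges k n. pow_norm p (edge_fun u e)) = real k * (2 ^ n * pow_norm p (U n))"
proof -
  have 1: "sq_norm (edge_fun u e) = sq_norm (U n)" if "e \<in> level_edges k n" for e
    by (rule sq_norm_cong) (rule has_profileD[OF f that])
  have 2: "dirichlet (edge_fun u e) = dirichlet (U n)" if "e \<in> level_edges k n" for e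
    by (rule dirichlet_cong[OF P, symmetric]) (rule has_profileD[OF f that, symmetric])
  have 3: "pow_norm p (edge_fun u e) = pow_norm p (U n)" if "e \<in> level_edges k n" for e
    by (rule pow_norm_cong) (rule has_profileD[OF f that])
  show "level_mass k u n = real k * (2 ^ n * sq_norm (U n))"
    "level_dirichlet k u n = real k * (2 ^ n * dirichlet (U n))"
    "(\<Sum>e\<in>level_edges k n. pow_norm p (edge_fun u e)) = real k * (2 ^ n * pow_norm p (U n))"
    unfolding level_mass_def level_dirichlet_def by (simp_all add: 1 2 3 card_level_edges)
qed

lemma has_profile_primitive:
  assumes f: "has_profile k u U" and U: "profile U" and e: "e \<in> level_edges k n"
  shows "primitive (edge_fun u e) (weak_deriv (edge_fun u e))"
proof -
  have "primitive (edge_fun u e) (weak_deriv (U n))"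
    by (rule primitive_cong[OF profile_primitive[OF U]]) (rule has_profileD[OF f e, symmetric], simp_all)
  then show ?thesis by (rule primitive_H1_unit(2))
qed

lemma has_profile_integrals:
  assumes f: "has_profile k u U" and U: "profile U" and p: "p > 2"
  shows "integrable (length_measure (binary_tree k)) (\<lambda>x. (graph_deriv u x)\<^sup>2 + (u x)\<^sup>2)"
    "(\<integral>x. (u x)\<^sup>2 \<partial>length_measure (binary_tree k)) = real k * mass U"
    "(\<integral>x. (graph_deriv u x)\<^sup>2 \<partial>length_measure (binary_tree k)) = real k * kinetic U"
    "(\<integral>x. \<bar>u x\<bar> powr p \<partial>length_measure (binary_tree k)) = real k * potential p U"
proof -
  note L = has_profile_levels[OF f profile_primitive[OF U]]
  have P: "primitive (edge_fun u e) (weak_deriv (edge_fun u e))" if "e \<in> arcs (binary_tree k)" for e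
    by (rule has_profile_primitive[OF f U arcs_level[OF that]])
  have s: "summable (level_mass k u)" "summable (level_dirichlet k u)"
    unfolding L[abs_def] by (intro summable_mult profile_summable U)+
  show "integrable (length_measure (binary_tree k)) (\<lambda>x. (graph_deriv u x)\<^sup>2 + (u x)\<^sup>2)"
    using graph_integrals(1)[of k u, OF P] s by blast
  show "(\<integral>x. (u x)\<^sup>2 \<partial>length_measure (binary_tree k)) = real k * mass U"
    using trans[OF graph_integrals(2)[OF P s(1)] suminf_mult[OF profile_summable(1)[OF U], of "real k", folded L(1)]]
    by (simp add: mass_def)
  show "(\<integral>x. (graph_deriv u x)\<^sup>2 \<partial>length_measure (binary_tree k)) = real k * kinetic U"
    using trans[OF graph_integrals(3)[OF P s(2)] suminf_mult[OF profile_summable(2)[OF U], of "real k", folded L(2)]]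
    by (simp add: kinetic_def)
  have i: "integrable unit_leb (\<lambda>t. \<bar>u (e, t)\<bar> powr p)" if "e \<in> arcs (binary_tree k)" for e
    using continuous_on_integrable_unit[OF continuous_on_abs_powr[OF primitive_continuous[OF P[OF that]], of p]] p
    by (simp add: edge_fun_def)
  have l: "(\<Sum>e\<in>level_edges k n. \<integral>t. \<bar>u (e, t)\<bar> powr p \<partial>unit_leb) = real k * (2 ^ n * pow_norm p (U n))" for n
    unfolding L(3)[symmetric] by (simp add: pow_norm_def edge_fun_def)
  have "(\<integral>x. \<bar>u x\<bar> powr p \<partial>length_measure (binary_tree k)) = (\<Sum>n. real k * (2 ^ n * pow_norm p (U n)))"
    by (rule integral_length_measure(2)[of "\<lambda>x. \<bar>u x\<bar> powr p" k, unfolded l, OF powr_ge_zero i])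
      (auto intro!: summable_mult summable_potential U p)
  also have "\<dots> = real k * potential p U"
    unfolding potential_def by (rule suminf_mult[OF summable_potential[OF U p]])
  finally show "(\<integral>x. \<bar>u x\<bar> powr p \<partial>length_measure (binary_tree k)) = real k * potential p U" .
qed

lemma level_point: "e \<in> level_edges k n \<Longrightarrow> t \<in> {0..1} \<Longrightarrow> (e, t) \<in> points (binary_tree k)"
  using level_edges_arcs by (simp add: points_def)

lemma level_geodesic_dist:
  "e \<in> level_edges k n \<Longrightarrow> t \<in> {0..1} \<Longrightarrow> geodesic_dist (binary_tree k) [] (e, t) = real n + t"
  using geodesic_dist_root[OF level_point] by (simp add: level_edges_def)

lemma radial_has_profile:
  assumes k: "1 \<le> k" and r: "radial (binary_tree k) [] u"
  shows "has_profile k u (ray_profile u)"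
  unfolding has_profile_def ray_profile_def
proof (intro allI ballI)
  fix n e and t :: real assume e: "e \<in> level_edges k n" and t: "t \<in> {0..1}"
  note z = replicate_in_level[OF k, of n]
  have "geodesic_dist (binary_tree k) [] (e, t) = geodesic_dist (binary_tree k) [] (replicate (Suc n) 0, t)"
    unfolding level_geodesic_dist[OF e t] level_geodesic_dist[OF z t] ..
  then show "u (e, t) = u (replicate (Suc n) 0, t)"
    using r level_point[OF e t] level_point[OF z t] unfolding radial_def by blast
qed

lemma radial_profile:
  assumes k: "1 \<le> k" and u: "u \<in> H1 (binary_tree k)" and r: "radial (binary_tree k) [] u"
  shows "profile (ray_profile u)"
proof -
  note f = radial_has_profile[OF k r] and z = replicate_in_level[OF k]
  have P: "primitive (ray_profile u n) (weak_deriv (edge_fun u (replicate (Suc n) 0)))" for n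
    using H1_primitive[OF u level_edges_arcs[OF z[of n]]]
    by (rule primitive_cong) (rule has_profileD[OF f z], simp_all)
  have k0: "real k \<noteq> 0" using k by simp
  show ?thesis
  proof (rule profileI[OF P])
    show "summable (\<lambda>n. 2 ^ n * sq_norm (ray_profile u n))"
      using H1_summable(1)[OF u] k0 unfolding has_profile_levels[OF f P, abs_def]
      by (simp only: summable_cmult_iff) simp
    show "summable (\<lambda>n. 2 ^ n * dirichlet (ray_profile u n))"
      using H1_summable(2)[OF u] k0 unfolding has_profile_levels[OF f P, abs_def]
      by (simp only: summable_cmult_iff) simp
    show "ray_profile u n 1 = ray_profile u (Suc n) 0" for n
    proof -
      have ends: "(1::real) \<in> {0..1}" "(0::real) \<in> {0..1}" by simp_all
      note l = level_geodesic_dist[OF z ends(1), of n] level_geodesic_dist[OF z ends(2), of "Suc n"]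
      have "geodesic_dist (binary_tree k) [] (replicate (Suc n) 0, 1)
          = geodesic_dist (binary_tree k) [] (replicate (Suc (Suc n)) 0, 0)"
        unfolding l by simp
      then show ?thesis
        using r level_point[OF z ends(1), of n] level_point[OF z ends(2), of "Suc n"]
        unfolding radial_def ray_profile_def by blast
    qed
  qed
qed

lemma spread_has_profile: "has_profile k (spread U) U"
  by (simp add: has_profile_def spread_def level_edges_def)

lemma spread_H1:
  assumes U: "profile U"
  shows "spread U \<in> H1 (binary_tree k)"
proof -
  note f = spread_has_profile[of k U]
  have P: "primitive (edge_fun (spread U) e) (weak_deriv (edge_fun (spread U) e))"
    if "e \<in> arcs (binary_tree k)" for e
    by (rule has_profile_primitive[OF f U arcs_level[OF that]])
  let ?f = "\<lambda>v :: nat list. if v = [] then U 0 0 else U (length v - 1) 1"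
  have "spread U (e, 0) = ?f (tl e)" if "e \<in> arcs (binary_tree k)" for e
  proof -
    from that have "e \<noteq> []" by simp
    then obtain i w where e: "e = i # w" by (cases e) auto
    show ?thesis
    proof (cases w)
      case (Cons j v)
      then show ?thesis using profile_glue[OF U, of "length v"] by (simp add: e spread_def)
    qed (simp add: e spread_def)
  qed
  moreover have "spread U (e, 1) = ?f e" if "e \<in> arcs (binary_tree k)" for e
    using that by (simp add: spread_def)
  ultimately have "\<exists>f. \<forall>e\<in>arcs (binary_tree k).
      spread U (e, 0) = f (tail (binary_tree k) e) \<and> spread U (e, 1) = f (head (binary_tree k) e)"
    by (intro exI[of _ ?f]) simp
  moreover have "continuous_on {0..1} (\<lambda>t. spread U (e, t))" "H1_unit (\<lambda>t. spread U (e, t))"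
    if "e \<in> arcs (binary_tree k)" for e
    using primitive_continuous[OF P[OF that]] primitive_H1_unit(1)[OF P[OF that]]
    by (simp_all add: edge_fun_def)
  moreover have "integrable (length_measure (binary_tree k)) (\<lambda>x. (graph_deriv (spread U) x)\<^sup>2 + (spread U x)\<^sup>2)"
    by (rule has_profile_integrals(1)[OF f U, of 3]) simp
  ultimately show ?thesis unfolding H1_def continuous_on_graph_def by blast
qed

lemma spread_radial:
  assumes U: "profile U" shows "radial (binary_tree k) [] (spread U)"
  unfolding radial_def
proof (intro ballI impI)
  fix x y assume x: "x \<in> points (binary_tree k)" and y: "y \<in> points (binary_tree k)"
    and eq: "geodesic_dist (binary_tree k) [] x = geodesic_dist (binary_tree k) [] y"
  obtain e s where x': "x = (e, s)" by (cases x)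
  obtain e' s' where y': "y = (e', s')" by (cases y)
  define n n' where "n = length e - 1" and "n' = length e' - 1"
  have e: "e \<in> level_edges k n" "s \<in> {0..1}" and e': "e' \<in> level_edges k n'" "s' \<in> {0..1}"
    using x y arcs_level unfolding x' y' n_def n'_def by (auto simp only: points_def mem_Times_iff fst_conv snd_conv)
  have d: "real n + s = real n' + s'"
    using eq unfolding x' y' level_geodesic_dist[OF e] level_geodesic_dist[OF e'] .
  have "U n s = U n' s'"
  proof (cases "n = n'")
    case False
    then consider "n < n'" | "n' < n" by linarith
    then show ?thesis
    proof cases
      case 1
      then have "n' = Suc n" "s = 1" "s' = 0" using d e e' by auto
      then show ?thesis using profile_glue[OF U] by simp
    next
      case 2
      then have "n = Suc n'" "s' = 1" "s = 0" using d e e' by auto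
      then show ?thesis using profile_glue[OF U] by simp
    qed
  qed (use d in simp)
  then show "spread U x = spread U y" by (simp add: x' y' spread_def n_def n'_def)
qed


section \<open>The bottom of the spectrum of the tree\<close>

text \<open>
  The edge inequality holds for arbitrary functions. At each vertex other than the root the term
  of the incoming edge cancels those of the two outgoing edges, and the root contributes with the
  right sign.
\<close>

lemma H1_spectral_gap:
  assumes u: "u \<in> H1 (binary_tree k)"
  shows "spec * (\<Sum>n. level_mass k u n) \<le> (\<Sum>n. level_dirichlet k u n)"
proof -
  obtain f where f: "\<And>e. e \<in> arcs (binary_tree k) \<Longrightarrow> u (e, 0) = f (tl e) \<and> u (e, 1) = f e"
    using u unfolding H1_def continuous_on_graph_def by auto
  define V where "V n = (\<Sum>e\<in>level_edges k n. (f e)\<^sup>2)" for n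
  define A where "A n = level_dirichlet k u n - spec * level_mass k u n" for n
  note P = H1_primitive[OF u level_edges_arcs]
  have A: "root_slope * ((\<Sum>e\<in>level_edges k n. (f (tl e))\<^sup>2) - 2 * V n) \<le> A n" for n
  proof -
    have "root_slope * ((f (tl e))\<^sup>2 - 2 * (f e)\<^sup>2) \<le> dirichlet (edge_fun u e) - spec * sq_norm (edge_fun u e)"
      if e: "e \<in> level_edges k n" for e
      using excess_nonneg[of "edge_fun u e" "weak_deriv (edge_fun u e)"] f[OF level_edges_arcs[OF e]]
      unfolding excess_eq[OF P[OF e]] dirichlet_def[symmetric] sq_norm_def[symmetric]
      by (simp add: edge_fun_def algebra_simps)
    then have "(\<Sum>e\<in>level_edges k n. root_slope * ((f (tl e))\<^sup>2 - 2 * (f e)\<^sup>2)) \<le> A n"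
      unfolding A_def level_dirichlet_def level_mass_def sum_distrib_left sum_subtractf[symmetric]
      by (rule sum_mono)
    then show ?thesis by (simp add: V_def sum_distrib_left sum_subtractf right_diff_distrib)
  qed
  have V0: "0 \<le> V n" for n by (simp add: V_def sum_nonneg)
  have part: "- (2 * root_slope * V N) \<le> (\<Sum>n<Suc N. A n)" for N
  proof (induction N)
    case 0
    have "0 \<le> root_slope * (\<Sum>e\<in>level_edges k 0. (f (tl e))\<^sup>2)"
      using root_slope_pos by (intro mult_nonneg_nonneg sum_nonneg) auto
    then show ?case using A[of 0] by (simp add: right_diff_distrib)
  next
    case (Suc N)
    have "(\<Sum>e\<in>level_edges k (Suc N). (f (tl e))\<^sup>2) = 2 * V N"
      unfolding V_def by (rule sum_level_edges_tl)
    then have "root_slope * (2 * V N - 2 * V (Suc N)) \<le> A (Suc N)" using A[of "Suc N"] by simp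
    then show ?case using Suc.IH by (simp add: right_diff_distrib)
  qed
  have s: "summable (level_mass k u)" "summable (level_dirichlet k u)" by (rule H1_summable[OF u])+
  have V_le: "V n \<le> 2 * level_mass k u n + level_dirichlet k u n" for n
  proof -
    have "(f e)\<^sup>2 \<le> 2 * sq_norm (edge_fun u e) + dirichlet (edge_fun u e)" if e: "e \<in> level_edges k n" for e
    proof -
      have "(edge_fun u e 1)\<^sup>2 \<le> sq_norm (edge_fun u e) + 2 * sqrt (sq_norm (edge_fun u e) * dirichlet (edge_fun u e))"
        using primitive_sup_bound[OF P[OF e], of 1] by (simp add: sq_norm_def dirichlet_def)
      moreover have "2 * sqrt (sq_norm (edge_fun u e) * dirichlet (edge_fun u e)) \<le> sq_norm (edge_fun u e) + dirichlet (edge_fun u e)"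
        using arith_geo_mean_sqrt[OF sq_norm_nonneg dirichlet_nonneg, of "edge_fun u e" "edge_fun u e"] by simp
      ultimately show ?thesis using f[OF level_edges_arcs[OF e]] by (simp add: edge_fun_def)
    qed
    then have "V n \<le> (\<Sum>e\<in>level_edges k n. 2 * sq_norm (edge_fun u e) + dirichlet (edge_fun u e))"
      unfolding V_def by (rule sum_mono)
    then show ?thesis by (simp add: level_mass_def level_dirichlet_def sum.distrib sum_distrib_left)
  qed
  have V_lim: "V \<longlonglongrightarrow> 0"
  proof (rule tendsto_sandwich[of "\<lambda>_. 0" V _ "\<lambda>n. 2 * level_mass k u n + level_dirichlet k u n"])
    have "(\<lambda>n. 2 * level_mass k u n + level_dirichlet k u n) \<longlonglongrightarrow> 2 * 0 + 0"
      by (intro tendsto_intros summable_LIMSEQ_zero s)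
    then show "(\<lambda>n. 2 * level_mass k u n + level_dirichlet k u n) \<longlonglongrightarrow> 0" by simp
  qed (use V0 V_le in simp_all)
  have "A sums ((\<Sum>n. level_dirichlet k u n) - spec * (\<Sum>n. level_mass k u n))"
    unfolding A_def by (intro sums_diff sums_mult summable_sums s)
  then have lim: "(\<lambda>N. \<Sum>n<Suc N. A n) \<longlonglongrightarrow> (\<Sum>n. level_dirichlet k u n) - spec * (\<Sum>n. level_mass k u n)"
    unfolding sums_def by (rule LIMSEQ_Suc)
  have lim0: "(\<lambda>N. - (2 * root_slope * V N)) \<longlonglongrightarrow> - (2 * root_slope * 0)"
    by (intro tendsto_intros V_lim)
  have "- (2 * root_slope * 0) \<le> (\<Sum>n. level_dirichlet k u n) - spec * (\<Sum>n. level_mass k u n)"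
    by (rule LIMSEQ_le[OF lim0 lim]) (use part in blast)
  then show ?thesis by simp
qed

text \<open>
  The supremum bound on one edge rules out that a function with a nonzero value has mass zero.
\<close>

lemma H1_mass_pos:
  assumes u: "u \<in> H1 (binary_tree k)" and x: "x \<in> points (binary_tree k)" "u x \<noteq> 0"
  shows "0 < (\<Sum>n. level_mass k u n)"
proof -
  obtain e t where xe: "x = (e, t)" by (cases x)
  then have et: "x = (e, t)" "e \<in> arcs (binary_tree k)" "t \<in> {0..1}"
    using x(1) unfolding points_def by (simp_all only: mem_Times_iff fst_conv snd_conv)
  have "sq_norm (edge_fun u e) \<noteq> 0"
  proof
    assume "sq_norm (edge_fun u e) = 0"
    then have "(edge_fun u e t)\<^sup>2 \<le> 0"
      using primitive_sup_bound[OF H1_primitive[OF u et(2)] et(3)] by (simp add: sq_norm_def)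
    then show False using x(2) et(1) by (simp add: edge_fun_def)
  qed
  then have "0 < sq_norm (edge_fun u e)" using sq_norm_nonneg by (simp add: less_le)
  also have "\<dots> \<le> level_mass k u (length e - 1)"
    unfolding level_mass_def
    by (rule member_le_sum) (use arcs_level[OF et(2)] sq_norm_nonneg finite_level_edges in auto)
  finally have "0 < level_mass k u (length e - 1)" .
  then show ?thesis
    using H1_summable(1)[OF u] level_mass_nonneg by (intro suminf_pos2) auto
qed

text \<open>
  The spectral gap holds for all functions, whereas radial ones suffice to approximate its constant.
\<close>

lemma rayleigh_inf_eq:
  assumes k: "1 \<le> k" shows "rayleigh_inf (binary_tree k) = spec"
proof -
  let ?X = "{u \<in> H1 (binary_tree k). \<exists>x\<in>points (binary_tree k). u x \<noteq> 0}"
  let ?R = "\<lambda>u. (\<integral>x. (graph_deriv u x)\<^sup>2 \<partial>length_measure (binary_tree k))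
    / (\<integral>x. (u x)\<^sup>2 \<partial>length_measure (binary_tree k))"
  have low: "spec \<le> ?R u" if u: "u \<in> ?X" for u
  proof -
    from u have u1: "u \<in> H1 (binary_tree k)" by simp
    from u obtain x where "x \<in> points (binary_tree k)" "u x \<noteq> 0" by blast
    from H1_mass_pos[OF u1 this] H1_spectral_gap[OF u1] show ?thesis
      unfolding H1_mass_eq[OF u1] H1_dirichlet_eq[OF u1] by (simp add: pos_le_divide_eq)
  qed
  have trial: "\<exists>u\<in>?X. ?R u \<le> spec + \<delta>" if \<delta>: "\<delta> > 0" for \<delta>
  proof -
    obtain U where U: "profile U" "mass U > 0" "kinetic U \<le> (spec + \<delta>) * mass U"
      by (rule spec_approximated[OF \<delta>])
    have h: "spread U \<in> H1 (binary_tree k)" by (rule spread_H1[OF U(1)])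
    have m: "(\<integral>x. (spread U x)\<^sup>2 \<partial>length_measure (binary_tree k)) = real k * mass U"
      and t: "(\<integral>x. (graph_deriv (spread U) x)\<^sup>2 \<partial>length_measure (binary_tree k)) = real k * kinetic U"
      by (rule has_profile_integrals[OF spread_has_profile U(1), of 3], simp)+
    have "\<exists>x\<in>points (binary_tree k). spread U x \<noteq> 0"
    proof (rule ccontr)
      assume none: "\<not> ?thesis"
      have "sq_norm (U n) = 0" for n
      proof -
        note z = replicate_in_level[OF k, of n]
        have "U n t = 0" if "t \<in> {0..1}" for t
          using none level_point[OF z that] has_profileD[OF spread_has_profile z that, of U] by (auto simp: edge_fun_def)
        then have "sq_norm (U n) = sq_norm (\<lambda>t. 0)" by (rule sq_norm_cong)
        then show ?thesis by (simp add: sq_norm_def)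
      qed
      then have "mass U = 0" by (simp add: mass_def)
      then show False using U(2) by simp
    qed
    moreover have "?R (spread U) \<le> spec + \<delta>"
      unfolding m t using k U(2,3) by (simp add: pos_divide_le_eq)
    ultimately show ?thesis using h by blast
  qed
  have bdd: "bdd_below (?R ` ?X)" using low by (intro bdd_belowI2)
  have "?X \<noteq> {}" using trial[of 1] by auto
  then have "spec \<le> rayleigh_inf (binary_tree k)"
    unfolding rayleigh_inf_def using low by (intro cINF_greatest)
  moreover have "rayleigh_inf (binary_tree k) \<le> spec"
  proof (rule field_le_epsilon)
    fix e :: real assume "e > 0"
    then obtain u where "u \<in> ?X" "?R u \<le> spec + e" using trial by blast
    then show "rayleigh_inf (binary_tree k) \<le> spec + e"
      unfolding rayleigh_inf_def using cINF_lower[OF bdd] order_trans by blast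
  qed
  ultimately show ?thesis by simp
qed

lemma lambda1_eq: "lambda1 = spec"
  by (simp add: lambda1_def unrooted_binary_tree_def rayleigh_inf_eq)

section \<open>Radial ground states\<close>

text \<open>
  With \<open>k\<close> edges at the root, the tree consists of \<open>k\<close> copies of the rooted tree, which carry the
  same profile.
\<close>

definition triples :: "real \<Rightarrow> nat \<Rightarrow> (real \<times> real \<times> real) set" where
  "triples p k = {(real k * mass U, real k * kinetic U, real k * potential p U) | U. profile U}"

lemma triplesE:
  assumes "(m, t, P) \<in> triples p k"
  obtains U where "profile U" "m = real k * mass U" "t = real k * kinetic U" "P = real k * potential p U"
  using assms unfolding triples_def by blast

text \<open>
  The square wins beyond the point where both powers balance, and the constant is the value there.
\<close>

lemma powr_below_square:
  fixes a \<epsilon> :: real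
  assumes a: "0 < a" "a < 2" and \<epsilon>: "0 < \<epsilon>"
  obtains K where "\<And>x. 0 < x \<Longrightarrow> x powr a \<le> \<epsilon> * x\<^sup>2 + K"
proof -
  define X where "X = (1 / \<epsilon>) powr (1 / (2 - a))"
  have X: "X > 0" "X powr (2 - a) = 1 / \<epsilon>" using a \<epsilon> by (simp_all add: X_def powr_powr)
  have "x powr a \<le> \<epsilon> * x\<^sup>2 + X powr a" if x: "0 < x" for x
  proof (cases "x \<le> X")
    case True
    then have "x powr a \<le> X powr a" using a x by (intro powr_mono2) auto
    moreover have "0 \<le> \<epsilon> * x\<^sup>2" using \<epsilon> by simp
    ultimately show ?thesis by linarith
  next
    case False
    have "1 / \<epsilon> \<le> x powr (2 - a)"
      unfolding X(2)[symmetric] using a X False by (intro powr_mono2) auto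
    then have "1 \<le> \<epsilon> * x powr (2 - a)" using \<epsilon> by (simp add: pos_divide_le_eq mult.commute)
    then have "x powr a * 1 \<le> x powr a * (\<epsilon> * x powr (2 - a))" by (intro mult_left_mono) auto
    also have "\<dots> = \<epsilon> * (x powr a * x powr (2 - a))" by simp
    also have "x powr a * x powr (2 - a) = x\<^sup>2"
      using x by (simp add: powr_add[symmetric])
    finally have "x powr a \<le> \<epsilon> * x\<^sup>2" by simp
    moreover have "0 \<le> X powr a" by simp
    ultimately show ?thesis by linarith
  qed
  then show ?thesis by (rule that)
qed

text \<open>
  Growth of the potential at mass one: the sup bound gives the power \<open>(p - 2) / 4\<close> of the kinetic
  energy, and this is less than one because \<open>p < 6\<close>.
\<close>

lemma triples_nls:
  assumes p: "2 < p" "p < 6" and k: "1 \<le> k"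
  shows "nls_triples (triples p k) spec p"
proof
  have k0: "real k > 0" "real k \<ge> 1" using k by simp_all
  show "2 < p" "0 < spec" using p spec_pos by simp_all
  show "(c * m, c * t, c powr (p / 2) * P) \<in> triples p k"
    if S: "(m, t, P) \<in> triples p k" and "0 \<le> c" for m t P c
  proof -
    obtain U where U: "profile U" "m = real k * mass U" "t = real k * kinetic U" "P = real k * potential p U"
      by (rule triplesE[OF S])
    note sc = profile_scale[OF U(1) that(2) p(1)]
    show ?thesis unfolding triples_def U mem_Collect_eq
      by (rule exI[of _ "\<lambda>n t. sqrt c * U n t"]) (simp add: sc)
  qed
  show "0 \<le> m \<and> spec * m \<le> t \<and> 0 \<le> P" if S: "(m, t, P) \<in> triples p k" for m t P
  proof -
    obtain U where U: "profile U" "m = real k * mass U" "t = real k * kinetic U" "P = real k * potential p U"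
      by (rule triplesE[OF S])
    have "real k * (spec * mass U) \<le> real k * kinetic U"
      using deficit_nonneg[OF U(1)] k0 by (intro mult_left_mono) (simp_all add: deficit_def)
    then show ?thesis
      using mass_nonneg[OF U(1)] potential_nonneg[OF U(1) p(1)] k0 by (simp add: U mult.left_commute)
  qed
  show "t = 0 \<and> P = 0" if S: "(0, t, P) \<in> triples p k" for t P
  proof -
    obtain U where U: "profile U" "0 = real k * mass U" "t = real k * kinetic U" "P = real k * potential p U"
      by (rule triplesE[OF S])
    then have "mass U = 0" using k0 by simp
    then show ?thesis using mass_0_imp[OF U(1)] U by simp
  qed
  show "0 < P" if S: "(m, t, P) \<in> triples p k" and "0 < m" for m t P
  proof -
    obtain U where U: "profile U" "m = real k * mass U" "t = real k * kinetic U" "P = real k * potential p U"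
      by (rule triplesE[OF S])
    then have "mass U > 0" using that(2) k0 by (simp add: zero_less_mult_iff)
    then show ?thesis using potential_pos[OF U(1) p(1)] k0 U by simp
  qed
  show "\<exists>m t P. (m, t, P) \<in> triples p k \<and> 0 < m \<and> t \<le> (spec + \<delta>) * m" if \<delta>: "0 < \<delta>" for \<delta>
  proof -
    obtain U where U: "profile U" "mass U > 0" "kinetic U \<le> (spec + \<delta>) * mass U"
      by (rule spec_approximated[OF \<delta>])
    have "real k * kinetic U \<le> (spec + \<delta>) * (real k * mass U)"
      using mult_left_mono[OF U(3), of "real k"] k0 by (simp add: mult.left_commute)
    moreover have "0 < real k * mass U" using U(2) k0 by simp
    ultimately show ?thesis using U(1) unfolding triples_def by blast
  qed
  show "\<exists>C. \<forall>m t P. (m, t, P) \<in> triples p k \<longrightarrow> P \<le> C * (t - spec * m) powr (p / 2)"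
  proof (intro exI allI impI)
    fix m t P assume "(m, t, P) \<in> triples p k"
    then obtain U where U: "profile U" "m = real k * mass U" "t = real k * kinetic U" "P = real k * potential p U"
      unfolding triples_def by blast
    define W where "W = (\<Sum>n. decay_weight p n)"
    have W: "0 \<le> W" unfolding W_def
      by (intro suminf_nonneg summable_decay_weight p decay_weight_nonneg)
    have td: "t - spec * m = real k * deficit U" by (simp add: U deficit_def algebra_simps)
    have "deficit U \<le> real k * deficit U"
      using mult_right_mono[OF k0(2) deficit_nonneg[OF U(1)]] by simp
    then have "deficit U powr (p / 2) \<le> (t - spec * m) powr (p / 2)"
      unfolding td using deficit_nonneg[OF U(1)] p by (intro powr_mono2) auto
    then have "potential p U \<le> W * (t - spec * m) powr (p / 2)"
      using potential_le_deficit[OF U(1) p(1)] mult_left_mono[OF _ W] order_trans unfolding W_def[symmetric] by blast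
    then have "real k * potential p U \<le> real k * (W * (t - spec * m) powr (p / 2))"
      by (rule mult_left_mono) simp
    then show "P \<le> (real k * (\<Sum>n. decay_weight p n)) * (t - spec * m) powr (p / 2)"
      by (simp add: U(4) W_def mult.assoc)
  qed
  show "\<exists>K. \<forall>t P. (1, t, P) \<in> triples p k \<longrightarrow> P \<le> \<epsilon> * t + K" if \<epsilon>: "0 < \<epsilon>" for \<epsilon>
  proof -
    define a where "a = (p - 2) / 2"
    have a: "0 < a" "a < 2" using p by (simp_all add: a_def)
    obtain K where K: "\<And>x. 0 < x \<Longrightarrow> x powr a \<le> \<epsilon> / 8 * x\<^sup>2 + K"
      by (rule powr_below_square[OF a, of "\<epsilon> / 8"]) (use \<epsilon> in simp, rule that)
    show ?thesis
    proof (intro exI allI impI)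
      fix t P assume "(1, t, P) \<in> triples p k"
      then obtain U where U: "profile U" "1 = real k * mass U" "t = real k * kinetic U" "P = real k * potential p U"
        unfolding triples_def by blast
      have m: "0 \<le> mass U" "mass U \<le> 1"
        using mass_nonneg[OF U(1)] mult_right_mono[OF k0(2) mass_nonneg[OF U(1)]] U(2) by simp_all
      have kin: "0 \<le> kinetic U" "kinetic U \<le> t"
        using kinetic_nonneg[OF U(1)] mult_right_mono[OF k0(2) kinetic_nonneg[OF U(1)]] U(3) by simp_all
      have "mass U * kinetic U \<le> 1 * t" using m kin by (intro mult_mono) auto
      then have "sqrt (mass U * kinetic U) \<le> sqrt t" by simp
      then have "mass U + 2 * sqrt (mass U * kinetic U) \<le> 1 + 2 * sqrt t" using m by linarith
      then have "(mass U + 2 * sqrt (mass U * kinetic U)) powr a \<le> (1 + 2 * sqrt t) powr a"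
        using a m kin by (intro powr_mono2) auto
      then have le: "real k * mass U * (mass U + 2 * sqrt (mass U * kinetic U)) powr a \<le> (1 + 2 * sqrt t) powr a"
        unfolding U(2)[symmetric] by simp
      have "P \<le> real k * ((mass U + 2 * sqrt (mass U * kinetic U)) powr a * mass U)"
        unfolding U(4) a_def by (intro mult_left_mono potential_le_sup U(1) p) simp
      also have "\<dots> = real k * mass U * (mass U + 2 * sqrt (mass U * kinetic U)) powr a" by simp
      also note le
      also have "(1 + 2 * sqrt t) powr a \<le> \<epsilon> / 8 * (1 + 2 * sqrt t)\<^sup>2 + K"
        using kin by (intro K add_pos_nonneg) auto
      also have "\<dots> \<le> \<epsilon> / 8 * (2 + 8 * t) + K"
      proof -
        have t: "0 \<le> t" using kin by linarith
        have "(1 - 2 * sqrt t)\<^sup>2 + (1 + 2 * sqrt t)\<^sup>2 = 2 + 8 * t"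
          using t by (simp add: power2_sum power2_diff power_mult_distrib)
        then have "(1 + 2 * sqrt t)\<^sup>2 \<le> 2 + 8 * t"
          using zero_le_power2[of "1 - 2 * sqrt t"] by linarith
        then show ?thesis using \<epsilon> by (intro add_right_mono mult_left_mono) auto
      qed
      finally show "P \<le> \<epsilon> * t + (\<epsilon> / 4 + K)" by (simp add: algebra_simps)
    qed
  qed
  show "\<exists>m' t'. (m', t', P0) \<in> triples p k \<and> m' \<le> m0 \<and> t' - spec * m' \<le> d"
    if S: "\<And>j::nat. (mj j, tj j, Pj j) \<in> triples p k" and m: "mj \<longlonglongrightarrow> m0"
      and D: "(\<lambda>j. tj j - spec * mj j) \<longlonglongrightarrow> d" and P: "Pj \<longlonglongrightarrow> P0" for mj tj Pj m0 d P0
  proof -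
    have "\<exists>U. profile U \<and> mj j = real k * mass U \<and> tj j = real k * kinetic U \<and> Pj j = real k * potential p U" for j
      using S[of j] unfolding triples_def by blast
    then obtain V where V: "\<And>j. profile (V j)" "\<And>j. mj j = real k * mass (V j)"
      "\<And>j. tj j = real k * kinetic (V j)" "\<And>j. Pj j = real k * potential p (V j)" by metis
    have kn: "real k \<noteq> 0" using k0 by simp
    have 1: "(\<lambda>j. mass (V j)) \<longlonglongrightarrow> m0 / real k" and 3: "(\<lambda>j. potential p (V j)) \<longlonglongrightarrow> P0 / real k"
      using tendsto_divide[OF m tendsto_const kn] tendsto_divide[OF P tendsto_const kn] kn by (simp_all add: V)
    have "deficit (V j) = (tj j - spec * mj j) / real k" for j
      using k0 by (simp add: V deficit_def field_simps)
    then have 2: "(\<lambda>j. deficit (V j)) \<longlonglongrightarrow> d / real k"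
      using tendsto_divide[OF D tendsto_const kn] by simp
    obtain U where U: "profile U" "mass U \<le> m0 / real k" "deficit U \<le> d / real k" "potential p U = P0 / real k"
      by (rule profile_compactness[OF V(1) p(1) 1 2 3])
    have "real k * mass U \<le> m0" using U(2) k0 by (simp add: pos_le_divide_eq mult.commute)
    moreover have "real k * kinetic U - spec * (real k * mass U) \<le> d"
    proof -
      have "real k * deficit U \<le> d" using U(3) k0 by (simp add: pos_le_divide_eq mult.commute)
      then show ?thesis by (simp add: deficit_def algebra_simps)
    qed
    moreover have "P0 = real k * potential p U" using U(4) k0 by simp
    ultimately show ?thesis using U(1) unfolding triples_def by blast
  qed
qed

lemma radial_triple:
  assumes k: "1 \<le> k" and p: "2 < p" and u: "u \<in> H1_mass_radial (binary_tree k) [] \<mu>"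
  obtains t P where "(\<mu>, t, P) \<in> triples p k" "energy p (binary_tree k) u = 1/2 * t - 1/p * P"
proof -
  have u': "u \<in> H1 (binary_tree k)" "(\<integral>x. (u x)\<^sup>2 \<partial>length_measure (binary_tree k)) = \<mu>"
    "radial (binary_tree k) [] u"
    using u by (simp_all add: H1_mass_radial_def H1_mass_def)
  note U = radial_profile[OF k u'(1,3)]
  note I = has_profile_integrals[OF radial_has_profile[OF k u'(3)] U p]
  have "(\<mu>, real k * kinetic (ray_profile u), real k * potential p (ray_profile u)) \<in> triples p k"
    using U unfolding triples_def u'(2)[symmetric] I(2) by blast
  then show ?thesis by (rule that) (simp add: energy_def I)
qed

lemma triple_radial:
  assumes p: "2 < p" and S: "(\<mu>, t, P) \<in> triples p k"
  obtains u where "u \<in> H1_mass_radial (binary_tree k) [] \<mu>" "energy p (binary_tree k) u = 1/2 * t - 1/p * P"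
proof -
  obtain U where U: "profile U" "\<mu> = real k * mass U" "t = real k * kinetic U" "P = real k * potential p U"
    by (rule triplesE[OF S])
  note I = has_profile_integrals[OF spread_has_profile U(1) p]
  have "spread U \<in> H1_mass_radial (binary_tree k) [] \<mu>"
    using spread_H1[OF U(1)] spread_radial[OF U(1)] by (simp add: H1_mass_radial_def H1_mass_def I U(2))
  then show ?thesis by (rule that) (simp add: energy_def I U)
qed

lemma binary_tree_ground_states:
  fixes p :: real
  assumes k: "1 \<le> k" and p: "2 < p" "p < 6"
  defines "G \<equiv> binary_tree k"
  shows "(\<forall>\<mu>\<ge>0. H1_mass_radial G [] \<mu> \<noteq> {} \<and> bdd_below (energy p G ` H1_mass_radial G [] \<mu>))
    \<and> mu_star p G > 0
    \<and> concave_on {0..} (radial_level p G [])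
    \<and> (\<forall>\<mu>\<in>{0..mu_star p G}. radial_level p G [] \<mu> = 1/2 * lambda1 * \<mu>)
    \<and> (\<forall>\<mu>>mu_star p G. radial_level p G [] \<mu> < 1/2 * lambda1 * \<mu>)
    \<and> (\<forall>\<^sub>F \<mu> in at_top. radial_level p G [] \<mu> < 0)
    \<and> (\<forall>\<mu>\<ge>mu_star p G. \<exists>u. radial_ground_state p G [] \<mu> u)
    \<and> (\<forall>\<mu>. 0 < \<mu> \<and> \<mu> < mu_star p G \<longrightarrow> \<not> (\<exists>u. radial_ground_state p G [] \<mu> u))"
proof -
  interpret nls_triples "triples p k" spec p by (rule triples_nls[OF p k])
  have energies: "energy p G ` H1_mass_radial G [] \<mu> = {en t P | t P. (\<mu>, t, P) \<in> triples p k}" for \<mu>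
  proof (intro equalityI subsetI)
    fix x assume "x \<in> energy p G ` H1_mass_radial G [] \<mu>"
    then obtain u where u: "x = energy p G u" "u \<in> H1_mass_radial G [] \<mu>" by blast
    obtain t P where "(\<mu>, t, P) \<in> triples p k" "energy p G u = 1/2 * t - 1/p * P"
      using radial_triple[OF k p(1) u(2)[unfolded G_def]] unfolding G_def by blast
    then show "x \<in> {en t P | t P. (\<mu>, t, P) \<in> triples p k}" unfolding u(1) en_def by blast
  next
    fix x assume "x \<in> {en t P | t P. (\<mu>, t, P) \<in> triples p k}"
    then obtain t P where tP: "x = en t P" "(\<mu>, t, P) \<in> triples p k" by blast
    obtain u where "u \<in> H1_mass_radial G [] \<mu>" "energy p G u = 1/2 * t - 1/p * P"
      using triple_radial[OF p(1) tP(2)] unfolding G_def by blast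
    then show "x \<in> energy p G ` H1_mass_radial G [] \<mu>" unfolding tP(1) en_def by (metis imageI)
  qed
  have lev: "radial_level p G [] = level"
    by (rule ext) (simp only: radial_level_def energies level_def)
  have star: "mu_star p G = threshold"
    unfolding mu_star_def lev lambda1_eq by (rule threshold_Greatest)
  have minimiser_iff: "(\<exists>u. radial_ground_state p G [] \<mu> u) \<longleftrightarrow> (\<exists>t P. (\<mu>, t, P) \<in> triples p k \<and> en t P = level \<mu>)" for \<mu>
  proof -
    have "(\<exists>u. radial_ground_state p G [] \<mu> u) \<longleftrightarrow> level \<mu> \<in> energy p G ` H1_mass_radial G [] \<mu>"
      unfolding radial_ground_state_def lev image_iff Bex_def by (simp only: eq_commute[of "level \<mu>"])
    also have "\<dots> \<longleftrightarrow> (\<exists>t P. (\<mu>, t, P) \<in> triples p k \<and> en t P = level \<mu>)"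
      unfolding energies mem_Collect_eq by metis
    finally show ?thesis .
  qed
  show ?thesis
    unfolding star lev lambda1_eq minimiser_iff
  proof (intro conjI allI impI ballI)
    show "H1_mass_radial G [] \<mu> \<noteq> {}" if \<mu>: "0 \<le> \<mu>" for \<mu>
    proof -
      obtain t P where "(\<mu>, t, P) \<in> triples p k" by (rule slice_nonempty[OF \<mu>])
      from triple_radial[OF p(1) this] show ?thesis unfolding G_def by blast
    qed
    show "bdd_below (energy p G ` H1_mass_radial G [] \<mu>)" for \<mu>
      unfolding energies by (rule slice_bdd_below)
    show "0 < threshold" by (rule threshold_pos)
    show "concave_on {0..} level" by (rule level_concave)
    show "level \<mu> = 1/2 * spec * \<mu>" if "\<mu> \<in> {0..threshold}" for \<mu>
      using critical_iff[of \<mu>] that by (simp add: critical_def)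
    show "level \<mu> < 1/2 * spec * \<mu>" if "threshold < \<mu>" for \<mu>
      by (rule above_threshold[OF that])
    show "\<forall>\<^sub>F \<mu> in at_top. level \<mu> < 0" by (rule level_eventually_negative)
    show "\<exists>t P. (\<mu>, t, P) \<in> triples p k \<and> en t P = level \<mu>" if \<mu>: "threshold \<le> \<mu>" for \<mu>
    proof (cases "\<mu> = threshold")
      case True
      show ?thesis unfolding True by (rule minimiser_at_threshold) blast
    next
      case False
      with \<mu> have "threshold < \<mu>" by simp
      then show ?thesis by (rule minimiser_above_threshold) blast
    qed
    show "\<nexists>t P. (\<mu>, t, P) \<in> triples p k \<and> en t P = level \<mu>" if "0 < \<mu> \<and> \<mu> < threshold" for \<mu>
      using no_minimiser_below_threshold[of \<mu>] that by (metis less_irrefl)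
  qed
qed

theorem theorem1p4:
  fixes p :: real and G :: "(nat list, nat list) pre_digraph"
  assumes "G = unrooted_binary_tree \<or> G = rooted_binary_tree"
    and "2 < p" and "p < 6"
  shows "(\<forall>\<mu>\<ge>0. H1_mass_radial G [] \<mu> \<noteq> {} \<and> bdd_below (energy p G ` H1_mass_radial G [] \<mu>))
    \<and> mu_star p G > 0
    \<and> concave_on {0..} (radial_level p G [])
    \<and> (\<forall>\<mu>\<in>{0..mu_star p G}. radial_level p G [] \<mu> = 1/2 * lambda1 * \<mu>)
    \<and> (\<forall>\<mu>>mu_star p G. radial_level p G [] \<mu> < 1/2 * lambda1 * \<mu>)
    \<and> (\<forall>\<^sub>F \<mu> in at_top. radial_level p G [] \<mu> < 0)
    \<and> (\<forall>\<mu>\<ge>mu_star p G. \<exists>u. radial_ground_state p G [] \<mu> u)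
    \<and> (\<forall>\<mu>. 0 < \<mu> \<and> \<mu> < mu_star p G \<longrightarrow> \<not> (\<exists>u. radial_ground_state p G [] \<mu> u))"
proof -
  obtain k where "G = binary_tree k" "1 \<le> k"
    using assms(1) unfolding unrooted_binary_tree_def rooted_binary_tree_def by force
  then show ?thesis using binary_tree_ground_states[OF _ assms(2,3), of k] by simp
qed

end
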